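(* The automorphism group $\mathrm{Aut}(\mathcal{C})$ of the asymptotic pants complex $\mathcal{C}$ is isomorphic to the semi-direct product $\mathcal{T}\rtimes \mathbb{Z}/2\mathbb{Z}$, where $\mathcal{T}$ is Thompson's group $\mathcal{T}$ and the generator of $\mathbb{Z}/2\mathbb{Z}$ acts on $\mathcal{T}$ by the automorphism $\gamma_R(t)= r\circ t\circ r$, with $r:\mathbb{R}/\mathbb{Z}\to\mathbb{R}/\mathbb{Z}$, $r(x)=-x$.
   Context: Thompson's group $\mathcal{T}$: the group of orientation-preserving piecewise linear homeomorphisms of the circle $S^1=[0,1]/(0\sim 1)=\mathbb{R}/\mathbb{Z}$ with finitely many points of non-differentiability, all of which are dyadic rationals, whose derivatives (where defined) are powers of $2$, and which send the set of dyadic rationals to itself. The complex $\mathcal{C}$: Let $\mathbb{D}^2$ be the hyperbolic disc with boundary circle $\partial\mathbb{D}^2$ parametrized by $\mathbb{R}/\mathbb{Z}$. A dyadic point is an element of $\mathbb{Z}[1/2]/\mathbb{Z}\subset\partial\mathbb{D}^2$. An arc is a bi-infinite geodesic of $\mathbb{D}^2$ joining two distinct dyadic points. For $n\ge 1$ and $0\le a\le 2^n-1$ let $I_a^n$ be the arc joining $a/2^n$ and $(a+1)/2^n$ (so $I_0^1=I_1^1$). The set $E$ of all $I_a^n$ is a triangulation of $\mathbb{D}^2$ into ideal triangles. In general, a triangulation is a set of pairwise non-crossing arcs cutting $\mathbb{D}^2$ into ideal triangles with dyadic vertices. The vertices of $\mathcal{C}$ are the triangulations which differ from $E$ only in finitely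 many triangles. If $v$ is such a triangulation and $a$ is an arc of $v$, the two triangles of $v$ having $a$ as a side form an ideal quadrilateral; flipping $a$ means replacing $a$ by the other diagonal of this quadrilateral. Two vertices of $\mathcal{C}$ are joined by an edge iff one is obtained from the other by flipping one arc. The 2-cells: let $a\neq b$ be two arcs of a vertex $v$. If no triangle of $v$ has both $a$ and $b$ as sides, the flips of $a$ and $b$ commute and define a 4-cycle in the 1-skeleton, filled by a square 2-cell. If some triangle of $v$ has both $a$ and $b$ as sides, the three triangles of $v$ having $a$ or $b$ as a side form an ideal pentagon, and the five triangulations obtained by triangulating this pentagon and keeping the rest of $v$ form a 5-cycle, filled by a pentagonal 2-cell. There is one 2-cell for each such cycle. $\mathrm{Aut}(\mathcal{C})$ is the group of cellular automorphisms of $\mathcal{C}$, i.e. automorphisms of the 1-skeleton graph which, together with their inverses, send boundary cycles of 2-cells to boundary cycles of 2-cells. *)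

theory Defs
  imports "HOL-Analysis.Analysis" "HOL-Algebra.Elementary_Groups" "HOL-Algebra.Bij"
begin

quotient_type circle = real / "\<lambda>x y :: real. x - y \<in> \<int>"
  morphisms rep_circle to_circle
proof (rule equivpI)
  show "reflp (\<lambda>x y :: real. x - y \<in> \<int>)"
    by (simp add: reflp_def)
  show "symp (\<lambda>x y :: real. x - y \<in> \<int>)"
    by (metis (mono_tags, lifting) Ints_minus minus_diff_eq sympI)
  show "transp (\<lambda>x y :: real. x - y \<in> \<int>)"
    by (rule transpI) (metis Ints_add diff_add_cancel add_diff_eq)
qed

lift_definition reflection :: "circle \<Rightarrow> circle" is "\<lambda>x. - x"
  by (metis Ints_minus minus_diff_eq minus_diff_minus)

definition dyadic :: "real set" where
  "dyadic = {x. \<exists>(a::int) (n::nat). x = of_int a / 2 ^ n}"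

definition dyadic_points :: "circle set" where
  "dyadic_points = to_circle ` dyadic"

definition piecewise_linear :: "(real \<Rightarrow> real) \<Rightarrow> bool" where
  "piecewise_linear F \<longleftrightarrow>
     (\<forall>x. \<exists>e>0. \<exists>m m'. (\<forall>y\<in>{x - e..x}. F y = F x + m * (y - x)) \<and>
                     (\<forall>y\<in>{x..x + e}. F y = F x + m' * (y - x)))"

text \<open>
  An orientation-preserving homeomorphism of \<open>\<real>/\<int>\<close> is a map of the circle that has a continuous,
  strictly increasing lift to \<open>\<real>\<close> commuting with the translation by 1.  The lift is unique up
  to adding an integer, so none of the conditions below depends on its choice.
\<close>

definition is_lift :: "(real \<Rightarrow> real) \<Rightarrow> (circle \<Rightarrow> circle) \<Rightarrow> bool" where
  "is_lift F t \<longleftrightarrow>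
     continuous_on UNIV F \<and> strict_mono F \<and> (\<forall>x. F (x + 1) = F x + 1) \<and>
     (\<forall>x. t (to_circle x) = to_circle (F x))"

definition thompson_map :: "(circle \<Rightarrow> circle) \<Rightarrow> bool" where
  "thompson_map t \<longleftrightarrow>
     (\<exists>F. is_lift F t \<and>
          piecewise_linear F \<and>
          finite (to_circle ` {x. \<not> F differentiable (at x)}) \<and>
          to_circle ` {x. \<not> F differentiable (at x)} \<subseteq> dyadic_points \<and>
          (\<forall>x D. (F has_real_derivative D) (at x) \<longrightarrow> (\<exists>k::int. D = 2 powi k))) \<and>
     t ` dyadic_points = dyadic_points"

definition thompson_T :: "(circle \<Rightarrow> circle) monoid" where
  "thompson_T = \<lparr>carrier = {t. thompson_map t}, mult = (\<circ>), one = id\<rparr>"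

definition gamma_R :: "(circle \<Rightarrow> circle) \<Rightarrow> circle \<Rightarrow> circle" where
  "gamma_R t = reflection \<circ> t \<circ> reflection"

definition semidirect_product ::
    "('a, 'c) monoid_scheme \<Rightarrow> ('b, 'd) monoid_scheme \<Rightarrow> ('b \<Rightarrow> 'a \<Rightarrow> 'a) \<Rightarrow> ('a \<times> 'b) monoid" where
  "semidirect_product G H \<phi> =
     \<lparr>carrier = carrier G \<times> carrier H,
      mult = (\<lambda>(g, h) (g', h'). (g \<otimes>\<^bsub>G\<^esub> \<phi> h g', h \<otimes>\<^bsub>H\<^esub> h')),
      one = (\<one>\<^bsub>G\<^esub>, \<one>\<^bsub>H\<^esub>)\<rparr>"

text \<open>
  The hyperbolic disc is the open unit disc in the Klein model, where the bi-infinite geodesics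
  are the open chords and the ideal triangles are the inscribed Euclidean triangles.  A geodesic is
  recorded by the set of its two endpoints and an ideal triangle by the set of its three vertices.
\<close>

abbreviation hyperbolic_disc :: "complex set" where
  "hyperbolic_disc \<equiv> ball 0 1"

lift_definition boundary_point :: "circle \<Rightarrow> complex" is "\<lambda>x. cis (2 * pi * x)"
proof -
  fix x y :: real
  assume "x - y \<in> \<int>"
  then obtain k :: int where "x = y + of_int k"
    by (metis Ints_cases add.commute diff_add_cancel)
  then have "cis (2 * pi * x) = cis (2 * pi * y) * cis (2 * pi * of_int k)"
    by (simp only: cis_mult distrib_left)
  also have "cis (2 * pi * of_int k) = 1"
    by (rule cis_multiple_2pi) simp
  finally show "cis (2 * pi * x) = cis (2 * pi * y)"
    by simp
qed

definition arcs :: "circle set set" where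
  "arcs = {A. A \<subseteq> dyadic_points \<and> card A = 2}"

definition geodesic :: "circle set \<Rightarrow> complex set" where
  "geodesic A = convex hull (boundary_point ` A) \<inter> hyperbolic_disc"

definition dyadic_triangles :: "circle set set" where
  "dyadic_triangles = {T. T \<subseteq> dyadic_points \<and> card T = 3}"

definition open_ideal_triangle :: "circle set \<Rightarrow> complex set" where
  "open_ideal_triangle T = interior (convex hull (boundary_point ` T))"

definition complementary_regions :: "circle set set \<Rightarrow> complex set set" where
  "complementary_regions v = components (hyperbolic_disc - \<Union> (geodesic ` v))"

definition triangulation :: "circle set set \<Rightarrow> bool" where
  "triangulation v \<longleftrightarrow>
     v \<subseteq> arcs \<and>
     pairwise (\<lambda>A B. geodesic A \<inter> geodesic B = {}) v \<and>
     complementary_regions v \<subseteq> open_ideal_triangle ` dyadic_triangles"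

text \<open>A triangle \<open>T\<close> has the arc \<open>A\<close> as a side iff \<open>A \<subseteq> T\<close>.\<close>

definition triangles :: "circle set set \<Rightarrow> circle set set" where
  "triangles v = {T \<in> dyadic_triangles. open_ideal_triangle T \<in> complementary_regions v}"

definition base_triangulation :: "circle set set" where
  "base_triangulation =
     {{to_circle (real a / 2 ^ n), to_circle ((real a + 1) / 2 ^ n)} | a n. n \<ge> 1 \<and> a < 2 ^ n}"

definition pants_vertices :: "circle set set set" where
  "pants_vertices =
     {v. triangulation v \<and>
         finite (triangles v - triangles base_triangulation) \<and>
         finite (triangles base_triangulation - triangles v)}"

text \<open>
  The union of the vertex sets of the two triangles with side \<open>a\<close> is the vertex set of the
  quadrilateral, and the two vertices not on \<open>a\<close> span its other diagonal.
\<close>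

definition flip :: "circle set set \<Rightarrow> circle set \<Rightarrow> circle set set" where
  "flip v a = insert (\<Union> {T \<in> triangles v. a \<subseteq> T} - a) (v - {a})"

definition pants_edges :: "circle set set set set" where
  "pants_edges =
     {{v, w} | v w. v \<in> pants_vertices \<and> w \<in> pants_vertices \<and> (\<exists>a\<in>v. w = flip v a)}"

text \<open>The boundary cycle of a 2-cell is represented by its set of edges.\<close>

definition square_cycles :: "circle set set set set set" where
  "square_cycles =
     {{{v, flip v a}, {flip v a, flip (flip v a) b}, {flip (flip v a) b, flip v b}, {flip v b, v}}
      | v a b. v \<in> pants_vertices \<and> a \<in> v \<and> b \<in> v \<and> a \<noteq> b \<and>
               \<not> (\<exists>T\<in>triangles v. a \<subseteq> T \<and> b \<subseteq> T)}"

definition pentagon :: "circle set set \<Rightarrow> circle set \<Rightarrow> circle set \<Rightarrow> circle set" where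
  "pentagon v a b = \<Union> {T \<in> triangles v. a \<subseteq> T \<or> b \<subseteq> T}"

definition pentagon_triangulations ::
    "circle set set \<Rightarrow> circle set \<Rightarrow> circle set \<Rightarrow> circle set set set" where
  "pentagon_triangulations v a b =
     {w \<in> pants_vertices. \<exists>D \<subseteq> {A. A \<subseteq> pentagon v a b \<and> card A = 2}. w = (v - {a, b}) \<union> D}"

definition pentagon_cycles :: "circle set set set set set" where
  "pentagon_cycles =
     {{e \<in> pants_edges. e \<subseteq> pentagon_triangulations v a b}
      | v a b. v \<in> pants_vertices \<and> a \<in> v \<and> b \<in> v \<and> a \<noteq> b \<and>
               (\<exists>T\<in>triangles v. a \<subseteq> T \<and> b \<subseteq> T)}"

definition two_cells :: "circle set set set set set" where
  "two_cells = square_cycles \<union> pentagon_cycles"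

definition cellular :: "(circle set set \<Rightarrow> circle set set) \<Rightarrow> bool" where
  "cellular f \<longleftrightarrow>
     (\<forall>e\<in>pants_edges. f ` e \<in> pants_edges) \<and>
     (\<forall>c\<in>two_cells. (`) f ` c \<in> two_cells)"

definition Aut_pants_complex :: "(circle set set \<Rightarrow> circle set set) monoid" where
  "Aut_pants_complex =
     BijGroup pants_vertices
       \<lparr>carrier := {f \<in> Bij pants_vertices. cellular f \<and> cellular (inv_into pants_vertices f)}\<rparr>"

end

theory Submission
  imports Defs
begin

text \<open>
  For a set of pairwise non-crossing arcs that differs from the base triangulation in finitely many
  arcs, being a triangulation of the disc amounts to being maximal; this turns vertices, flips and
  2-cells into combinatorics of the cyclic order on dyadic points.  Two flips of a triangulation span
  a unique 2-cell, so a cellular automorphism that fixes a vertex and all its neighbours propagates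
  along flips and is the identity.  Squares and pentagons are distinguished by whether the two flips
  commute, hence an automorphism fixing the base triangulation preserves adjacency of arcs, and
  flipping the common side of two triangles shows that it respects the cyclic order of the
  quadrilateral they form; so it is the identity once it fixes the three sides of one triangle.
  Finally Thompson's group acts transitively on triangulations with a positively oriented triangle:
  this follows from the connectedness of the flip graph together with the rotation by \<open>1/4\<close>, which
  acts on the base triangulation as a flip, and a map of order 3 that permutes the sides of a triangle.
\<close>

subsection \<open>Cyclic order and crossing\<close>

text \<open>The obstacle is infinity: a maximal family of non-crossing arcs need not cut the disc
  into ideal triangles, because arcs may accumulate. Closeness to the base triangulation excludes
  this: from some level on, every standard dyadic arc belongs to the family, so only finitely many
  arcs have length bounded away from 0 and 1. Existence of triangles then becomes the choice of a
  longest or shortest arc (\<open>third_vertex_exists\<close>, \<open>triangle_cover\<close>). The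
  same finiteness links Thompson's group to the complex. A piecewise linear map with dyadic breaks
  and slopes powers of 2 carries all sufficiently small standard intervals affinely onto standard
  intervals, so it sends all but finitely many base arcs to base arcs and acts on vertices. The
  reflection keeps the base triangulation but reverses the cyclic order. An automorphism is
  determined by its effect on the base triangulation and on the flips of three sides of one
  triangle; the image triangle has one of two orientations, whence the factor of order 2. The
  isomorphism sends \<open>(t, k)\<close> to the action of \<open>t\<close> composed with the
  \<open>k\<close>-th power of the reflection, so \<open>gamma_R\<close> appears as
  conjugation.\<close>

definition pos :: "circle \<Rightarrow> real" where
  "pos c = frac (rep_circle c)"

definition cyc :: "circle \<Rightarrow> circle \<Rightarrow> circle \<Rightarrow> bool" where
  "cyc a b c \<longleftrightarrow> pos a < pos b \<and> pos b < pos c \<or> pos b < pos c \<and> pos c < pos a \<or>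
     pos c < pos a \<and> pos a < pos b"

text \<open>Linked pairs of endpoints; all order relations are strict, so two arcs with a common end
  do not cross.\<close>

definition cross :: "circle set \<Rightarrow> circle set \<Rightarrow> bool" where
  "cross A B \<longleftrightarrow> (\<exists>a b c d. A = {a, b} \<and> B = {c, d} \<and> cyc a c b \<and> cyc b d a)"

lemma to_circle_eq_iff: "to_circle x = to_circle y \<longleftrightarrow> x - y \<in> \<int>"
  by (rule circle.abs_eq_iff)

lemma to_circle_rep [simp]: "to_circle (rep_circle c) = c"
  by (rule Quotient_abs_rep[OF Quotient_circle])

lemma frac_eq_frac_iff: "frac x = frac y \<longleftrightarrow> x - y \<in> \<int>"
proof
  assume "frac x = frac y"
  then have "x - y = of_int (\<lfloor>x\<rfloor> - \<lfloor>y\<rfloor>)" by (simp add: frac_def)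
  then show "x - y \<in> \<int>" by (metis Ints_of_int)
next
  assume "x - y \<in> \<int>"
  then obtain k where "x = y + of_int k" by (metis Ints_cases add.commute diff_add_cancel)
  then show "frac x = frac y" by (simp add: frac_def)
qed

lemma pos_to_circle [simp]: "pos (to_circle x) = frac x"
  unfolding pos_def frac_eq_frac_iff using to_circle_eq_iff to_circle_rep by blast

lemma to_circle_pos [simp]: "to_circle (pos c) = c"
proof -
  have "to_circle (pos c) = to_circle (rep_circle c)"
    unfolding to_circle_eq_iff pos_def frac_eq_frac_iff[symmetric] by simp
  then show ?thesis by simp
qed

lemma pos_eq_iff [simp]: "pos a = pos b \<longleftrightarrow> a = b"
  by (metis to_circle_pos)

lemma to_circle_add_int [simp]: "to_circle (x + of_int k) = to_circle x"
  by (simp add: to_circle_eq_iff)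

lemma to_circle_add_1 [simp]: "to_circle (x + 1) = to_circle x"
  by (simp add: to_circle_eq_iff)

lemma cyc_rotate: "cyc a b c \<Longrightarrow> cyc b c a"
  by (auto simp: cyc_def)

lemma cyc_distinct: "cyc a b c \<Longrightarrow> a \<noteq> b \<and> b \<noteq> c \<and> a \<noteq> c"
  by (auto simp: cyc_def)

lemma cyc_asym: "cyc a b c \<Longrightarrow> \<not> cyc c b a"
  by (auto simp: cyc_def)

lemma cyc_linear: "a \<noteq> b \<Longrightarrow> b \<noteq> c \<Longrightarrow> a \<noteq> c \<Longrightarrow> cyc a b c \<or> cyc c b a"
  unfolding cyc_def pos_eq_iff[symmetric] by linarith

lemma floor_within_1: "x < y \<Longrightarrow> y < x + 1 \<Longrightarrow> \<lfloor>y\<rfloor> = \<lfloor>x\<rfloor> \<or> \<lfloor>y\<rfloor> = \<lfloor>x\<rfloor> + 1" for x y :: real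
  by linarith

text \<open>Cutting the circle at another point only rotates the order of the three representatives.
  Together with the converse \<open>cyc_lift\<close>, this turns cyclic statements into linear
  inequalities between lifts in a window of length 1.\<close>

lemma cyc_to_circle:
  assumes "x < y" "y < z" "z < x + 1"
  shows "cyc (to_circle x) (to_circle y) (to_circle z)"
proof -
  have "\<lfloor>y\<rfloor> = \<lfloor>x\<rfloor> \<or> \<lfloor>y\<rfloor> = \<lfloor>x\<rfloor> + 1" "\<lfloor>z\<rfloor> = \<lfloor>x\<rfloor> \<or> \<lfloor>z\<rfloor> = \<lfloor>x\<rfloor> + 1" "\<lfloor>y\<rfloor> \<le> \<lfloor>z\<rfloor>"
    using assms floor_within_1[of x y] floor_within_1[of x z] by (auto intro: floor_mono)
  moreover have "of_int \<lfloor>x\<rfloor> \<le> x" "x < of_int \<lfloor>x\<rfloor> + 1" by linarith+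
  ultimately show ?thesis using assms unfolding cyc_def pos_to_circle frac_def by auto
qed

lemma to_circle_lift: obtains y where "c = to_circle y" "x \<le> y" "y < x + 1"
proof
  \<comment> \<open>The lift of \<open>c\<close> in the window starting at \<open>x\<close>: go from
    \<open>x\<close> by the counterclockwise distance to \<open>c\<close>.\<close>
  let ?y = "x + frac (pos c - x)"
  have "?y = pos c + of_int (- \<lfloor>pos c - x\<rfloor>)" by (simp add: frac_def)
  then show "c = to_circle ?y" by (metis to_circle_add_int to_circle_pos)
  show "x \<le> ?y" "?y < x + 1" by (auto simp: frac_lt_1)
qed

lemma to_circle_lift_neq:
  assumes "c \<noteq> to_circle x"
  obtains y where "c = to_circle y" "x < y" "y < x + 1"
  using to_circle_lift[of c x] assms by (metis order_le_less)

lemma cyc_lift: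
  assumes "cyc (to_circle x) b c"
  obtains y z where "b = to_circle y" "c = to_circle z" "x < y" "y < z" "z < x + 1"
proof -
  obtain y where y: "b = to_circle y" "x < y" "y < x + 1"
    using to_circle_lift_neq[of b x] cyc_distinct[OF assms] by blast
  obtain z where z: "c = to_circle z" "x < z" "z < x + 1"
    using to_circle_lift_neq[of c x] cyc_distinct[OF assms] by blast
  have "\<not> z < y" using cyc_to_circle[of x z y] y z assms cyc_asym cyc_rotate by blast
  moreover have "z \<noteq> y" using y z cyc_distinct[OF assms] by auto
  ultimately show ?thesis using that y z by auto
qed

lemma cyc_lift_between:
  assumes "cyc (to_circle x) c (to_circle y)" "x < y" "y < x + 1"
  obtains z where "c = to_circle z" "x < z" "z < y"
proof -
  obtain z w where zw: "c = to_circle z" "to_circle y = to_circle w" "x < z" "z < w" "w < x + 1"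
    using cyc_lift[OF assms(1)] by metis
  then have "frac y = frac w" by (metis pos_to_circle)
  then have "y - w \<in> \<int>" by (simp add: frac_eq_frac_iff)
  then obtain k where "y - w = of_int k" by (auto elim: Ints_cases)
  \<comment> \<open>Both \<open>y\<close> and \<open>w\<close> lie in the same open window of length
    1, so the integer by which they differ is 0.\<close>
  moreover from this have "-1 < k" "k < 1" using zw assms by linarith+
  ultimately have "y = w" by auto
  then show ?thesis using that zw by auto
qed

text \<open>An arc is an unordered pair; renaming the ends of one arc leaves exactly these two
  alternatives.\<close>

lemma cross_iff: "cross {a, b} {c, d} \<longleftrightarrow> cyc a c b \<and> cyc b d a \<or> cyc a d b \<and> cyc b c a"
proof
  assume "cross {a, b} {c, d}"
  then obtain a' b' c' d' where "{a, b} = {a', b'}" "{c, d} = {c', d'}" "cyc a' c' b'" "cyc b' d' a'"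
    unfolding cross_def by blast
  then show "cyc a c b \<and> cyc b d a \<or> cyc a d b \<and> cyc b c a"
    by (auto simp: doubleton_eq_iff)
next
  assume "cyc a c b \<and> cyc b d a \<or> cyc a d b \<and> cyc b c a"
  then show "cross {a, b} {c, d}"
  proof
    assume "cyc a c b \<and> cyc b d a"
    then show ?thesis unfolding cross_def by (intro exI[of _ a] exI[of _ b] exI[of _ c] exI[of _ d]) simp
  next
    assume "cyc a d b \<and> cyc b c a"
    then show ?thesis unfolding cross_def
      by (intro exI[of _ a] exI[of _ b] exI[of _ d] exI[of _ c]) (simp add: insert_commute)
  qed
qed

lemma cross_sym:
  assumes "cross A B"
  shows "cross B A"
proof -
  obtain a b c d where "A = {a, b}" "B = {c, d}" "cyc a c b" "cyc b d a"
    using assms unfolding cross_def by blast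
  moreover from this have "cyc c b d" "cyc d a c" unfolding cyc_def by linarith+
  ultimately show ?thesis by (simp add: cross_iff)
qed

subsection \<open>The base triangulation\<close>

text \<open>The index is any integer, with period \<open>2 ^ n\<close>
  (\<open>stdarc_shift\<close>), so neighbouring and halved intervals need no wrap-around. At level
  0 both ends coincide, hence the condition \<open>n \<ge> 1\<close> in what follows.\<close>

definition stdarc :: "nat \<Rightarrow> int \<Rightarrow> circle set" where
  "stdarc n i = {to_circle (of_int i / 2 ^ n), to_circle ((of_int i + 1) / 2 ^ n)}"

definition grid :: "nat \<Rightarrow> circle set" where
  "grid n = range (\<lambda>i::int. to_circle (of_int i / 2 ^ n))"

abbreviation "E \<equiv> base_triangulation"

lemma grid_shift: "to_circle (of_int (i + k * 2 ^ n) / 2 ^ n) = to_circle (of_int i / 2 ^ n)"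
  by (simp add: to_circle_eq_iff add_divide_distrib)

lemma stdarc_shift: "stdarc n (i + k * 2 ^ n) = stdarc n i"
  using grid_shift[of i k n] grid_shift[of "i + 1" k n]
  by (simp add: stdarc_def algebra_simps)

lemma base_eq: "E = {stdarc n i | n i. n \<ge> 1}"
proof (intro equalityI subsetI)
  fix A assume "A \<in> E"
  then obtain a n where "A = {to_circle (real a / 2 ^ n), to_circle ((real a + 1) / 2 ^ n)}" "n \<ge> 1"
    unfolding base_triangulation_def by auto
  then have "A = stdarc n (int a)" by (simp add: stdarc_def)
  then show "A \<in> {stdarc n i | n i. n \<ge> 1}" using \<open>n \<ge> 1\<close> by blast
next
  fix A assume "A \<in> {stdarc n i | n i. n \<ge> 1}"
  then obtain n i where A: "A = stdarc n i" "n \<ge> 1" by auto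
  define a where "a = nat (i mod 2 ^ n)"
  have "i = int a + (i div 2 ^ n) * 2 ^ n" by (simp add: a_def mod_div_mult_eq)
  then have "A = stdarc n (int a)" using stdarc_shift A by metis
  moreover have "a < 2 ^ n"
    using pos_mod_bound[of "2 ^ n" i] by (simp add: a_def nat_less_iff)
  ultimately show "A \<in> E" unfolding base_triangulation_def stdarc_def
    using A(2) by force
qed

lemma stdarc_in_base [intro]: "n \<ge> 1 \<Longrightarrow> stdarc n i \<in> E"
  by (auto simp: base_eq)

lemma dyadic_points_eq: "dyadic_points = (\<Union>n. grid n)"
  by (fastforce simp: dyadic_points_def dyadic_def grid_def)

lemma grid_mono: "m \<le> n \<Longrightarrow> grid m \<subseteq> grid n"
proof
  fix c assume "m \<le> n" "c \<in> grid m"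
  then obtain i where "c = to_circle (of_int i / 2 ^ m)" by (auto simp: grid_def)
  also have "of_int i / 2 ^ m = (of_int (i * 2 ^ (n - m)) / 2 ^ n :: real)"
  proof -
    have "(2::real) ^ n = 2 ^ m * 2 ^ (n - m)" using \<open>m \<le> n\<close> by (simp flip: power_add)
    then show ?thesis by simp
  qed
  finally show "c \<in> grid n" unfolding grid_def by (rule range_eqI)
qed

lemma finite_grid: "finite (grid n)"
proof -
  have "grid n \<subseteq> (\<lambda>i::int. to_circle (of_int i / 2 ^ n)) ` {0..<2 ^ n}"
  proof
    fix c assume "c \<in> grid n"
    then obtain i where c: "c = to_circle (of_int i / 2 ^ n)" by (auto simp: grid_def)
    have "i = i mod 2 ^ n + (i div 2 ^ n) * 2 ^ n" by (simp add: mod_div_mult_eq)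
    then have "c = to_circle (of_int (i mod 2 ^ n) / 2 ^ n)" using c grid_shift by metis
    then show "c \<in> (\<lambda>i::int. to_circle (of_int i / 2 ^ n)) ` {0..<2 ^ n}" by auto
  qed
  then show ?thesis by (rule finite_subset) auto
qed

lemma finite_subset_grid: "finite S \<Longrightarrow> S \<subseteq> dyadic_points \<Longrightarrow> \<exists>n. S \<subseteq> grid n"
proof (induction S rule: finite_induct)
  case (insert x S)
  then obtain n m where "S \<subseteq> grid n" "x \<in> grid m" by (auto simp: dyadic_points_eq)
  then have "insert x S \<subseteq> grid (max n m)"
    using grid_mono[of n "max n m"] grid_mono[of m "max n m"] by auto
  then show ?case by blast
qed auto

lemma stdarc_subset_grid: "stdarc n i \<subseteq> grid n"
proof -
  have "to_circle ((of_int i + 1) / 2 ^ n) \<in> grid n"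
    unfolding grid_def by (rule range_eqI[of _ _ "i + 1"]) simp
  then show ?thesis by (auto simp: stdarc_def grid_def)
qed

lemma stdarc_points_neq:
  "n \<ge> 1 \<Longrightarrow> to_circle (of_int i / 2 ^ n) \<noteq> to_circle ((of_int i + 1) / 2 ^ n)"
proof
  assume n: "n \<ge> 1" and "to_circle (of_int i / 2 ^ n) = to_circle ((of_int i + 1) / 2 ^ n)"
  then have "(of_int i + 1) / 2 ^ n - of_int i / 2 ^ n \<in> (\<int> :: real set)"
    by (metis to_circle_eq_iff)
  then have "1 / 2 ^ n \<in> (\<int> :: real set)" by (simp add: diff_divide_distrib[symmetric])
  then obtain k where k: "1 / 2 ^ n = (of_int k :: real)" by (auto elim: Ints_cases)
  have "0 < 1 / (2 ^ n :: real)" by simp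
  moreover have "1 / (2 ^ n :: real) < 1" using n by simp
  ultimately have "0 < k" "k < 1" unfolding k by linarith+
  then show False by simp
qed

lemma stdarc_in_arcs: "n \<ge> 1 \<Longrightarrow> stdarc n i \<in> arcs"
proof -
  assume "n \<ge> 1"
  then have "card (stdarc n i) = 2"
    using stdarc_points_neq by (simp add: stdarc_def)
  moreover have "stdarc n i \<subseteq> dyadic_points"
    using stdarc_subset_grid by (auto simp: dyadic_points_eq)
  ultimately show ?thesis by (simp add: arcs_def)
qed

text \<open>Points of lower level are also points of level \<open>n\<close>, and scaling by
  \<open>2 ^ n\<close> leaves an integer strictly between \<open>i\<close> and
  \<open>i + 1\<close>.\<close>

lemma grid_not_inside:
  assumes "cyc (to_circle (of_int i / 2 ^ n)) c (to_circle ((of_int i + 1) / 2 ^ n))"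
    and "c \<in> grid m" "m \<le> n" "n \<ge> 1"
  shows False
proof -
  have "c \<in> grid n" using assms grid_mono by blast
  then obtain j where j: "c = to_circle (of_int j / 2 ^ n)" by (auto simp: grid_def)
  have "of_int i / 2 ^ n < (of_int i + 1) / (2 ^ n :: real)" by (simp add: divide_strict_right_mono)
  moreover have "(of_int i + 1) / (2 ^ n :: real) < of_int i / 2 ^ n + 1"
    using \<open>n \<ge> 1\<close> by (simp add: field_simps)
  ultimately obtain z where z: "c = to_circle z" "of_int i / 2 ^ n < z" "z < (of_int i + 1) / 2 ^ n"
    using cyc_lift_between[OF assms(1)] by metis
  from j z(1) have "z - of_int j / 2 ^ n \<in> \<int>" by (metis to_circle_eq_iff)
  then obtain k where k: "z - of_int j / 2 ^ n = of_int k" by (auto elim: Ints_cases)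
  then have "z * 2 ^ n = of_int (k * 2 ^ n + j)" by (simp add: field_simps)
  moreover have "of_int i < z * 2 ^ n" "z * 2 ^ n < of_int (i + 1)"
    using z by (simp_all add: field_simps)
  ultimately have "i < k * 2 ^ n + j" "k * 2 ^ n + j < i + 1"
    by (metis of_int_less_iff)+
  then show False by simp
qed

text \<open>Crossing would put an end of \<open>B\<close> strictly inside the dyadic interval cut
  off by the standard arc, where no point of level at most \<open>n\<close> lies.\<close>

lemma stdarc_not_cross_grid:
  assumes "B \<subseteq> grid m" "m \<le> n" "n \<ge> 1"
  shows "\<not> cross (stdarc n i) B"
proof
  assume "cross (stdarc n i) B"
  then obtain a b c d where *: "stdarc n i = {a, b}" "B = {c, d}" "cyc a c b" "cyc b d a"
    unfolding cross_def by blast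
  then consider "a = to_circle (of_int i / 2 ^ n)" "b = to_circle ((of_int i + 1) / 2 ^ n)"
    | "b = to_circle (of_int i / 2 ^ n)" "a = to_circle ((of_int i + 1) / 2 ^ n)"
    unfolding stdarc_def doubleton_eq_iff by blast
  then show False
  proof cases
    case 1
    then show ?thesis using grid_not_inside[of i n c m] * assms by auto
  next
    case 2
    then show ?thesis using grid_not_inside[of i n d m] * assms by auto
  qed
qed

lemma base_not_cross: "A \<in> E \<Longrightarrow> B \<in> E \<Longrightarrow> \<not> cross A B"
proof -
  have *: "\<not> cross (stdarc n i) (stdarc m j)" if "n \<ge> 1" "m \<le> n" for n m i j
    using stdarc_not_cross_grid[OF stdarc_subset_grid] that by blast
  assume "A \<in> E" "B \<in> E"
  then obtain n m i j where "A = stdarc n i" "B = stdarc m j" "n \<ge> 1" "m \<ge> 1"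
    by (auto simp: base_eq)
  then show ?thesis using *[of n m i j] *[of m n j i] cross_sym by (metis nle_le)
qed

subsection \<open>Combinatorial triangulations\<close>

lemma arcE:
  assumes "A \<in> arcs"
  obtains a b where "A = {a, b}" "a \<noteq> b" "a \<in> dyadic_points" "b \<in> dyadic_points"
proof -
  from assms have "A \<subseteq> dyadic_points" "card A = 2" by (auto simp: arcs_def)
  then show ?thesis using that by (auto simp: card_2_iff)
qed

lemma arc_iff: "{a, b} \<in> arcs \<longleftrightarrow> a \<noteq> b \<and> a \<in> dyadic_points \<and> b \<in> dyadic_points"
  by (auto simp: arcs_def card_insert_if)

lemma finite_arc: "A \<in> arcs \<Longrightarrow> finite A"
  by (auto simp: arcs_def intro: card_ge_0_finite)

lemma arc_dyadic: "A \<in> arcs \<Longrightarrow> A \<subseteq> dyadic_points"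
  by (auto simp: arcs_def)

lemma grid_lift:
  assumes "to_circle z \<in> grid n"
  obtains j where "z = of_int j / 2 ^ n"
proof -
  obtain j where "to_circle z = to_circle (of_int j / 2 ^ n)"
    using assms unfolding grid_def by blast
  then obtain k where "z - of_int j / 2 ^ n = of_int k"
    unfolding to_circle_eq_iff by (rule Ints_cases)
  then have "z = of_int (j + k * 2 ^ n) / 2 ^ n"
    by (simp add: field_simps)
  then show ?thesis by (rule that)
qed

lemma base_subset_arcs: "E \<subseteq> arcs"
  using stdarc_in_arcs by (auto simp: base_eq)

text \<open>Bisection, by induction on the number \<open>k\<close> of levels between the interval
  and the endpoints: an arc staying in one half descends, and an arc straddling the midpoint is
  crossed by the left or the right half unless it spans the whole interval. The bound
  \<open>m > n\<close> matters where only the fine base arcs are known to be present.\<close>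

lemma base_maximal_in_interval:
  assumes "n \<ge> 1" "of_int i / 2 ^ n \<le> x" "x < y" "y \<le> (of_int i + 1) / 2 ^ n"
    and "x = of_int j / 2 ^ (n + k)" "y = of_int l / 2 ^ (n + k)"
    and "{to_circle x, to_circle y} \<notin> E"
  shows "\<exists>m>n. \<exists>h. cross (stdarc m h) {to_circle x, to_circle y}"
  using assms
proof (induction k arbitrary: n i)
  case 0
  then have "i \<le> j" "j < l" "l \<le> i + 1"
    by (simp_all add: divide_le_cancel divide_less_cancel)
  then have "j = i" "l = i + 1" by auto
  then have "{to_circle x, to_circle y} = stdarc n i" using 0 by (simp add: stdarc_def)
  then show ?case using 0 by auto
next
  case (Suc k)
  define m where "m = (2 * of_int i + 1) / (2 :: real) ^ Suc n"
  have lm: "of_int i / 2 ^ n = of_int (2 * i) / (2 :: real) ^ Suc n"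
    "(of_int (2 * i) + 1) / 2 ^ Suc n = m"
    "of_int (2 * i + 1) / 2 ^ Suc n = m"
    "(of_int i + 1) / 2 ^ n = (of_int (2 * i + 1) + 1) / (2 :: real) ^ Suc n"
    by (simp_all add: m_def field_simps)
  have xk: "x = of_int j / 2 ^ (Suc n + k)" "y = of_int l / 2 ^ (Suc n + k)"
    using Suc.prems(5,6) by (simp_all only: add_Suc_right add_Suc)
  have IH: "\<exists>q>n. \<exists>h. cross (stdarc q h) {to_circle x, to_circle y}"
    if a: "of_int i' / 2 ^ Suc n \<le> x" "y \<le> (of_int i' + 1) / 2 ^ Suc n" for i'
    using Suc.IH[OF _ a(1) Suc.prems(3) a(2) xk Suc.prems(7)] Suc_lessD by (metis le_add1 plus_1_eq_Suc)
  consider "y \<le> m" | "x \<ge> m" | "x < m" "m < y" by linarith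
  then show ?case
  proof cases
    case 1
    then show ?thesis using IH[of "2 * i"] Suc.prems(2) unfolding lm by blast
  next
    case 2
    then show ?thesis using IH[of "2 * i + 1"] Suc.prems(4) unfolding lm by blast
  next
    case 3
    let ?l = "of_int i / (2 :: real) ^ n" and ?r = "(of_int i + 1) / (2 :: real) ^ n"
    have L: "stdarc (Suc n) (2 * i) = {to_circle ?l, to_circle m}"
      and R: "stdarc (Suc n) (2 * i + 1) = {to_circle m, to_circle ?r}"
      unfolding stdarc_def lm by simp_all
    have "(1 :: real) / 2 ^ n < 1" using \<open>n \<ge> 1\<close> by simp
    then have lr: "?r < ?l + 1" by (simp add: add_divide_distrib)
    consider "?l < x" | "?l = x" "y < ?r" | "?l = x" "y = ?r"
      using Suc.prems by linarith
    then show ?thesis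
    proof cases
      case 1
      then have "cyc (to_circle ?l) (to_circle x) (to_circle m)"
        "cyc (to_circle m) (to_circle y) (to_circle ?l)"
        using 3 lr Suc.prems cyc_to_circle[of ?l x m] cyc_to_circle[of ?l m y] cyc_rotate
        by auto
      then show ?thesis unfolding L[symmetric]
        by (metis L cross_iff lessI)
    next
      case 2
      then have "cyc (to_circle m) (to_circle y) (to_circle ?r)"
        "cyc (to_circle ?r) (to_circle x) (to_circle m)"
        using 3 lr Suc.prems cyc_to_circle[of m y ?r] cyc_to_circle[of ?l m ?r] cyc_rotate
        by auto
      then show ?thesis
        by (metis R cross_iff lessI)
    next
      case 3
      then have "{to_circle x, to_circle y} = stdarc n i" by (simp add: stdarc_def)
      then show ?thesis using Suc.prems by auto
    qed
  qed
qed

text \<open>Not crossing the arc of the interval traps the second end in the closed interval;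
  \<open>base_maximal_in_interval\<close> then applies at a level that resolves both ends.\<close>

lemma arc_in_interval:
  assumes "n \<ge> 1" "{c, d} \<in> arcs" "{c, d} \<notin> E"
    and "\<not> cross (stdarc n i) {c, d}"
    and "cyc (to_circle (of_int i / 2 ^ n)) c (to_circle ((of_int i + 1) / 2 ^ n))"
  shows "\<exists>m>n. \<exists>h. cross (stdarc m h) {c, d}"
proof -
  let ?l = "of_int i / (2 :: real) ^ n" and ?r = "(of_int i + 1) / (2 :: real) ^ n"
  have "(1 :: real) / 2 ^ n < 1" using \<open>n \<ge> 1\<close> by simp
  then have lr: "?l < ?r" "?r < ?l + 1" by (simp_all add: add_divide_distrib)
  obtain x where x: "c = to_circle x" "?l < x" "x < ?r"
    using cyc_lift_between[OF assms(5) lr] .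
  have "\<not> cyc (to_circle ?r) d (to_circle ?l)"
    using assms(4,5) unfolding stdarc_def cross_iff by blast
  then consider "d = to_circle ?l" | "d = to_circle ?r" | "cyc (to_circle ?l) d (to_circle ?r)"
    using cyc_linear[of "to_circle ?l" d "to_circle ?r"] stdarc_points_neq[OF \<open>n \<ge> 1\<close>] by metis
  then obtain y where y: "d = to_circle y" "?l \<le> y" "y \<le> ?r"
  proof cases
    case 3
    then show ?thesis using that cyc_lift_between[OF 3 lr] by (metis less_imp_le)
  qed (use that lr in auto)
  have "x \<noteq> y" using x y assms(2) by (auto simp: arc_iff)
  have dy: "{c, d} \<subseteq> dyadic_points" "finite {c, d}" using assms(2) by (auto simp: arc_iff)
  then obtain K where "{c, d} \<subseteq> grid K" using finite_subset_grid by blast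
  then have "{c, d} \<subseteq> grid (n + K)" using grid_mono[of K "n + K"] by auto
  then have "to_circle x \<in> grid (n + K)" "to_circle y \<in> grid (n + K)" using x y by auto
  then obtain j l where jl: "x = of_int j / 2 ^ (n + K)" "y = of_int l / 2 ^ (n + K)"
    using grid_lift by metis
  then show ?thesis
  proof (cases "x < y")
    case True
    then show ?thesis using base_maximal_in_interval[of n i x y j K l] x y assms
        jl by auto
  next
    case False
    then show ?thesis using base_maximal_in_interval[of n i y x l K j] x y assms
        jl \<open>x \<noteq> y\<close> by (auto simp: insert_commute)
  qed
qed

text \<open>The points 0 and 1/2 split the circle into the two intervals of level 1. An end
  different from both lies inside one of them and \<open>arc_in_interval\<close> applies; the only
  other arc joins 0 to 1/2.\<close>

lemma base_maximal:
  assumes "A \<in> arcs" "\<And>B. B \<in> E \<Longrightarrow> \<not> cross B A"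
  shows "A \<in> E"
proof (rule ccontr)
  assume "A \<notin> E"
  obtain c d where A: "A = {c, d}" "c \<noteq> d" "c \<in> dyadic_points" "d \<in> dyadic_points"
    using assms(1) by (rule arcE)
  have False if np: "p \<noteq> to_circle 0" "p \<noteq> to_circle (1/2)" "A = {p, q}" for p q
  proof -
    obtain x where x: "p = to_circle x" "0 < x" "x < 1"
      using to_circle_lift_neq[OF np(1)] by (metis add_0)
    have "x \<noteq> 1/2" using x(1) np(2) by blast
    then have "cyc (to_circle 0) p (to_circle (1/2)) \<or> cyc (to_circle (1/2)) p (to_circle 1)"
      using x cyc_to_circle[of 0 x "1/2"] cyc_to_circle[of "1/2" x 1] by (cases "x < 1/2") auto
    then obtain i where "cyc (to_circle (of_int i / 2 ^ 1)) p (to_circle ((of_int i + 1) / 2 ^ 1))"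
    proof
      assume "cyc (to_circle 0) p (to_circle (1/2))"
      then show ?thesis using that[of 0] by simp
    next
      assume "cyc (to_circle (1/2)) p (to_circle 1)"
      then show ?thesis using that[of 1] by simp
    qed
    then show False using arc_in_interval[of 1 p q i] assms \<open>A \<notin> E\<close> \<open>A = {p, q}\<close>
      by (metis le_refl less_imp_le stdarc_in_base)
  qed
  then have "c = to_circle 0 \<or> c = to_circle (1/2)" "d = to_circle 0 \<or> d = to_circle (1/2)"
    using A(1) by (auto simp: insert_commute)
  then have "A = stdarc 1 0" using A(1,2) by (auto simp: stdarc_def)
  then show False using \<open>A \<notin> E\<close> by auto
qed

text \<open>Finiteness is asked of \<open>v - E\<close> only; with maximality it yields finiteness
  of \<open>E - v\<close> (\<open>comb_finite\<close>).\<close>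

definition comb :: "circle set set \<Rightarrow> bool" where
  "comb v \<longleftrightarrow> v \<subseteq> arcs \<and> (\<forall>A\<in>v. \<forall>B\<in>v. \<not> cross A B) \<and>
     (\<forall>A\<in>arcs. (\<forall>B\<in>v. \<not> cross B A) \<longrightarrow> A \<in> v) \<and> finite (v - E)"

lemma comb_base: "comb E"
  unfolding comb_def using base_subset_arcs base_not_cross base_maximal by auto

lemma comb_arcs: "comb v \<Longrightarrow> A \<in> v \<Longrightarrow> A \<in> arcs"
  by (auto simp: comb_def)

lemma comb_not_cross: "comb v \<Longrightarrow> A \<in> v \<Longrightarrow> B \<in> v \<Longrightarrow> \<not> cross A B"
  by (auto simp: comb_def)

lemma comb_maximal: "comb v \<Longrightarrow> A \<in> arcs \<Longrightarrow> (\<And>B. B \<in> v \<Longrightarrow> \<not> cross B A) \<Longrightarrow> A \<in> v"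
  by (auto simp: comb_def)

text \<open>An arc of \<open>w\<close> crosses no arc of the subfamily \<open>v\<close>, so
  maximality of \<open>v\<close> already contains it. Equalities of triangulations below are
  therefore proved by one inclusion.\<close>

lemma comb_eqI: "comb v \<Longrightarrow> comb w \<Longrightarrow> v \<subseteq> w \<Longrightarrow> v = w"
  unfolding comb_def by blast

text \<open>The finitely many exceptional arcs have their ends in some \<open>grid N\<close>; a
  standard arc of level at least \<open>N\<close> crosses neither these nor a base arc, so
  maximality puts it into \<open>v\<close>.\<close>

lemma comb_contains_stdarcs:
  assumes "v \<subseteq> arcs" "\<forall>A\<in>arcs. (\<forall>B\<in>v. \<not> cross B A) \<longrightarrow> A \<in> v" "finite (v - E)"
  obtains N where "N \<ge> 1" "\<And>n i. n \<ge> N \<Longrightarrow> stdarc n i \<in> v" "\<And>A. A \<in> v - E \<Longrightarrow> A \<subseteq> grid N"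
proof -
  have "finite (\<Union> (v - E))" "\<Union> (v - E) \<subseteq> dyadic_points"
    using assms(1,3) finite_arc arc_dyadic by blast+
  then obtain M where M: "\<Union> (v - E) \<subseteq> grid M" using finite_subset_grid by blast
  define N where "N = max 1 M"
  have N: "N \<ge> 1" "\<Union> (v - E) \<subseteq> grid N" using M grid_mono[of M N] by (auto simp: N_def)
  have "stdarc n i \<in> v" if "n \<ge> N" for n i
  proof -
    have "\<not> cross B (stdarc n i)" if "B \<in> v" for B
    proof (cases "B \<in> E")
      case True
      then show ?thesis using base_not_cross \<open>n \<ge> N\<close> N by (meson le_trans stdarc_in_base)
    next
      case False
      then have "B \<subseteq> grid N" using N that by auto
      then show ?thesis using stdarc_not_cross_grid[of B N n i] \<open>n \<ge> N\<close> N cross_sym by auto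
    qed
    then show ?thesis using assms(2) stdarc_in_arcs[of n i] \<open>n \<ge> N\<close> N by auto
  qed
  then show ?thesis using that N by blast
qed

lemma comb_stdarcs:
  assumes "comb v"
  obtains N where "N \<ge> 1" "\<And>n i. n \<ge> N \<Longrightarrow> stdarc n i \<in> v" "\<And>A. A \<in> v - E \<Longrightarrow> A \<subseteq> grid N"
proof -
  have "v \<subseteq> arcs" "\<forall>A\<in>arcs. (\<forall>B\<in>v. \<not> cross B A) \<longrightarrow> A \<in> v" "finite (v - E)"
    using assms by (auto simp: comb_def)
  from comb_contains_stdarcs[OF this] that show ?thesis by blast
qed

lemma base_minus_finite:
  assumes "N \<ge> 1" "\<And>n i. n \<ge> N \<Longrightarrow> stdarc n i \<in> v"
  shows "finite (E - v)"
proof -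
  have "E - v \<subseteq> Pow (grid N)"
  proof
    fix A assume A: "A \<in> E - v"
    then obtain n i where ni: "A = stdarc n i" "n \<ge> 1" by (auto simp: base_eq)
    with A assms(2) have "n \<le> N" by (metis DiffD2 nle_le)
    then show "A \<in> Pow (grid N)" using ni grid_mono stdarc_subset_grid by blast
  qed
  then show ?thesis using finite_grid finite_Pow_iff finite_subset by metis
qed

lemma comb_finite: "comb v \<Longrightarrow> finite (E - v)"
  by (erule comb_stdarcs) (rule base_minus_finite)

text \<open>A geometric vertex directly yields finiteness of \<open>E - v\<close>; this turns it
  into finiteness of \<open>v - E\<close>. The missing base arcs are coarse, so all fine standard
  arcs lie in \<open>v\<close>, and they confine every other arc of \<open>v\<close> to
  \<open>grid N\<close>.\<close>

lemma minus_base_finite: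
  assumes "v \<subseteq> arcs" "\<forall>A\<in>v. \<forall>B\<in>v. \<not> cross A B" "finite (E - v)"
  shows "finite (v - E)"
proof -
  have "finite (\<Union> (E - v))" "\<Union> (E - v) \<subseteq> dyadic_points"
    using assms(3) base_subset_arcs finite_arc arc_dyadic by blast+
  then obtain M where M: "\<Union> (E - v) \<subseteq> grid M" using finite_subset_grid by blast
  \<comment> \<open>One level above the missing arcs: of the consecutive numerators \<open>i\<close>
    and \<open>i + 1\<close> one is odd, so a standard arc of level above \<open>M\<close> has an
    end outside \<open>grid M\<close>.\<close>
  define N where "N = Suc M"
  have std: "stdarc n i \<in> v" if "n \<ge> N" for n i
  proof (rule ccontr)
    assume "stdarc n i \<notin> v"
    then have sub: "stdarc n i \<subseteq> grid M"
    proof -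
      have "stdarc n i \<in> E" using that by (intro stdarc_in_base) (simp add: N_def)
      then show ?thesis using M \<open>stdarc n i \<notin> v\<close> by blast
    qed
    show False
    proof -
      have "to_circle (of_int i / 2 ^ n) \<in> grid M" "to_circle ((of_int i + 1) / 2 ^ n) \<in> grid M"
        using sub by (auto simp: stdarc_def)
      then obtain j l where jl: "of_int i / 2 ^ n = (of_int j / 2 ^ M :: real)"
        "(of_int i + 1) / 2 ^ n = (of_int l / 2 ^ M :: real)" using grid_lift by metis
      have p: "(2::real) ^ n = 2 ^ M * 2 ^ (n - M)" using that by (simp add: N_def flip: power_add)
      have "of_int i = of_int j / 2 ^ M * (2 :: real) ^ n" "of_int (i + 1) = of_int l / 2 ^ M * (2 :: real) ^ n"
        using jl by (simp_all add: divide_eq_eq)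
      then have "of_int i = (of_int (j * 2 ^ (n - M)) :: real)"
        "of_int (i + 1) = (of_int (l * 2 ^ (n - M)) :: real)"
        unfolding p by simp_all
      then have "i = j * 2 ^ (n - M)" "i + 1 = l * 2 ^ (n - M)" by (simp_all only: of_int_eq_iff)
      moreover have "(2::int) dvd 2 ^ (n - M)" using that by (simp add: N_def)
      ultimately have "2 dvd i" "2 dvd i + 1" by auto
      then show False by presburger
    qed
  qed
  have "v - E \<subseteq> Pow (grid N)"
  proof
    fix A assume A: "A \<in> v - E"
    have "c \<in> grid N" if cd: "A = {c, d}" for c d
    proof (rule ccontr)
      assume "c \<notin> grid N"
      \<comment> \<open>Number of the dyadic interval of level \<open>N\<close> containing
        \<open>c\<close>; its left end is not \<open>c\<close>, as \<open>c\<close> is not in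
        \<open>grid N\<close>.\<close>
      define i where "i = \<lfloor>pos c * 2 ^ N\<rfloor>"
      have "pos c \<noteq> of_int i / 2 ^ N" using \<open>c \<notin> grid N\<close> unfolding grid_def
        by (metis rangeI to_circle_pos)
      moreover have "of_int i \<le> pos c * 2 ^ N" "pos c * 2 ^ N < of_int i + 1"
        unfolding i_def by linarith+
      then have "of_int i / 2 ^ N \<le> pos c" "pos c < (of_int i + 1) / 2 ^ N"
        by (simp_all add: divide_le_eq less_divide_eq)
      ultimately have "of_int i / 2 ^ N < pos c" "pos c < (of_int i + 1) / 2 ^ N" by linarith+
      moreover have "(1 :: real) / 2 ^ N < 1"
        by (simp add: N_def one_less_power del: power_Suc)
      ultimately have "cyc (to_circle (of_int i / 2 ^ N)) c (to_circle ((of_int i + 1) / 2 ^ N))"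
        using cyc_to_circle[of "of_int i / 2 ^ N" "pos c" "(of_int i + 1) / 2 ^ N"]
        by (simp add: add_divide_distrib)
      moreover have "{c, d} \<in> arcs" "{c, d} \<notin> E" "N \<ge> 1" using A cd assms(1) by (auto simp: N_def)
      moreover have "\<not> cross (stdarc m h) {c, d}" if "m \<ge> N" for m h
        using std[OF that] A assms(2) cd by blast
      ultimately show False using arc_in_interval[of N c d i] by (meson less_imp_le le_refl)
    qed
    moreover obtain c d where "A = {c, d}" using A assms(1) arcE by blast
    ultimately show "A \<in> Pow (grid N)" by (auto simp: insert_commute)
  qed
  then show ?thesis using finite_grid finite_Pow_iff finite_subset by metis
qed

section \<open>Lengths of arcs and third vertices of triangles\<close>

definition len :: "circle \<Rightarrow> circle \<Rightarrow> real" where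
  "len a b = frac (pos b - pos a)"

lemma len_to_circle: "len (to_circle x) (to_circle y) = frac (y - x)"
proof -
  have "frac y - frac x - (y - x) = of_int (\<lfloor>x\<rfloor> - \<lfloor>y\<rfloor>)" by (simp add: frac_def)
  then show ?thesis unfolding len_def pos_to_circle frac_eq_frac_iff by (metis Ints_of_int)
qed

lemma len_lift: "x < y \<Longrightarrow> y < x + 1 \<Longrightarrow> len (to_circle x) (to_circle y) = y - x"
  by (simp add: len_to_circle frac_eq)

lemma len_pos: "a \<noteq> b \<Longrightarrow> 0 < len a b"
  using to_circle_lift_neq[of b "pos a"] len_lift[of "pos a"]
  by (metis to_circle_pos diff_gt_0_iff_gt)

lemma len_less_1: "len a b < 1"
  by (simp add: len_def frac_lt_1)

lemma cyc_len: "cyc a m b \<Longrightarrow> len a m < len a b"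
proof -
  assume "cyc a m b"
  then have "cyc (to_circle (pos a)) m b" by simp
  then obtain y z where "m = to_circle y" "b = to_circle z" "pos a < y" "y < z" "z < pos a + 1"
    by (rule cyc_lift)
  then show ?thesis using len_lift[of "pos a" y] len_lift[of "pos a" z] by simp
qed

lemma cyc_len': "cyc a m b \<Longrightarrow> len m b < len a b"
proof -
  assume "cyc a m b"
  then have "cyc (to_circle (pos a)) m b" by simp
  then obtain y z where "m = to_circle y" "b = to_circle z" "pos a < y" "y < z" "z < pos a + 1"
    by (rule cyc_lift)
  then show ?thesis using len_lift[of y z] len_lift[of "pos a" z] by simp
qed

text \<open>Since \<open>len\<close> measures counterclockwise, the two directions along one base
  arc have complementary lengths.\<close>

lemma base_arc_ends:
  assumes "{a, b} \<in> E"
  obtains n i where "n \<ge> 1" "{a, b} = stdarc n i" "len a b = 1 / 2 ^ n \<or> len a b = 1 - 1 / 2 ^ n"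
proof -
  obtain n i where ni: "n \<ge> 1" "{a, b} = stdarc n i" using assms by (auto simp: base_eq)
  let ?l = "of_int i / (2 :: real) ^ n" and ?r = "(of_int i + 1) / (2 :: real) ^ n"
  have "(1 :: real) / 2 ^ n < 1" using \<open>n \<ge> 1\<close> by simp
  then have lr: "?l < ?r" "?r < ?l + 1" by (simp_all add: add_divide_distrib)
  have "len (to_circle ?l) (to_circle ?r) = 1 / 2 ^ n"
    using len_lift[OF lr] by (simp add: add_divide_distrib)
  moreover have "len (to_circle ?r) (to_circle (?l + 1)) = 1 - 1 / 2 ^ n"
    using len_lift[of ?r "?l + 1"] lr by (simp add: add_divide_distrib)
  moreover have "a = to_circle ?l \<and> b = to_circle ?r \<or> a = to_circle ?r \<and> b = to_circle (?l + 1)"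
    using ni(2) unfolding stdarc_def doubleton_eq_iff to_circle_add_1 by blast
  ultimately show ?thesis using that ni by auto
qed

lemma finite_base_len:
  assumes "\<epsilon> > 0"
  shows "finite {(a, b). {a, b} \<in> E \<and> \<epsilon> \<le> len a b \<and> len a b \<le> 1 - \<epsilon>}"
proof -
  obtain N where N: "(1/2) ^ N < \<epsilon>" using real_arch_pow_inv[of \<epsilon> "1/2"] assms by auto
  have "{(a, b). {a, b} \<in> E \<and> \<epsilon> \<le> len a b \<and> len a b \<le> 1 - \<epsilon>} \<subseteq> grid N \<times> grid N"
  proof clarify
    fix a b assume ab: "{a, b} \<in> E" "\<epsilon> \<le> len a b" "len a b \<le> 1 - \<epsilon>"
    obtain n i where ni: "{a, b} = stdarc n i" "len a b = 1 / 2 ^ n \<or> len a b = 1 - 1 / 2 ^ n"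
      using base_arc_ends[OF ab(1)] by metis
    then have "\<epsilon> \<le> 1 / 2 ^ n" using ab by auto
    then have "(1/2) ^ N < (1/2 :: real) ^ n" using N by (simp add: power_one_over)
    then have "n \<le> N" by (simp add: power_strict_decreasing_iff)
    then show "a \<in> grid N \<and> b \<in> grid N" using ni(1) stdarc_subset_grid grid_mono by blast
  qed
  then show ?thesis using finite_grid finite_subset by blast
qed

text \<open>Only base arcs of bounded level are neither very short nor very long, and the other arcs
  of \<open>v\<close> are finite in number. This local finiteness makes the extremal choices in
  \<open>third_vertex_exists\<close> and \<open>triangle_cover\<close> possible.\<close>

lemma finite_comb_len:
  assumes "comb v" "\<epsilon> > 0"
  shows "finite {(a, b). {a, b} \<in> v \<and> \<epsilon> \<le> len a b \<and> len a b \<le> 1 - \<epsilon>}"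
proof (rule finite_subset)
  show "{(a, b). {a, b} \<in> v \<and> \<epsilon> \<le> len a b \<and> len a b \<le> 1 - \<epsilon>} \<subseteq>
    {(a, b). {a, b} \<in> E \<and> \<epsilon> \<le> len a b \<and> len a b \<le> 1 - \<epsilon>} \<union> \<Union> (v - E) \<times> \<Union> (v - E)"
    by blast
  have "finite (\<Union> (v - E))" using assms finite_arc unfolding comb_def by blast
  then show "finite ({(a, b). {a, b} \<in> E \<and> \<epsilon> \<le> len a b \<and> len a b \<le> 1 - \<epsilon>} \<union> \<Union> (v - E) \<times> \<Union> (v - E))"
    using finite_base_len[OF assms(2)] by blast
qed

text \<open>Among the arcs of \<open>v\<close> from \<open>a\<close> to points before
  \<open>b\<close>, the one reaching farthest ends at the wanted vertex: an arc crossing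
  \<open>{m, b}\<close> crosses neither \<open>{a, b}\<close> nor \<open>{a, m}\<close>, so one of
  its ends is \<open>a\<close> and it reaches farther.\<close>

lemma third_vertex_exists:
  assumes "comb v" "{a, b} \<in> v"
  obtains m where "cyc a m b" "{a, m} \<in> v" "{m, b} \<in> v"
proof -
  have ab: "a \<noteq> b" "a \<in> dyadic_points" "b \<in> dyadic_points"
    using assms comb_arcs arc_iff by blast+
  obtain N where N: "N \<ge> 1" "\<And>n i. n \<ge> N \<Longrightarrow> stdarc n i \<in> v" "\<And>A. A \<in> v - E \<Longrightarrow> A \<subseteq> grid N"
    by (rule comb_stdarcs[OF assms(1)]) (rule that)
  obtain k i where a: "a = to_circle (of_int i / 2 ^ k)"
    using ab(2) by (auto simp: dyadic_points_eq grid_def)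
  let ?x = "of_int i / (2 :: real) ^ k"
  obtain y where y: "b = to_circle y" "?x < y" "y < ?x + 1"
    using to_circle_lift_neq[of b ?x] ab(1) a by blast
  obtain K where K: "(1/2) ^ K < y - ?x" using real_arch_pow_inv[of "y - ?x" "1/2"] y by auto
  \<comment> \<open>\<open>N\<close> puts the standard arc into \<open>v\<close>, \<open>k\<close>
    makes \<open>a\<close> a point of level \<open>n\<close>, and \<open>K\<close> makes the arc end
    before \<open>b\<close>.\<close>
  define n where "n = N + k + K"
  have "(1/2 :: real) ^ n \<le> (1/2) ^ K" unfolding n_def by (intro power_decreasing) auto
  then have n: "?x + 1 / 2 ^ n < y" using K by (simp add: power_one_over)
  define m0 where "m0 = to_circle (?x + 1 / 2 ^ n)"
  have "(2 :: real) ^ n = 2 ^ k * 2 ^ (N + K)" by (simp add: n_def power_add)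
  then have "?x = of_int (i * 2 ^ (N + K)) / 2 ^ n" by simp
  then have "stdarc n (i * 2 ^ (N + K)) = {a, m0}"
    unfolding stdarc_def add_divide_distrib a m0_def by metis
  then have m0: "{a, m0} \<in> v" using N(2)[of n] by (metis n_def add.assoc le_add1)
  have cm0: "cyc a m0 b" unfolding a m0_def y(1) using n y by (intro cyc_to_circle) auto
  \<comment> \<open>The lower bound \<open>len a m0\<close> discards the short arcs accumulating at
    \<open>a\<close>; the remaining lengths stay away from 0 and 1.\<close>
  define S where "S = {m. {a, m} \<in> v \<and> cyc a m b \<and> len a m0 \<le> len a m}"
  define \<epsilon> where "\<epsilon> = min (len a m0) (1 - len a b)"
  have "\<epsilon> > 0" unfolding \<epsilon>_def using len_less_1[of a b] len_pos[of a m0] cyc_distinct[OF cm0] by auto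
  have "S \<subseteq> snd ` {(c, d). {c, d} \<in> v \<and> \<epsilon> \<le> len c d \<and> len c d \<le> 1 - \<epsilon>}"
  proof
    fix m assume "m \<in> S"
    then have "{a, m} \<in> v" "len a m0 \<le> len a m" "len a m < len a b"
      unfolding S_def using cyc_len by blast+
    then have "(a, m) \<in> {(c, d). {c, d} \<in> v \<and> \<epsilon> \<le> len c d \<and> len c d \<le> 1 - \<epsilon>}"
      unfolding \<epsilon>_def by auto
    then show "m \<in> snd ` {(c, d). {c, d} \<in> v \<and> \<epsilon> \<le> len c d \<and> len c d \<le> 1 - \<epsilon>}"
      by (rule image_eqI[rotated]) simp
  qed
  then have "finite S" using finite_comb_len[OF assms(1) \<open>\<epsilon> > 0\<close>] finite_surj by blast
  moreover have "m0 \<in> S" using m0 cm0 by (simp add: S_def)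
  ultimately have "Max (len a ` S) \<in> len a ` S" by (intro Max_in) auto
  then obtain m where "m \<in> S" "len a m = Max (len a ` S)" by auto
  then have m: "m \<in> S" "\<And>m'. m' \<in> S \<Longrightarrow> len a m' \<le> len a m"
    using \<open>finite S\<close> by simp_all
  then have am: "{a, m} \<in> v" "cyc a m b" by (auto simp: S_def)
  have "{m, b} \<in> v"
  proof (rule comb_maximal[OF assms(1)])
    show "{m, b} \<in> arcs"
      using cyc_distinct[OF am(2)] ab comb_arcs[OF assms(1) am(1)] by (auto simp: arc_iff)
    fix B assume B: "B \<in> v"
    have no: False if "cyc m c b" "cyc b d m" "{c, d} \<in> v" for c d
    proof -
      have "\<not> cross {a, b} {c, d}" "\<not> cross {a, m} {c, d}"
        using comb_not_cross assms that am by blast+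
      moreover have c: "cyc a m c" "cyc a c b" "cyc m c a" using that(1) am(2) unfolding cyc_def by linarith+
      ultimately have "\<not> cyc b d a" "\<not> cyc a d m" unfolding cross_iff by blast+
      then have "d = a" using that(2) am(2) unfolding cyc_def pos_eq_iff[symmetric] by linarith
      then have "c \<in> S" using c that(3) cyc_len[of a m c] m(1) unfolding S_def
        by (auto simp: insert_commute)
      then show False using m(2) cyc_len[OF c(1)] by force
    qed
    show "\<not> cross B {m, b}"
    proof
      assume "cross B {m, b}"
      then have c: "cross {m, b} B" by (rule cross_sym)
      obtain c d where "B = {c, d}" using comb_arcs[OF assms(1) B] by (rule arcE)
      then show False using c no[of c d] no[of d c] B by (auto simp: cross_iff insert_commute)
    qed
  qed
  then show ?thesis using that am by blast
qed

text \<open>Of two different candidates, the arc from \<open>a\<close> to the farther one crosses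
  the arc from the nearer one to \<open>b\<close>.\<close>

lemma third_vertex_unique:
  assumes "comb v" "cyc a m b" "{a, m} \<in> v" "{m, b} \<in> v" "cyc a m' b" "{a, m'} \<in> v" "{m', b} \<in> v"
  shows "m = m'"
proof -
  have "\<not> cross {a, m} {m', b}" "\<not> cross {a, m'} {m, b}"
    using comb_not_cross assms by blast+
  then have "\<not> cyc a m m'" "\<not> cyc a m' m"
    using assms(2,5) unfolding cross_iff by (blast dest: cyc_rotate)+
  then show ?thesis using assms(2,5) cyc_linear[of a m m'] cyc_distinct cyc_rotate by metis
qed

subsection \<open>Chords and triangles of the disc\<close>

abbreviation "bp \<equiv> boundary_point"

text \<open>Positive on the left of the directed line from \<open>bp a\<close> to \<open>bp b\<close>.\<close>

definition side :: "circle \<Rightarrow> circle \<Rightarrow> complex \<Rightarrow> real" where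
  "side a b z = (Re (bp b) - Re (bp a)) * (Im z - Im (bp a)) -
     (Im (bp b) - Im (bp a)) * (Re z - Re (bp a))"

lemma bp_to_circle: "bp (to_circle x) = cis (2 * pi * x)"
  by (rule boundary_point.abs_eq)

lemma norm_bp [simp]: "norm (bp a) = 1"
  using bp_to_circle[of "pos a"] by simp

text \<open>Sum-to-product formulas at half angles turn the determinant into a product of sines,
  whose signs are read off the order of the lifts. This identifies sides of chords with cyclic order
  (\<open>side_bp_iff\<close>).\<close>

lemma side_cis:
  "side (to_circle x) (to_circle y) (bp (to_circle t)) =
     4 * sin (pi * (y - x)) * sin (pi * (t - x)) * sin (pi * (t - y))"
proof -
  define \<alpha> \<beta> \<theta> where "\<alpha> = pi * x" "\<beta> = pi * y" "\<theta> = pi * t"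
  have c: "cos (2 * u) - cos (2 * w) = - 2 * sin (u + w) * sin (u - w)"
    "sin (2 * u) - sin (2 * w) = 2 * cos (u + w) * sin (u - w)" for u w :: real
  proof -
    have e: "(2 * u + 2 * w) / 2 = u + w" "(2 * w - 2 * u) / 2 = - (u - w)" "(2 * u - 2 * w) / 2 = u - w"
      by simp_all
    show "cos (2 * u) - cos (2 * w) = - 2 * sin (u + w) * sin (u - w)"
      using cos_diff_cos[of "2 * u" "2 * w"] unfolding e sin_minus by linarith
    show "sin (2 * u) - sin (2 * w) = 2 * cos (u + w) * sin (u - w)"
      using sin_diff_sin[of "2 * u" "2 * w"] unfolding e by (simp only: mult_ac)
  qed
  have "side (to_circle x) (to_circle y) (bp (to_circle t)) =
    (cos (2 * \<beta>) - cos (2 * \<alpha>)) * (sin (2 * \<theta>) - sin (2 * \<alpha>)) -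
    (sin (2 * \<beta>) - sin (2 * \<alpha>)) * (cos (2 * \<theta>) - cos (2 * \<alpha>))"
    unfolding side_def bp_to_circle \<alpha>_\<beta>_\<theta>_def by (simp add: mult.assoc)
  also have "\<dots> = 4 * sin (\<beta> - \<alpha>) * sin (\<theta> - \<alpha>) *
      (sin (\<theta> + \<alpha>) * cos (\<beta> + \<alpha>) - cos (\<theta> + \<alpha>) * sin (\<beta> + \<alpha>))"
    unfolding c by (simp add: algebra_simps)
  also have "sin (\<theta> + \<alpha>) * cos (\<beta> + \<alpha>) - cos (\<theta> + \<alpha>) * sin (\<beta> + \<alpha>) = sin (\<theta> - \<beta>)"
    unfolding sin_diff[symmetric] by simp
  finally show ?thesis by (simp add: \<alpha>_\<beta>_\<theta>_def right_diff_distrib)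
qed

lemma sin_pi_pos: "0 < u \<Longrightarrow> u < 1 \<Longrightarrow> 0 < sin (pi * u)"
  by (rule sin_gt_zero) auto

lemma side_swap: "side b a z = - side a b z"
  by (simp add: side_def algebra_simps)

lemma side_ends [simp]: "side a b (bp a) = 0" "side a b (bp b) = 0"
  by (simp_all add: side_def algebra_simps)

lemma side_affine: "side a b ((1 - u) *\<^sub>R z + u *\<^sub>R w) = (1 - u) * side a b z + u * side a b w"
  by (simp add: side_def algebra_simps)

lemma side_affine3:
  "x + y + t = 1 \<Longrightarrow> side a b (x *\<^sub>R z + y *\<^sub>R w + t *\<^sub>R q) =
     x * side a b z + y * side a b w + t * side a b q"
proof -
  assume "x + y + t = 1"
  then have t: "t = 1 - x - y" by simp
  show ?thesis unfolding t by (simp add: side_def algebra_simps)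
qed

lemma continuous_side [continuous_intros]: "continuous_on S (side a b)"
  unfolding side_def by (intro continuous_intros)

text \<open>The boundary interval run counterclockwise from \<open>a\<close> to \<open>b\<close>
  lies to the right of the directed chord: of the three sines in \<open>side_cis\<close> only the
  one of \<open>t - y\<close> is negative.\<close>

lemma side_neg: "cyc a m b \<Longrightarrow> side a b (bp m) < 0"
proof -
  assume "cyc a m b"
  then have "cyc (to_circle (pos a)) m b" by simp
  then obtain t y where ty: "m = to_circle t" "b = to_circle y" "pos a < t" "t < y" "y < pos a + 1"
    by (rule cyc_lift)
  have "side (to_circle (pos a)) b (bp m) < 0"
    unfolding ty(1,2) side_cis
    using sin_pi_pos[of "y - pos a"] sin_pi_pos[of "t - pos a"] sin_pi_pos[of "y - t"] ty(3-)
      sin_minus[of "pi * (y - t)"]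
    by (simp add: mult_less_0_iff algebra_simps)
  then show ?thesis by simp
qed

lemma side_pos: "cyc b m a \<Longrightarrow> side a b (bp m) > 0"
  using side_neg[of b m a] side_swap[of a b] by simp

lemma side_bp_iff:
  assumes "a \<noteq> b"
  shows "side a b (bp m) < 0 \<longleftrightarrow> cyc a m b" "side a b (bp m) > 0 \<longleftrightarrow> cyc b m a"
    "side a b (bp m) = 0 \<longleftrightarrow> m = a \<or> m = b"
  using side_neg[of a m b] side_pos[of b m a] cyc_linear[of a m b] cyc_distinct[of a m b]
    cyc_distinct[of b m a] side_ends assms by (metis order_less_asym less_irrefl)+

lemma bp_inj: "bp a = bp b \<Longrightarrow> a = b"
proof (rule ccontr)
  assume ab: "bp a = bp b" "a \<noteq> b"
  then obtain y where y: "b = to_circle y" "pos a < y" "y < pos a + 1"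
    using to_circle_lift_neq[of b "pos a"] by auto
  then have "cyc (to_circle (pos a)) (to_circle ((pos a + y) / 2)) b"
    unfolding y(1) by (intro cyc_to_circle) auto
  then have "side a b (bp (to_circle ((pos a + y) / 2))) < 0" using side_neg by simp
  then show False using ab by (simp add: side_def)
qed

text \<open>The deficit \<open>u * (1 - u)\<close> is positive exactly for \<open>0 < u < 1\<close>,
  so the open disc cuts out of the line through two boundary points precisely the open
  chord.\<close>

lemma norm_chord:
  assumes "norm p = 1" "norm q = 1"
  shows "(norm ((1 - u) *\<^sub>R p + u *\<^sub>R q :: complex))\<^sup>2 = 1 - u * (1 - u) * (norm (q - p))\<^sup>2"
proof -
  obtain a b c d where [simp]: "p = Complex a b" "q = Complex c d" by (metis complex.exhaust)
  have 1: "b\<^sup>2 = 1 - a\<^sup>2" "d\<^sup>2 = 1 - c\<^sup>2" using assms by (simp_all add: cmod_def)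
  have "(norm ((1 - u) *\<^sub>R p + u *\<^sub>R q))\<^sup>2 - (1 - u * (1 - u) * (norm (q - p))\<^sup>2) =
     (1 - u) * (a\<^sup>2 + b\<^sup>2) + u * (c\<^sup>2 + d\<^sup>2) - 1"
    unfolding cmod_power2 by (simp add: power2_eq_square algebra_simps)
  then show ?thesis using 1 by simp
qed

lemma geodesic_chord:
  assumes "a \<noteq> b"
  shows "p \<in> geodesic {a, b} \<longleftrightarrow> (\<exists>u. 0 < u \<and> u < 1 \<and> p = (1 - u) *\<^sub>R bp a + u *\<^sub>R bp b)"
proof -
  have pos: "(norm (bp b - bp a))\<^sup>2 > 0" using bp_inj assms by fastforce
  have *: "norm ((1 - u) *\<^sub>R bp a + u *\<^sub>R bp b) < 1 \<longleftrightarrow> 0 < u \<and> u < 1" for u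
  proof -
    have "norm ((1 - u) *\<^sub>R bp a + u *\<^sub>R bp b) < 1 \<longleftrightarrow>
      (norm ((1 - u) *\<^sub>R bp a + u *\<^sub>R bp b))\<^sup>2 < 1"
      by (simp add: abs_square_less_1)
    also have "\<dots> \<longleftrightarrow> 0 < u * (1 - u)"
      using pos by (simp add: norm_chord zero_less_mult_iff)
    also have "\<dots> \<longleftrightarrow> 0 < u \<and> u < 1" by (auto simp: zero_less_mult_iff)
    finally show ?thesis .
  qed
  have "geodesic {a, b} = closed_segment (bp a) (bp b) \<inter> ball 0 1"
    by (simp add: geodesic_def segment_convex_hull)
  then have "p \<in> geodesic {a, b} \<longleftrightarrow>
      (\<exists>u. 0 \<le> u \<and> u \<le> 1 \<and> p = (1 - u) *\<^sub>R bp a + u *\<^sub>R bp b) \<and> norm p < 1"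
    by (auto simp: in_segment)
  then show ?thesis using * by (metis less_imp_le)
qed

lemma geodesic_iff:
  assumes "a \<noteq> b"
  shows "p \<in> geodesic {a, b} \<longleftrightarrow> norm p < 1 \<and> side a b p = 0"
proof
  assume p: "p \<in> geodesic {a, b}"
  then obtain u where "p = (1 - u) *\<^sub>R bp a + u *\<^sub>R bp b"
    using geodesic_chord[OF assms] by blast
  then show "norm p < 1 \<and> side a b p = 0" using p by (simp add: side_affine geodesic_def)
next
  assume p: "norm p < 1 \<and> side a b p = 0"
  define w where "w = bp b - bp a"
  have w: "(Re w)\<^sup>2 + (Im w)\<^sup>2 > 0"
    using bp_inj assms by (metis cmod_power2 eq_iff_diff_eq_0 norm_eq_zero w_def zero_less_power2)
  \<comment> \<open>The parameter of the orthogonal projection of \<open>p\<close> onto the line; as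
    \<open>side a b p = 0\<close>, the point is its own projection.\<close>
  define u where "u = (Re w * Re (p - bp a) + Im w * Im (p - bp a)) / ((Re w)\<^sup>2 + (Im w)\<^sup>2)"
  have s: "Re w * Im (p - bp a) = Im w * Re (p - bp a)" using p by (simp add: side_def w_def)
  have u: "u * ((Re w)\<^sup>2 + (Im w)\<^sup>2) = Re w * Re (p - bp a) + Im w * Im (p - bp a)"
    using w by (simp add: u_def)
  have "(u * Re w - Re (p - bp a)) * ((Re w)\<^sup>2 + (Im w)\<^sup>2) =
      (Re w * Re (p - bp a) + Im w * Im (p - bp a)) * Re w - Re (p - bp a) * ((Re w)\<^sup>2 + (Im w)\<^sup>2)"
    unfolding u[symmetric] by (simp add: algebra_simps)
  also have "\<dots> = Im w * (Re w * Im (p - bp a) - Im w * Re (p - bp a))"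
    by (simp add: algebra_simps power2_eq_square)
  finally have 1: "u * Re w = Re (p - bp a)" using s w by auto
  have "(u * Im w - Im (p - bp a)) * ((Re w)\<^sup>2 + (Im w)\<^sup>2) =
      (Re w * Re (p - bp a) + Im w * Im (p - bp a)) * Im w - Im (p - bp a) * ((Re w)\<^sup>2 + (Im w)\<^sup>2)"
    unfolding u[symmetric] by (simp add: algebra_simps)
  also have "\<dots> = Re w * (Im w * Re (p - bp a) - Re w * Im (p - bp a))"
    by (simp add: algebra_simps power2_eq_square)
  finally have 2: "u * Im w = Im (p - bp a)" using s w by auto
  have e: "p = (1 - u) *\<^sub>R bp a + u *\<^sub>R bp b"
    using 1 2 by (intro complex_eqI) (simp_all add: w_def algebra_simps)
  have "(norm p)\<^sup>2 < 1" using p by (simp add: abs_square_less_1)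
  then have "0 < u * (1 - u) * (norm (bp b - bp a))\<^sup>2" unfolding e by (simp add: norm_chord)
  then have "0 < u \<and> u < 1" by (auto simp: zero_less_mult_iff)
  then show "p \<in> geodesic {a, b}" using e geodesic_chord[OF assms] by blast
qed

lemma side_Delta:
  "side b c (bp a) = side a b (bp c)" "side c a (bp b) = side a b (bp c)"
  "side a b z + side b c z + side c a z = side a b (bp c)"
  by (simp_all add: side_def algebra_simps)

text \<open>Up to the common factor \<open>side a b (bp c)\<close>, to which they add up by
  \<open>side_Delta\<close>, the three values are the barycentric coordinates of \<open>z\<close> in
  the triangle.\<close>

lemma side_barycentric:
  "side b c z *\<^sub>R bp a + side c a z *\<^sub>R bp b + side a b z *\<^sub>R bp c = side a b (bp c) *\<^sub>R z"
  by (rule complex_eqI) (simp_all add: side_def algebra_simps)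

lemma open_triangle_eq:
  assumes "cyc a b c"
  shows "open_ideal_triangle {a, b, c} = {z. side a b z > 0 \<and> side b c z > 0 \<and> side c a z > 0}"
proof -
  define \<Delta> where "\<Delta> = side a b (bp c)"
  have pos: "\<Delta> > 0" unfolding \<Delta>_def using side_pos[of b c a] assms cyc_rotate by blast
  have "\<not> collinear {bp a, bp b, bp c}"
  proof
    assume "collinear {bp a, bp b, bp c}"
    then obtain u where u: "\<And>x y. x \<in> {bp a, bp b, bp c} \<Longrightarrow> y \<in> {bp a, bp b, bp c} \<Longrightarrow> \<exists>k. x - y = k *\<^sub>R u"
      unfolding collinear_def by blast
    obtain k l where "bp b - bp a = k *\<^sub>R u" "bp c - bp a = l *\<^sub>R u" using u[of "bp b" "bp a"] u[of "bp c" "bp a"] by blast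
    then have "Re (bp b) - Re (bp a) = k * Re u" "Im (bp b) - Im (bp a) = k * Im u"
      "Re (bp c) - Re (bp a) = l * Re u" "Im (bp c) - Im (bp a) = l * Im u"
      by (metis minus_complex.simps scaleR_complex.simps)+
    then have "\<Delta> = 0" unfolding \<Delta>_def side_def by simp
    then show False using pos by simp
  qed
  moreover have "DIM(complex) = 2" by simp
  ultimately have *: "open_ideal_triangle {a, b, c} =
    {v. \<exists>x y z. 0 < x \<and> 0 < y \<and> 0 < z \<and> x + y + z = 1 \<and> x *\<^sub>R bp a + y *\<^sub>R bp b + z *\<^sub>R bp c = v}"
    unfolding open_ideal_triangle_def image_insert image_empty by (rule interior_convex_hull_3_minimal)
  show ?thesis unfolding *
  proof (intro equalityI subsetI; clarify)
    fix x y z :: real assume h: "0 < x" "0 < y" "0 < z" "x + y + z = 1"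
    then show "side a b (x *\<^sub>R bp a + y *\<^sub>R bp b + z *\<^sub>R bp c) > 0 \<and>
      side b c (x *\<^sub>R bp a + y *\<^sub>R bp b + z *\<^sub>R bp c) > 0 \<and>
      side c a (x *\<^sub>R bp a + y *\<^sub>R bp b + z *\<^sub>R bp c) > 0"
      using pos unfolding side_affine3[OF h(4)] by (simp add: side_Delta \<Delta>_def)
  next
    fix v assume v: "side a b v > 0" "side b c v > 0" "side c a v > 0"
    show "\<exists>x y z. 0 < x \<and> 0 < y \<and> 0 < z \<and> x + y + z = 1 \<and> x *\<^sub>R bp a + y *\<^sub>R bp b + z *\<^sub>R bp c = v"
    proof (intro exI conjI)
      show "0 < side b c v / \<Delta>" "0 < side c a v / \<Delta>" "0 < side a b v / \<Delta>" using v pos by simp_all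
      show "side b c v / \<Delta> + side c a v / \<Delta> + side a b v / \<Delta> = 1"
        using side_Delta(3)[of a b v c] pos unfolding \<Delta>_def[symmetric] by (simp add: field_simps)
      have "(side b c v / \<Delta>) *\<^sub>R bp a + (side c a v / \<Delta>) *\<^sub>R bp b + (side a b v / \<Delta>) *\<^sub>R bp c
        = (1 / \<Delta>) *\<^sub>R (side b c v *\<^sub>R bp a + side c a v *\<^sub>R bp b + side a b v *\<^sub>R bp c)"
        by (simp add: scaleR_add_right)
      also have "\<dots> = v" unfolding side_barycentric \<Delta>_def[symmetric] using pos by simp
      finally show "(side b c v / \<Delta>) *\<^sub>R bp a + (side c a v / \<Delta>) *\<^sub>R bp b + (side a b v / \<Delta>) *\<^sub>R bp c = v" .
    qed
  qed
qed

lemma open_triangle_disc: "open_ideal_triangle T \<subseteq> hyperbolic_disc"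
proof -
  have "convex hull (bp ` T) \<subseteq> cball 0 1"
    by (rule hull_minimal) auto
  then have "interior (convex hull (bp ` T)) \<subseteq> interior (cball 0 1)" by (rule interior_mono)
  then show ?thesis by (simp add: open_ideal_triangle_def)
qed

lemma open_triangle_nonempty: "cyc a b c \<Longrightarrow> open_ideal_triangle {a, b, c} \<noteq> {}"
proof -
  assume h: "cyc a b c"
  have d: "side a b (bp c) > 0" using side_pos[of b c a] h cyc_rotate by blast
  have "(1/3) *\<^sub>R bp a + (1/3) *\<^sub>R bp b + (1/3) *\<^sub>R bp c \<in> open_ideal_triangle {a, b, c}"
    unfolding open_triangle_eq[OF h] using d by (simp add: side_affine3 side_Delta)
  then show ?thesis by blast
qed

lemma weighted_sum_neq_0:
  "0 < p \<Longrightarrow> 0 < q \<Longrightarrow> 0 \<le> x \<Longrightarrow> 0 \<le> y \<Longrightarrow> \<not> (x = 0 \<and> y = 0) \<Longrightarrow> p * x + q * y \<noteq> (0 :: real)"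
  by (auto simp: add_nonneg_eq_0_iff)

text \<open>At a common point \<open>side a b\<close> vanishes and is a proper convex combination of
  its values at the ends \<open>c\<close> and \<open>d\<close>. These are not both zero, so they
  have opposite signs, which means crossing.\<close>

lemma disjoint_geodesics:
  assumes "A \<in> arcs" "B \<in> arcs" "A \<noteq> B" "\<not> cross A B"
  shows "geodesic A \<inter> geodesic B = {}"
proof -
  obtain a b c d where A: "A = {a, b}" "a \<noteq> b" and B: "B = {c, d}" "c \<noteq> d"
    using assms(1,2) by (metis arcE)
  have False if p: "p \<in> geodesic {a, b}" "p \<in> geodesic {c, d}" for p
  proof -
    have p0: "side a b p = 0" using p(1) geodesic_iff[OF A(2)] by blast
    obtain u where u: "0 < u" "u < 1" "p = (1 - u) *\<^sub>R bp c + u *\<^sub>R bp d"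
      using p(2) geodesic_chord[OF B(2)] by blast
    have z: "(1 - u) * side a b (bp c) + u * side a b (bp d) = 0"
      using p0 unfolding u(3) side_affine .
    have nb: "\<not> (side a b (bp c) = 0 \<and> side a b (bp d) = 0)"
      using assms(3) A B side_bp_iff(3)[OF A(2)] by (auto simp: insert_commute)
    have "0 < 1 - u" using u by simp
    then have "(1 - u) * x + u * y \<noteq> 0" if xy: "x \<le> 0 \<and> y \<le> 0 \<or> 0 \<le> x \<and> 0 \<le> y" "\<not> (x = 0 \<and> y = 0)" for x y
      using weighted_sum_neq_0[OF \<open>0 < 1 - u\<close> \<open>0 < u\<close>, of "- x" "- y"]
        weighted_sum_neq_0[OF \<open>0 < 1 - u\<close> \<open>0 < u\<close>, of x y] xy by (auto simp: algebra_simps)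
    then have "side a b (bp c) < 0 \<and> 0 < side a b (bp d) \<or> 0 < side a b (bp c) \<and> side a b (bp d) < 0"
      using z nb by (metis not_le order_less_imp_le)
    then show False using assms(4) unfolding A B cross_iff side_bp_iff[OF A(2)] by blast
  qed
  then show ?thesis unfolding A B by blast
qed

lemma crossing_geodesics:
  assumes "cyc a c b" "cyc b d a"
  obtains u where "0 < u" "u < 1" "(1 - u) *\<^sub>R bp c + u *\<^sub>R bp d \<in> geodesic {a, b}"
    "(1 - u) *\<^sub>R bp c + u *\<^sub>R bp d \<in> geodesic {c, d}"
proof -
  have n: "a \<noteq> b" "c \<noteq> d" using assms cyc_distinct cyc_asym cyc_rotate by blast+
  define s t where "s = side a b (bp c)" and "t = side a b (bp d)"
  have st: "s < 0" "0 < t" using assms side_neg side_pos by (auto simp: s_def t_def)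
  \<comment> \<open>The zero of the affine function with value \<open>s\<close> at parameter 0 and
    \<open>t\<close> at parameter 1.\<close>
  define u where "u = - s / (t - s)"
  have u: "0 < u" "u < 1" using st by (simp_all add: u_def field_simps)
  have "(1 - u) * s + u * t = s + u * (t - s)" by (simp add: algebra_simps)
  also have "\<dots> = 0" using st by (simp add: u_def)
  finally have "side a b ((1 - u) *\<^sub>R bp c + u *\<^sub>R bp d) = 0"
    by (simp add: side_affine s_def t_def)
  moreover have g: "(1 - u) *\<^sub>R bp c + u *\<^sub>R bp d \<in> geodesic {c, d}"
    using u geodesic_chord[OF n(2)] by blast
  ultimately show ?thesis using that u geodesic_iff n by blast
qed

lemma cross_imp_geodesics_meet: "cross A B \<Longrightarrow> geodesic A \<inter> geodesic B \<noteq> {}"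
  unfolding cross_def by (metis crossing_geodesics IntI empty_iff)

text \<open>The vertices cut the circle into three intervals. Ends in the interiors of different
  intervals, or one at a vertex and one inside the opposite interval, force a crossing with a
  side.\<close>

lemma not_cross_triangle:
  assumes "cyc a b c" "x \<noteq> y" "\<not> cross {a, b} {x, y}" "\<not> cross {b, c} {x, y}" "\<not> cross {c, a} {x, y}"
  shows "(\<forall>m\<in>{x, y}. m = a \<or> m = b \<or> cyc a m b) \<or> (\<forall>m\<in>{x, y}. m = b \<or> m = c \<or> cyc b m c) \<or>
    (\<forall>m\<in>{x, y}. m = c \<or> m = a \<or> cyc c m a)"
proof -
  have tri: "m = a \<or> m = b \<or> m = c \<or> cyc a m b \<or> cyc b m c \<or> cyc c m a" for m
    using assms(1) by (smt (verit) cyc_def pos_eq_iff)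
  have out: "cyc b c a" "cyc c a b" using assms(1) cyc_rotate by blast+
  have sep: "cyc a m b \<Longrightarrow> cyc b n c \<Longrightarrow> cross {a, b} {m, n}" "cyc a m b \<Longrightarrow> cyc c n a \<Longrightarrow> cross {a, b} {m, n}"
    "cyc a m b \<Longrightarrow> n = c \<Longrightarrow> cross {a, b} {m, n}" if "cyc a b c" for a b c m n
    using that unfolding cross_iff by (smt (verit) cyc_def)+
  have "x = a \<or> x = b \<or> x = c \<or> cyc a x b \<or> cyc b x c \<or> cyc c x a" by (rule tri)
  then consider "x = a" | "x = b" | "x = c" | "cyc a x b" | "cyc b x c" | "cyc c x a" by blast
  then show ?thesis
  proof cases
    case 1
    then show ?thesis using tri[of y] sep(3)[OF out(1), of y x] assms(4) by (auto simp: insert_commute)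
  next
    case 2
    then show ?thesis using tri[of y] sep(3)[OF out(2), of y x] assms(5) by (auto simp: insert_commute)
  next
    case 3
    then show ?thesis using tri[of y] sep(3)[OF assms(1), of y x] assms(3) by (auto simp: insert_commute)
  next
    case 4
    then show ?thesis using tri[of y] sep[OF assms(1) 4, of y] assms(3) by auto
  next
    case 5
    then show ?thesis using tri[of y] sep[OF out(1) 5, of y] assms(4) by auto
  next
    case 6
    then show ?thesis using tri[of y] sep[OF out(2) 6, of y] assms(5) by auto
  qed
qed

text \<open>By \<open>not_cross_triangle\<close> both ends, hence the whole chord, lie in the closed
  half-plane beyond one side.\<close>

lemma triangle_geodesic_disjoint:
  assumes "cyc a b c" "A \<in> arcs" "\<not> cross {a, b} A" "\<not> cross {b, c} A" "\<not> cross {c, a} A"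
  shows "open_ideal_triangle {a, b, c} \<inter> geodesic A = {}"
proof -
  obtain x y where A: "A = {x, y}" "x \<noteq> y" using assms(2) by (rule arcE)
  have no: "side s t p \<le> 0" if p: "p \<in> geodesic A" and "\<forall>m\<in>{x, y}. m = s \<or> m = t \<or> cyc s m t" for s t p
  proof -
    have le: "side s t (bp m) \<le> 0" if "m = s \<or> m = t \<or> cyc s m t" for m
      using that side_neg[of s m t] by auto
    have "side s t (bp x) \<le> 0" "side s t (bp y) \<le> 0" using that(2) le by simp_all
    moreover obtain u where "0 < u" "u < 1" "p = (1 - u) *\<^sub>R bp x + u *\<^sub>R bp y"
      using p unfolding A(1) geodesic_chord[OF A(2)] by blast
    ultimately show ?thesis unfolding \<open>p = _\<close> side_affine
      by (simp add: add_nonpos_nonpos mult_nonneg_nonpos)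
  qed
  consider "\<forall>m\<in>{x, y}. m = a \<or> m = b \<or> cyc a m b" | "\<forall>m\<in>{x, y}. m = b \<or> m = c \<or> cyc b m c" |
    "\<forall>m\<in>{x, y}. m = c \<or> m = a \<or> cyc c m a"
    using not_cross_triangle[OF assms(1) A(2)] assms(3-5) unfolding A(1) by blast
  then show ?thesis unfolding open_triangle_eq[OF assms(1)]
  proof cases
    case 1
    then show "{z. side a b z > 0 \<and> side b c z > 0 \<and> side c a z > 0} \<inter> geodesic A = {}" using no[OF _ 1] by fastforce
  next
    case 2
    then show "{z. side a b z > 0 \<and> side b c z > 0 \<and> side c a z > 0} \<inter> geodesic A = {}" using no[OF _ 2] by fastforce
  next
    case 3
    then show "{z. side a b z > 0 \<and> side b c z > 0 \<and> side c a z > 0} \<inter> geodesic A = {}" using no[OF _ 3] by fastforce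
  qed
qed

subsection \<open>Complementary regions\<close>

lemma dyadic_triangleE:
  assumes "T \<in> dyadic_triangles"
  obtains a b c where "T = {a, b, c}" "cyc a b c" "a \<in> dyadic_points" "b \<in> dyadic_points" "c \<in> dyadic_points"
proof -
  from assms have T: "T \<subseteq> dyadic_points" "card T = 3" by (auto simp: dyadic_triangles_def)
  then obtain a b c where abc: "T = {a, b, c}" "a \<noteq> b" "b \<noteq> c" "a \<noteq> c" by (auto simp: card_3_iff)
  from cyc_linear[OF abc(2-4)] show ?thesis
  proof
    assume "cyc a b c"
    then show ?thesis using that abc T by auto
  next
    assume "cyc c b a"
    then show ?thesis using that[of c b a] abc T by auto
  qed
qed

lemma dyadic_triangleI:
  "cyc a b c \<Longrightarrow> a \<in> dyadic_points \<Longrightarrow> b \<in> dyadic_points \<Longrightarrow> c \<in> dyadic_points \<Longrightarrow> {a, b, c} \<in> dyadic_triangles"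
  using cyc_distinct[of a b c] by (auto simp: dyadic_triangles_def)

text \<open>Combinatorial counterpart of \<open>triangles\<close>, without regions of the disc; the
  two agree under \<open>comb\<close> (\<open>comb_triangulation\<close>).\<close>

definition side_triangles :: "circle set set \<Rightarrow> circle set set" where
  "side_triangles v = {T \<in> dyadic_triangles. \<forall>x\<in>T. \<forall>y\<in>T. x \<noteq> y \<longrightarrow> {x, y} \<in> v}"

lemma side_trianglesI:
  "cyc a b c \<Longrightarrow> v \<subseteq> arcs \<Longrightarrow> {a, b} \<in> v \<Longrightarrow> {b, c} \<in> v \<Longrightarrow> {c, a} \<in> v \<Longrightarrow> {a, b, c} \<in> side_triangles v"
proof -
  assume h: "cyc a b c" "v \<subseteq> arcs" "{a, b} \<in> v" "{b, c} \<in> v" "{c, a} \<in> v"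
  then have "{a, b} \<in> arcs" "{b, c} \<in> arcs" by auto
  then have "{a, b, c} \<in> dyadic_triangles" using dyadic_triangleI h(1) by (simp add: arc_iff)
  then show ?thesis using h by (auto simp: side_triangles_def insert_commute)
qed

lemma side_trianglesD:
  "{a, b, c} \<in> side_triangles v \<Longrightarrow> cyc a b c \<Longrightarrow> {a, b} \<in> v \<and> {b, c} \<in> v \<and> {c, a} \<in> v"
  using cyc_distinct[of a b c] by (auto simp: side_triangles_def)

text \<open>Without the three side chords the disc is covered by the open triangle and the open set
  \<open>W\<close> beyond its sides, which are disjoint. A connected set that contains the triangle
  and avoids the chords cannot leave it.\<close>

lemma triangle_component:
  assumes "v \<subseteq> arcs" "cyc a b c" "{a, b} \<in> v" "{b, c} \<in> v" "{c, a} \<in> v"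
    and "\<And>A. A \<in> v \<Longrightarrow> \<not> cross {a, b} A \<and> \<not> cross {b, c} A \<and> \<not> cross {c, a} A"
  shows "open_ideal_triangle {a, b, c} \<in> complementary_regions v"
proof -
  let ?T = "open_ideal_triangle {a, b, c}" and ?S = "hyperbolic_disc - \<Union> (geodesic ` v)"
  note eq = open_triangle_eq[OF assms(2)]
  have n: "a \<noteq> b" "b \<noteq> c" "c \<noteq> a" using cyc_distinct[OF assms(2)] by auto
  have sub: "?T \<subseteq> ?S"
    using open_triangle_disc[of "{a, b, c}"] triangle_geodesic_disjoint[OF assms(2)] assms(1,6) by blast
  have conn: "connected ?T"
    unfolding open_ideal_triangle_def by (intro convex_connected convex_interior convex_convex_hull)
  have "D = ?T" if D: "?T \<subseteq> D" "D \<subseteq> ?S" "connected D" for D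
  proof -
    define W where "W = {z. side a b z < 0} \<union> {z. side b c z < 0} \<union> {z. side c a z < 0}"
    have "open W" unfolding W_def
      by (intro open_Un open_Collect_less continuous_side continuous_on_const)
    moreover have "open ?T" by (simp add: open_ideal_triangle_def)
    moreover have "?T \<inter> W \<inter> D = {}" unfolding eq W_def by fastforce
    moreover have "D \<subseteq> ?T \<union> W"
    proof
      fix z assume "z \<in> D"
      then have "norm z < 1" "z \<notin> geodesic {a, b}" "z \<notin> geodesic {b, c}" "z \<notin> geodesic {c, a}"
        using D(2) assms(3-5) by auto
      then have "side a b z \<noteq> 0" "side b c z \<noteq> 0" "side c a z \<noteq> 0"
        using geodesic_iff n by blast+
      then show "z \<in> ?T \<union> W" unfolding eq W_def by auto
    qed
    ultimately have "?T \<inter> D = {} \<or> W \<inter> D = {}"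
      using connectedD[OF D(3), of ?T W] by blast
    then have "W \<inter> D = {}" using D(1) open_triangle_nonempty[OF assms(2)] by blast
    then show ?thesis using \<open>D \<subseteq> ?T \<union> W\<close> D(1) by blast
  qed
  then show ?thesis unfolding complementary_regions_def in_components_maximal
    using sub conn open_triangle_nonempty[OF assms(2)] by blast
qed

text \<open>A chord spanning the central angle \<open>2 * \<delta>\<close> cuts off the cap where
  the coordinate in the direction \<open>\<mu>\<close> exceeds \<open>cos \<delta>\<close>. A point
  of the cap has norm above \<open>cos \<delta>\<close>, which bounds \<open>\<delta>\<close> from
  below by \<open>arccos (norm z)\<close>.\<close>

lemma cap_len_bound:
  assumes "norm z < 1"
  obtains \<epsilon> where "\<epsilon> > 0" "\<And>a b. a \<noteq> b \<Longrightarrow> side a b z < 0 \<Longrightarrow> \<epsilon> \<le> len a b"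
proof
  show "arccos (norm z) / pi > 0" using arccos_lt_bounded[of "norm z"] assms
    by (simp add: order_less_le_trans[of "-1" 0])
  fix a b assume "a \<noteq> b" and neg: "side a b z < 0"
  define x where "x = pos a"
  obtain y where y: "b = to_circle y" "x < y" "y < x + 1"
    using to_circle_lift_neq[of b x] \<open>a \<noteq> b\<close> unfolding x_def by auto
  have a: "a = to_circle x" by (simp add: x_def)
  define \<delta> \<mu> where "\<delta> = pi * (y - x)" "\<mu> = pi * (x + y)"
  have \<delta>: "0 < \<delta>" "\<delta> < pi" using y by (simp_all add: \<delta>_\<mu>_def)
  have xy: "2 * pi * x = \<mu> - \<delta>" "2 * pi * y = \<mu> + \<delta>" by (simp_all add: \<delta>_\<mu>_def algebra_simps)
  define c s where "c = cos \<mu>" "s = sin \<mu>"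
  have "side a b z = - 2 * sin \<delta> * (c * Re z + s * Im z - (s\<^sup>2 + c\<^sup>2) * cos \<delta>)"
    unfolding side_def a y(1) bp_to_circle xy cis.sel cos_diff cos_add sin_diff sin_add c_s_def[symmetric]
    by (simp add: power2_eq_square algebra_simps)
  moreover have "s\<^sup>2 + c\<^sup>2 = 1" by (simp add: c_s_def)
  ultimately have "side a b z = - 2 * sin \<delta> * (cos \<mu> * Re z + sin \<mu> * Im z - cos \<delta>)"
    by (simp add: c_s_def)
  then have "0 < 2 * sin \<delta> * (cos \<mu> * Re z + sin \<mu> * Im z - cos \<delta>)"
    using neg by simp
  moreover have "sin \<delta> > 0" using sin_gt_zero \<delta> by blast
  ultimately have "cos \<delta> < cos \<mu> * Re z + sin \<mu> * Im z" by (simp add: zero_less_mult_iff)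
  also have "\<dots> = Re (cis (- \<mu>) * z)" by simp
  also have "\<dots> \<le> norm (cis (- \<mu>) * z)" by (rule complex_Re_le_cmod)
  also have "\<dots> = norm z" by (simp add: norm_mult)
  also have "\<dots> = cos (arccos (norm z))" using assms by (intro cos_arccos[symmetric]) (auto intro: order_trans[of _ 0])
  finally have "cos \<delta> < cos (arccos (norm z))" .
  moreover have "- 1 \<le> norm z" using norm_ge_zero[of z] by linarith
  ultimately have "arccos (norm z) < \<delta>"
    using \<delta> arccos_lbound[of "norm z"] arccos_ubound[of "norm z"] assms
    by (subst (asm) cos_mono_less_eq) auto
  then have "arccos (norm z) / pi < y - x" by (simp add: \<delta>_\<mu>_def field_simps)
  then show "arccos (norm z) / pi \<le> len a b" using len_lift[of x y] y a by simp
qed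

text \<open>Among the caps containing \<open>z\<close> take one of least length, which exists by
  \<open>cap_len_bound\<close> and local finiteness. The triangle inside it over its chord has two
  further sides cutting off shorter caps, which miss \<open>z\<close>; so \<open>z\<close> lies in
  the triangle.\<close>

lemma triangle_cover:
  assumes "comb v" "z \<in> hyperbolic_disc" "z \<notin> \<Union> (geodesic ` v)"
  obtains a b c where "cyc a b c" "{a, b} \<in> v" "{b, c} \<in> v" "{c, a} \<in> v" "z \<in> open_ideal_triangle {a, b, c}"
proof -
  have arc: "a \<noteq> b" if "{a, b} \<in> v" for a b using comb_arcs[OF assms(1) that] arc_iff by blast
  have nz: "side a b z \<noteq> 0" if ab: "{a, b} \<in> v" for a b
    using ab assms(2,3) geodesic_iff[OF arc[OF ab]] by force
  define cap where "cap = {(a, b). {a, b} \<in> v \<and> side a b z < 0}"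
  obtain \<epsilon> where \<epsilon>: "\<epsilon> > 0" "\<And>a b. a \<noteq> b \<Longrightarrow> side a b z < 0 \<Longrightarrow> \<epsilon> \<le> len a b"
    using assms(2) by (auto intro: cap_len_bound[of z])
  \<comment> \<open>Any arc of \<open>v\<close> has \<open>z\<close> strictly on one side, so one of
    its two directions supplies a first cap.\<close>
  obtain N where "stdarc N 0 \<in> v" by (rule comb_stdarcs[OF assms(1)]) blast
  then obtain a b where "{a, b} \<in> v" unfolding stdarc_def by blast
  then have "(a, b) \<in> cap \<or> (b, a) \<in> cap"
    using nz[of a b] side_swap[of a b z] by (auto simp: cap_def insert_commute)
  then obtain p where p: "p \<in> cap" by blast
  define \<eta> where "\<eta> = min \<epsilon> (1 - len (fst p) (snd p))"
  have "\<eta> > 0" using \<epsilon> len_less_1 by (simp add: \<eta>_def)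
  define S where "S = {q \<in> cap. len (fst q) (snd q) \<le> len (fst p) (snd p)}"
  have "S \<subseteq> {(a, b). {a, b} \<in> v \<and> \<eta> \<le> len a b \<and> len a b \<le> 1 - \<eta>}"
  proof
    fix q assume q: "q \<in> S"
    then have "\<epsilon> \<le> len (fst q) (snd q)" using \<epsilon>(2)[of "fst q" "snd q"] arc[of "fst q" "snd q"] by (auto simp: S_def cap_def)
    then show "q \<in> {(a, b). {a, b} \<in> v \<and> \<eta> \<le> len a b \<and> len a b \<le> 1 - \<eta>}"
      using q by (auto simp: S_def cap_def \<eta>_def)
  qed
  then have "finite S" using finite_comb_len[OF assms(1) \<open>\<eta> > 0\<close>] finite_subset by blast
  moreover have "p \<in> S" using p by (simp add: S_def)
  ultimately have "Min ((\<lambda>q. len (fst q) (snd q)) ` S) \<in> (\<lambda>q. len (fst q) (snd q)) ` S" by (intro Min_in) auto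
  then obtain q where q: "q \<in> S" "len (fst q) (snd q) = Min ((\<lambda>q. len (fst q) (snd q)) ` S)" by auto
  then have min: "len (fst q) (snd q) \<le> len (fst q') (snd q')" if "q' \<in> S" for q'
    using \<open>finite S\<close> that by simp
  obtain a b where ab: "q = (a, b)" by (cases q)
  have abv: "{a, b} \<in> v" "side a b z < 0" using q(1) by (auto simp: S_def cap_def ab)
  obtain m where m: "cyc a m b" "{a, m} \<in> v" "{m, b} \<in> v" using third_vertex_exists[OF assms(1) abv(1)] .
  have small: "\<not> side c d z < 0" if "{c, d} \<in> v" "len c d < len a b" for c d
  proof
    assume "side c d z < 0"
    then have "(c, d) \<in> S" using that q(1) by (auto simp: S_def cap_def ab)
    then show False using min[of "(c, d)"] that(2) by (simp add: ab)
  qed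
  have "side a m z > 0" "side m b z > 0"
    using small[OF m(2) cyc_len[OF m(1)]] small[OF m(3) cyc_len'[OF m(1)]] nz m by fastforce+
  moreover have "side b a z > 0" using abv(2) side_swap[of b a z] by simp
  ultimately have "z \<in> open_ideal_triangle {a, m, b}" using open_triangle_eq[OF m(1)] by blast
  then show ?thesis using that m abv(1) by (auto simp: insert_commute)
qed

lemma open_segment_step:
  fixes p q :: complex
  assumes "open U" "p \<in> U"
  obtains s where "0 < s" "s < 1" "(1 - s) *\<^sub>R p + s *\<^sub>R q \<in> U"
proof -
  obtain e where e: "e > 0" "ball p e \<subseteq> U" using assms open_contains_ball by blast
  define n where "n = norm (q - p)"
  define s where "s = min (1 / 2) (e / (2 * (n + 1)))"
  have n: "n \<ge> 0" by (simp add: n_def)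
  then have s: "0 < s" "s < 1" using e by (simp_all add: s_def)
  have "(1 - s) *\<^sub>R p + s *\<^sub>R q - p = s *\<^sub>R (q - p)" by (simp add: algebra_simps)
  then have "norm ((1 - s) *\<^sub>R p + s *\<^sub>R q - p) = s * n" using s by (simp add: n_def)
  also have "\<dots> \<le> e / (2 * (n + 1)) * n" using n by (intro mult_right_mono) (auto simp: s_def)
  also have "\<dots> < e" using n e by (simp add: field_simps) (smt (verit) mult_nonneg_nonneg)
  finally have "(1 - s) *\<^sub>R p + s *\<^sub>R q \<in> ball p e" by (simp add: dist_norm norm_minus_commute)
  then show ?thesis using that s e by blast
qed

text \<open>The midpoint \<open>p\<close> of a missing side is contradictory either way. Off all
  geodesics it lies in an open region that meets the triangle and so equals it, although
  \<open>p\<close> is outside; on the geodesic of another arc, that arc crosses the side and enters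
  the triangle.\<close>

lemma triangulation_side:
  assumes "triangulation v" "{a, b, c} \<in> triangles v" "cyc a b c"
  shows "{a, b} \<in> v"
proof (rule ccontr)
  assume nv: "{a, b} \<notin> v"
  let ?T = "open_ideal_triangle {a, b, c}" and ?S = "hyperbolic_disc - \<Union> (geodesic ` v)"
  have T: "?T \<in> components ?S" and dy: "{a, b, c} \<in> dyadic_triangles"
    using assms(2) by (auto simp: triangles_def complementary_regions_def)
  have va: "v \<subseteq> arcs" and reg: "components ?S \<subseteq> open_ideal_triangle ` dyadic_triangles"
    using assms(1) by (auto simp: triangulation_def complementary_regions_def)
  note eq = open_triangle_eq[OF assms(3)]
  have n: "a \<noteq> b" using cyc_distinct[OF assms(3)] by auto
  have \<Delta>: "side a b (bp c) > 0" using side_pos[of b c a] assms(3) cyc_rotate by blast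
  define p where "p = (1 - 1 / 2) *\<^sub>R bp a + (1 / 2) *\<^sub>R bp b"
  have p: "p \<in> geodesic {a, b}"
    unfolding p_def geodesic_chord[OF n] by (intro exI[of _ "1 / 2"]) simp
  have sp: "side a b p = 0" "side b c p = side a b (bp c) / 2" "side c a p = side a b (bp c) / 2"
    unfolding p_def side_affine by (simp_all add: side_Delta)
  have "p \<in> hyperbolic_disc" using p by (simp add: geodesic_def)
  have "p \<in> \<Union> (geodesic ` v)"
  proof (rule ccontr)
    assume "p \<notin> \<Union> (geodesic ` v)"
    then have "p \<in> \<Union> (components ?S)" using \<open>p \<in> hyperbolic_disc\<close> Union_components[of ?S] by blast
    then obtain C where C: "C \<in> components ?S" "p \<in> C" by blast
    then have "open C" using reg by (auto simp: open_ideal_triangle_def)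
    then obtain s where s: "0 < s" "s < 1" "(1 - s) *\<^sub>R p + s *\<^sub>R bp c \<in> C"
      using open_segment_step C(2) by blast
    have "(1 - s) *\<^sub>R p + s *\<^sub>R bp c \<in> ?T"
      unfolding eq using s \<Delta> by (simp add: side_affine sp)
    then have "C = ?T" using s(3) C(1) T components_nonoverlap by blast
    then show False using C(2) sp(1) unfolding eq by simp
  qed
  then obtain A where A: "A \<in> v" "p \<in> geodesic A" by blast
  have dyab: "{a, b} \<in> arcs" using dy n by (auto simp: dyadic_triangles_def arc_iff)
  have "A \<noteq> {a, b}" "A \<in> arcs" using A nv va by auto
  then have "cross {a, b} A"
    using disjoint_geodesics[OF dyab \<open>A \<in> arcs\<close>] A(2) p by blast
  moreover obtain x y where xy: "A = {x, y}" using \<open>A \<in> arcs\<close> by (rule arcE)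
  ultimately obtain x y where xy: "A = {x, y}" "cyc a x b" "cyc b y a"
    by (auto simp: cross_iff insert_commute)
  have xny: "x \<noteq> y" using xy(2,3) cyc_asym cyc_rotate by blast
  define U where "U = {z. 0 < side b c z} \<inter> {z. 0 < side c a z}"
  have "open U" unfolding U_def by (intro open_Int open_Collect_less continuous_side continuous_on_const)
  moreover have "p \<in> U" using \<Delta> by (simp add: U_def sp)
  ultimately obtain s where s: "0 < s" "s < 1" "(1 - s) *\<^sub>R p + s *\<^sub>R bp y \<in> U"
    by (rule open_segment_step)
  have "side a b ((1 - s) *\<^sub>R p + s *\<^sub>R bp y) > 0"
    using s side_pos[OF xy(3)] by (simp add: side_affine sp)
  then have inT: "(1 - s) *\<^sub>R p + s *\<^sub>R bp y \<in> ?T" using s(3) unfolding eq U_def by simp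
  obtain u where u: "0 < u" "u < 1" "p = (1 - u) *\<^sub>R bp x + u *\<^sub>R bp y"
    using A(2) unfolding xy(1) geodesic_chord[OF xny] by blast
  \<comment> \<open>Parameter on the chord from \<open>x\<close> to \<open>y\<close> of the point
    reached from \<open>p\<close> by the step \<open>s\<close> towards \<open>y\<close>.\<close>
  define w where "w = u * (1 - s) + s"
  have "1 - w = (1 - s) * (1 - u)" by (simp add: w_def algebra_simps)
  then have "w < 1" using s u by (smt (verit) mult_pos_pos)
  moreover have "0 < w" using s u by (simp add: w_def add_pos_pos)
  moreover have "(1 - s) *\<^sub>R p + s *\<^sub>R bp y = (1 - w) *\<^sub>R bp x + w *\<^sub>R bp y"
    unfolding u(3) w_def by (simp add: algebra_simps)
  ultimately have "(1 - s) *\<^sub>R p + s *\<^sub>R bp y \<in> geodesic A"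
    unfolding xy(1) geodesic_chord[OF xny] by blast
  moreover have "?T \<subseteq> ?S" using T by (rule in_components_subset)
  ultimately show False using inT A(1) by blast
qed

lemma triangulation_side_triangles:
  assumes "triangulation v"
  shows "triangles v \<subseteq> side_triangles v"
proof
  fix T assume T: "T \<in> triangles v"
  then have "T \<in> dyadic_triangles" by (simp add: triangles_def)
  then obtain a b c where abc: "T = {a, b, c}" "cyc a b c" by (rule dyadic_triangleE)
  have "{a, b, c} = {b, c, a}" "{a, b, c} = {c, a, b}" by auto
  then have "{a, b} \<in> v" "{b, c} \<in> v" "{c, a} \<in> v"
    using triangulation_side[OF assms] T abc cyc_rotate by metis+
  moreover have "v \<subseteq> arcs" using assms by (simp add: triangulation_def)
  ultimately show "T \<in> side_triangles v"
    unfolding abc(1) by (intro side_trianglesI[OF abc(2)])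
qed

text \<open>Every point off the arcs lies in a triangle with sides in \<open>v\<close>
  (\<open>triangle_cover\<close>), and such triangles are components
  (\<open>triangle_component\<close>), so no other regions exist.\<close>

lemma comb_triangulation:
  assumes "comb v"
  shows "triangulation v"
    and "triangles v = side_triangles v"
proof -
  have va: "v \<subseteq> arcs" using assms by (simp add: comb_def)
  have comp: "open_ideal_triangle {a, b, c} \<in> complementary_regions v" "{a, b, c} \<in> dyadic_triangles"
    if h: "cyc a b c" "{a, b} \<in> v" "{b, c} \<in> v" "{c, a} \<in> v" for a b c
    using triangle_component[OF va h] comb_not_cross[OF assms] h
      side_trianglesI[OF h(1) va h(2-4)] by (auto simp: side_triangles_def)
  have reg: "\<exists>a b c. cyc a b c \<and> {a, b} \<in> v \<and> {b, c} \<in> v \<and> {c, a} \<in> v \<and> C = open_ideal_triangle {a, b, c}"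
    if C: "C \<in> complementary_regions v" for C
  proof -
    from C have "C \<noteq> {}" "C \<subseteq> hyperbolic_disc - \<Union> (geodesic ` v)"
      unfolding complementary_regions_def by (auto dest: in_components_nonempty in_components_subset)
    then obtain z where z: "z \<in> C" "z \<in> hyperbolic_disc" "z \<notin> \<Union> (geodesic ` v)" by blast
    obtain a b c where h: "cyc a b c" "{a, b} \<in> v" "{b, c} \<in> v" "{c, a} \<in> v" "z \<in> open_ideal_triangle {a, b, c}"
      using triangle_cover[OF assms z(2,3)] .
    then show ?thesis
      using comp(1)[OF h(1-4)] C z(1) components_nonoverlap unfolding complementary_regions_def by blast
  qed
  show tr: "triangulation v"
    unfolding triangulation_def
  proof (intro conjI pairwiseI subsetI)
    fix A B assume "A \<in> v" "B \<in> v" "A \<noteq> B"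
    then show "geodesic A \<inter> geodesic B = {}"
      using disjoint_geodesics va comb_not_cross[OF assms] by blast
  next
    fix C assume "C \<in> complementary_regions v"
    then show "C \<in> open_ideal_triangle ` dyadic_triangles" using reg comp(2) by blast
  qed (use va in auto)
  show "triangles v = side_triangles v"
  proof (intro equalityI subsetI)
    fix T assume "T \<in> side_triangles v"
    moreover from this obtain a b c where T: "T = {a, b, c}" "cyc a b c"
      unfolding side_triangles_def by (blast elim: dyadic_triangleE)
    ultimately show "T \<in> triangles v" unfolding triangles_def
      using comp side_trianglesD[of a b c v] by blast
  next
    fix T assume T: "T \<in> triangles v"
    then show "T \<in> side_triangles v" using triangulation_side_triangles[OF tr] by blast
  qed
qed

section \<open>Triangles at a given arc and the combinatorial form of vertices\<close>

lemma triangle_at_side: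
  assumes "comb v" "T \<in> side_triangles v" "{a, b} \<subseteq> T" "a \<noteq> b"
  obtains m where "T = {a, m, b}" "cyc a m b" "{a, m} \<in> v" "{m, b} \<in> v"
    | m where "T = {b, m, a}" "cyc b m a" "{b, m} \<in> v" "{m, a} \<in> v"
proof -
  have "T \<in> dyadic_triangles" using assms(2) by (simp add: side_triangles_def)
  then have "card T = 3" by (simp add: dyadic_triangles_def)
  then have "card (T - {a, b}) = 1" using assms(3,4) by (simp add: card_Diff_subset)
  then obtain m where "T - {a, b} = {m}" by (auto simp: card_1_singleton_iff)
  then have m: "T = {a, m, b}" "m \<noteq> a" "m \<noteq> b" using assms(3) by auto
  have s: "{a, m} \<in> v" "{m, b} \<in> v" using assms(2) m by (auto simp: side_triangles_def)
  have "cyc a m b \<or> cyc b m a" using cyc_linear[of a m b] m assms(4) by auto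
  then show ?thesis using that s m(1) by (auto simp: insert_commute)
qed

lemma finite_triangles_at_side:
  assumes "comb v" "A \<in> v"
  shows "finite {T \<in> side_triangles v. A \<subseteq> T}"
proof -
  obtain a b where A: "A = {a, b}" "a \<noteq> b" using comb_arcs[OF assms] by (rule arcE)
  obtain m where m: "cyc a m b" "{a, m} \<in> v" "{m, b} \<in> v"
    using third_vertex_exists assms unfolding A by blast
  obtain n where n: "cyc b n a" "{b, n} \<in> v" "{n, a} \<in> v"
    using third_vertex_exists[of v b a] assms unfolding A by (auto simp: insert_commute)
  have "{T \<in> side_triangles v. A \<subseteq> T} \<subseteq> {{a, m, b}, {b, n, a}}"
  proof
    fix T assume "T \<in> {T \<in> side_triangles v. A \<subseteq> T}"
    then have T: "T \<in> side_triangles v" "A \<subseteq> T" by auto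
    show "T \<in> {{a, m, b}, {b, n, a}}"
    proof (rule triangle_at_side[OF assms(1) T(1) T(2)[unfolded A(1)] A(2)])
      fix m' assume "T = {a, m', b}" "cyc a m' b" "{a, m'} \<in> v" "{m', b} \<in> v"
      then show ?thesis using third_vertex_unique[OF assms(1) m] by blast
    next
      fix m' assume "T = {b, m', a}" "cyc b m' a" "{b, m'} \<in> v" "{m', a} \<in> v"
      then show ?thesis using third_vertex_unique[OF assms(1) n] by blast
    qed
  qed
  then show ?thesis by (rule finite_subset) simp
qed

lemma side_triangles_diff_finite:
  assumes "comb v" "finite (v - w)"
  shows "finite (side_triangles v - side_triangles w)"
proof (rule finite_subset)
  show "side_triangles v - side_triangles w \<subseteq> (\<Union>A\<in>v - w. {T \<in> side_triangles v. A \<subseteq> T})"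
    unfolding side_triangles_def by blast
  show "finite (\<Union>A\<in>v - w. {T \<in> side_triangles v. A \<subseteq> T})"
    using assms finite_triangles_at_side by blast
qed

lemma arc_in_triangle:
  assumes "comb v" "A \<in> v"
  obtains T where "T \<in> side_triangles v" "A \<subseteq> T"
proof -
  obtain a b where A: "A = {a, b}" "a \<noteq> b" using comb_arcs[OF assms] by (rule arcE)
  obtain m where m: "cyc a m b" "{a, m} \<in> v" "{m, b} \<in> v"
    using third_vertex_exists assms unfolding A by blast
  then have "{a, m, b} \<in> side_triangles v"
    using assms A by (intro side_trianglesI) (auto simp: comb_def insert_commute)
  then show ?thesis using that A by blast
qed

text \<open>The midpoint of an uncrossed missing arc would lie in a region; this is a triangle with
  sides in \<open>v\<close>, and an arc crossing none of these sides avoids its interior.\<close>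

lemma triangulation_maximal:
  assumes "triangulation v" "A \<in> arcs" "\<forall>B\<in>v. \<not> cross B A"
  shows "A \<in> v"
proof (rule ccontr)
  assume "A \<notin> v"
  let ?S = "hyperbolic_disc - \<Union> (geodesic ` v)"
  have va: "v \<subseteq> arcs" and reg: "components ?S \<subseteq> open_ideal_triangle ` dyadic_triangles"
    using assms(1) by (auto simp: triangulation_def complementary_regions_def)
  obtain a b where ab: "A = {a, b}" "a \<noteq> b" using assms(2) by (rule arcE)
  define p where "p = (1 - 1 / 2) *\<^sub>R bp a + (1 / 2) *\<^sub>R bp b"
  have p: "p \<in> geodesic A"
    unfolding ab(1) p_def geodesic_chord[OF ab(2)] by (intro exI[of _ "1 / 2"]) simp
  have "p \<notin> \<Union> (geodesic ` v)"
    using disjoint_geodesics[OF _ assms(2)] assms(3) va p \<open>A \<notin> v\<close> by blast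
  moreover have "p \<in> hyperbolic_disc" using p by (simp add: geodesic_def)
  ultimately have "p \<in> \<Union> (components ?S)" using Union_components[of ?S] by blast
  then obtain C where C: "C \<in> components ?S" "p \<in> C" by blast
  then obtain T where T: "T \<in> dyadic_triangles" "C = open_ideal_triangle T" using reg by blast
  then have "T \<in> triangles v" using C by (simp add: triangles_def complementary_regions_def)
  then have Ts: "T \<in> side_triangles v" using triangulation_side_triangles[OF assms(1)] by blast
  obtain x y z where xyz: "T = {x, y, z}" "cyc x y z" using T(1) by (rule dyadic_triangleE)
  then have "{x, y} \<in> v" "{y, z} \<in> v" "{z, x} \<in> v" using side_trianglesD Ts by blast+
  then have "open_ideal_triangle T \<inter> geodesic A = {}"
    unfolding xyz(1) using assms(2,3) by (intro triangle_geodesic_disjoint[OF xyz(2)]) auto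
  then show False using p C(2) T(2) by blast
qed

text \<open>Finiteness passes from triangles to arcs because a missing base arc is a side of a base
  triangle that is not a triangle of \<open>v\<close>, and back because each arc lies in finitely
  many triangles.\<close>

lemma pants_vertices_eq: "pants_vertices = {v. comb v}"
proof (intro equalityI subsetI CollectI)
  fix v assume "v \<in> pants_vertices"
  then have tr: "triangulation v" and fin: "finite (triangles E - triangles v)"
    by (auto simp: pants_vertices_def)
  have va: "v \<subseteq> arcs" and dis: "pairwise (\<lambda>A B. geodesic A \<inter> geodesic B = {}) v"
    using tr by (auto simp: triangulation_def)
  have nc: "\<not> cross A B" if AB: "A \<in> v" "B \<in> v" for A B
  proof (cases "A = B")
    case True
    obtain a b where "A = {a, b}" using AB va by (blast elim: arcE)
    then show ?thesis using True cyc_distinct by (auto simp: cross_iff)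
  next
    case False
    then show ?thesis using cross_imp_geodesics_meet[of A B] pairwiseD[OF dis AB False] by blast
  qed
  have mx: "\<forall>A\<in>arcs. (\<forall>B\<in>v. \<not> cross B A) \<longrightarrow> A \<in> v"
    using triangulation_maximal[OF tr] by blast
  have "E - v \<subseteq> (\<Union>T\<in>triangles E - triangles v. Pow T)"
  proof
    fix A assume A: "A \<in> E - v"
    then obtain T where T: "T \<in> side_triangles E" "A \<subseteq> T" using arc_in_triangle[OF comb_base] by blast
    have "T \<notin> triangles v"
    proof
      assume "T \<in> triangles v"
      then have "T \<in> side_triangles v" using triangulation_side_triangles[OF tr] by blast
      moreover obtain a b where "A = {a, b}" "a \<noteq> b" using A base_subset_arcs by (blast elim: arcE)
      ultimately show False using T A by (auto simp: side_triangles_def)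
    qed
    then show "A \<in> (\<Union>T\<in>triangles E - triangles v. Pow T)"
      using T comb_triangulation(2)[OF comb_base] by blast
  qed
  moreover have "finite (\<Union>T\<in>triangles E - triangles v. Pow T)"
    using fin by (intro finite_UN_I) (auto simp: triangles_def dyadic_triangles_def intro: card_ge_0_finite)
  ultimately have "finite (E - v)" by (rule finite_subset)
  then have "finite (v - E)" using minus_base_finite va nc by blast
  then show "comb v" using va nc mx by (simp add: comb_def)
next
  fix v assume "v \<in> {v. comb v}"
  then have v: "comb v" by simp
  have "finite (v - E)" using v by (simp add: comb_def)
  then show "v \<in> pants_vertices"
    unfolding pants_vertices_def
    using comb_triangulation[OF v] comb_triangulation[OF comb_base] comb_finite[OF v]
      side_triangles_diff_finite[OF v, of E] side_triangles_diff_finite[OF comb_base, of v] by simp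
qed

subsection \<open>Flips\<close>

text \<open>A quadrilateral with vertices \<open>a, m, b, n\<close> in cyclic order and diagonal \<open>{a, b}\<close>.\<close>

definition quad :: "circle set set \<Rightarrow> circle \<Rightarrow> circle \<Rightarrow> circle \<Rightarrow> circle \<Rightarrow> bool" where
  "quad v a m b n \<longleftrightarrow> comb v \<and> {a, b} \<in> v \<and> cyc a m b \<and> cyc b n a \<and>
     {a, m} \<in> v \<and> {m, b} \<in> v \<and> {b, n} \<in> v \<and> {n, a} \<in> v"

definition dual :: "circle set set \<Rightarrow> circle set \<Rightarrow> circle set" where
  "dual v A = \<Union> {T \<in> triangles v. A \<subseteq> T} - A"

lemma flip_eq: "flip v A = insert (dual v A) (v - {A})"
  by (simp add: flip_def dual_def)

lemma quad_exists:
  assumes "comb v" "{a, b} \<in> v"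
  obtains m n where "quad v a m b n"
proof -
  obtain m where m: "cyc a m b" "{a, m} \<in> v" "{m, b} \<in> v" using third_vertex_exists[OF assms] .
  have "{b, a} \<in> v" using assms(2) by (simp add: insert_commute)
  then obtain n where n: "cyc b n a" "{b, n} \<in> v" "{n, a} \<in> v" using third_vertex_exists[OF assms(1)] by blast
  have "quad v a m b n" using m n assms by (auto simp: quad_def)
  then show ?thesis by (rule that)
qed

lemma quad_obtain:
  assumes "comb v" "A \<in> v"
  obtains a m b n where "A = {a, b}" "a \<noteq> b" "quad v a m b n"
proof -
  obtain a b where A: "A = {a, b}" "a \<noteq> b" using comb_arcs[OF assms] by (rule arcE)
  obtain m n where "quad v a m b n" using quad_exists[OF assms(1) assms(2)[unfolded A(1)]] .
  with A show ?thesis by (rule that)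
qed

lemma cyc_quad: "cyc a m b \<Longrightarrow> cyc b n a \<Longrightarrow> cyc m b n \<and> cyc n a m"
  by (auto simp: cyc_def)

lemma quad_distinct:
  assumes "quad v a m b n"
  shows "a \<noteq> m" "a \<noteq> b" "a \<noteq> n" "m \<noteq> b" "m \<noteq> n" "b \<noteq> n"
  using assms cyc_quad[of a m b n] cyc_distinct unfolding quad_def by blast+

lemma quad_triangles:
  assumes "quad v a m b n"
  shows "{T \<in> triangles v. {a, b} \<subseteq> T} = {{a, m, b}, {b, n, a}}"
proof -
  have c: "comb v" using assms by (simp add: quad_def)
  then have v: "v \<subseteq> arcs" by (simp add: comb_def)
  note q = assms[unfolded quad_def] and d = quad_distinct[OF assms]
  have "{a, m, b} \<in> side_triangles v" using q v by (intro side_trianglesI) (auto simp: insert_commute)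
  moreover have "{b, n, a} \<in> side_triangles v" using q v by (intro side_trianglesI) (auto simp: insert_commute)
  moreover have "T \<in> {{a, m, b}, {b, n, a}}" if T: "T \<in> side_triangles v" "{a, b} \<subseteq> T" for T
  proof (rule triangle_at_side[OF c T d(2)])
    fix m' assume "T = {a, m', b}" "cyc a m' b" "{a, m'} \<in> v" "{m', b} \<in> v"
    then show ?thesis using third_vertex_unique[of v a m b m'] q by blast
  next
    fix m' assume "T = {b, m', a}" "cyc b m' a" "{b, m'} \<in> v" "{m', a} \<in> v"
    then show ?thesis using third_vertex_unique[of v b n a m'] q by blast
  qed
  ultimately show ?thesis unfolding comb_triangulation(2)[OF c] by (intro equalityI subsetI) blast+
qed

lemma quad_dual: "quad v a m b n \<Longrightarrow> dual v {a, b} = {m, n}"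
  unfolding dual_def using quad_triangles[of v a m b n] quad_distinct[of v a m b n] by auto

text \<open>A crossing arc has one end on each side of the diagonal, and there it avoids the two
  sides of the quadrilateral only by ending at their common vertex.\<close>

lemma quad_cross:
  assumes "cyc a m b" "cyc b n a" "cross {a, b} A"
    and "\<not> cross {a, m} A" "\<not> cross {m, b} A" "\<not> cross {b, n} A" "\<not> cross {n, a} A"
  shows "A = {m, n}"
proof -
  obtain x y where A: "A = {x, y}"
    using assms(3) unfolding cross_def by blast
  obtain x y where A: "A = {x, y}" "cyc a x b" "cyc b y a"
    using assms(3) unfolding A by (auto simp: cross_iff insert_commute)
  have half: "x = m" if "cyc a m b" "cyc a x b" "cyc b y a" "\<not> cross {a, m} {x, y}" "\<not> cross {m, b} {x, y}"
    for a b m x y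
  proof (rule ccontr)
    assume "x \<noteq> m"
    then have "cyc a x m \<or> cyc m x b"
      using that(1,2) unfolding cyc_def pos_eq_iff[symmetric] by linarith
    moreover have "cyc m y a" "cyc b y m" using that(1,3) unfolding cyc_def by linarith+
    ultimately show False using that(4,5) by (auto simp: cross_iff)
  qed
  have "x = m" using half[of a m b x y] assms A by auto
  moreover have "y = n" using half[of b n a y x] assms A by (auto simp: insert_commute)
  ultimately show ?thesis using A by simp
qed

lemma quad_cross_dual: "quad v a m b n \<Longrightarrow> cross {a, b} {m, n}"
  by (simp add: quad_def cross_iff)

lemma quad_dual_notin: "quad v a m b n \<Longrightarrow> {m, n} \<notin> v"
  using quad_cross_dual[of v a m b n] comb_not_cross unfolding quad_def by blast

lemma quad_flip: "quad v a m b n \<Longrightarrow> flip v {a, b} = insert {m, n} (v - {{a, b}})"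
  by (simp add: flip_eq quad_dual)

text \<open>For maximality: an arc compatible with the flipped family either crosses the removed
  diagonal, and is the new one by \<open>quad_cross\<close>, or was compatible with \<open>v\<close>
  already.\<close>

lemma quad_comb_flip:
  assumes "quad v a m b n"
  shows "comb (flip v {a, b})"
proof -
  have c: "comb v" using assms by (simp add: quad_def)
  note q = assms[unfolded quad_def] and d = quad_distinct[OF assms]
  have mn: "cyc m b n" "cyc n a m" using q cyc_quad by blast+
  have arc: "{m, n} \<in> arcs"
  proof -
    have "{a, m} \<in> arcs" "{b, n} \<in> arcs" using comb_arcs[OF c] q by auto
    then show ?thesis using d by (simp add: arc_iff)
  qed
  have nc: "\<not> cross {m, n} B" if B: "B \<in> v" "B \<noteq> {a, b}" for B
  proof
    assume x: "cross {m, n} B"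
    have "\<not> cross {m, b} B \<and> \<not> cross {b, n} B \<and> \<not> cross {n, a} B \<and> \<not> cross {a, m} B"
      using comb_not_cross[OF c _ B(1)] q by blast
    then have "B = {b, a}" using quad_cross[OF mn x] by blast
    then show False using B(2) by auto
  qed
  have self: "\<not> cross {m, n} {m, n}" by (auto simp: cross_iff dest: cyc_distinct)
  show ?thesis
    unfolding comb_def quad_flip[OF assms]
  proof (intro conjI ballI impI)
    show "insert {m, n} (v - {{a, b}}) \<subseteq> arcs" using arc c by (auto simp: comb_def)
    show "finite (insert {m, n} (v - {{a, b}}) - E)"
      using c by (auto simp: comb_def insert_Diff_if intro: finite_subset[of _ "v - E"])
    show "\<not> cross A B" if "A \<in> insert {m, n} (v - {{a, b}})" "B \<in> insert {m, n} (v - {{a, b}})" for A B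
      using that nc self comb_not_cross[OF c] cross_sym by blast
    fix A assume A: "A \<in> arcs" "\<forall>B\<in>insert {m, n} (v - {{a, b}}). \<not> cross B A"
    have s: "{a, m} \<noteq> {a, b}" "{m, b} \<noteq> {a, b}" "{b, n} \<noteq> {a, b}" "{n, a} \<noteq> {a, b}"
      using d by (auto simp: doubleton_eq_iff)
    show "A \<in> insert {m, n} (v - {{a, b}})"
    proof (cases "cross {a, b} A")
      case True
      moreover have "\<not> cross {a, m} A \<and> \<not> cross {m, b} A \<and> \<not> cross {b, n} A \<and> \<not> cross {n, a} A"
        using A(2) s q by blast
      ultimately have "A = {m, n}" using q quad_cross by blast
      then show ?thesis by simp
    next
      case False
      then have "A \<in> v" using A comb_maximal[OF c A(1)] by blast
      moreover have "A \<noteq> {a, b}" using A(2) quad_cross_dual[OF assms] cross_sym by blast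
      ultimately show ?thesis by blast
    qed
  qed
qed

text \<open>The same four points read from the next vertex: the diagonals change roles, which makes
  flips reversible.\<close>

lemma quad_flip_quad:
  assumes "quad v a m b n"
  shows "quad (flip v {a, b}) m b n a"
proof -
  note q = assms[unfolded quad_def] and d = quad_distinct[OF assms]
  have s: "{a, m} \<noteq> {a, b}" "{m, b} \<noteq> {a, b}" "{b, n} \<noteq> {a, b}" "{n, a} \<noteq> {a, b}"
    using d by (auto simp: doubleton_eq_iff)
  have mn: "cyc m b n" "cyc n a m" using q cyc_quad by blast+
  show ?thesis unfolding quad_def using quad_comb_flip[OF assms] mn s q
    by (auto simp: quad_flip[OF assms])
qed

lemma flip_props:
  assumes "comb v" "A \<in> v"
  shows "comb (flip v A)" "dual v A \<notin> v" "dual v A \<in> flip v A" "cross A (dual v A)" "A \<notin> flip v A"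
    "dual (flip v A) (dual v A) = A" "flip (flip v A) (dual v A) = v"
proof -
  obtain a m b n where A: "A = {a, b}" "a \<noteq> b" and q: "quad v a m b n" using quad_obtain[OF assms] .
  note q' = quad_flip_quad[OF q]
  show "comb (flip v A)" using quad_comb_flip[OF q] A by simp
  show nin: "dual v A \<notin> v" using quad_dual_notin[OF q] quad_dual[OF q] A by simp
  show "dual v A \<in> flip v A" by (simp add: flip_eq)
  show "cross A (dual v A)" using quad_cross_dual[OF q] quad_dual[OF q] A by simp
  show "A \<notin> flip v A" using nin assms(2) by (auto simp: flip_eq)
  show d: "dual (flip v A) (dual v A) = A" using quad_dual[OF q'] quad_dual[OF q] A by (simp add: insert_commute)
  show "flip (flip v A) (dual v A) = v"
    unfolding flip_eq[of "flip v A"] d using nin assms(2) by (auto simp: flip_eq)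
qed

lemma flip_inj: "comb v \<Longrightarrow> A \<in> v \<Longrightarrow> B \<in> v \<Longrightarrow> flip v A = flip v B \<Longrightarrow> A = B"
  using flip_props(5)[of v A] by (auto simp: flip_eq)

lemma flip_neq: "comb v \<Longrightarrow> A \<in> v \<Longrightarrow> flip v A \<noteq> v"
  using flip_props(5) by blast

text \<open>Since flips are reversible, an edge can be read from either of its ends.\<close>

lemma edge_iff: "{v, w} \<in> pants_edges \<longleftrightarrow> comb v \<and> (\<exists>A\<in>v. w = flip v A)"
proof
  assume "{v, w} \<in> pants_edges"
  then obtain x y A where *: "{v, w} = {x, y}" "comb x" "A \<in> x" "y = flip x A"
    by (auto simp: pants_edges_def pants_vertices_eq)
  then consider "v = x" "w = y" | "v = y" "w = x" by (auto simp: doubleton_eq_iff)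
  then show "comb v \<and> (\<exists>A\<in>v. w = flip v A)"
    using * flip_props[of x A] by cases metis+
next
  assume "comb v \<and> (\<exists>A\<in>v. w = flip v A)"
  then show "{v, w} \<in> pants_edges"
    unfolding pants_edges_def pants_vertices_eq using flip_props(1) by blast
qed

definition adj :: "circle set set \<Rightarrow> circle set \<Rightarrow> circle set \<Rightarrow> bool" where
  "adj v A B \<longleftrightarrow> (\<exists>T\<in>triangles v. A \<subseteq> T \<and> B \<subseteq> T)"

lemma adj_sym: "adj v A B \<longleftrightarrow> adj v B A"
  by (auto simp: adj_def)

lemma quad_adj:
  assumes "quad v a m b n" "B \<in> v" "B \<noteq> {a, b}"
  shows "adj v {a, b} B \<longleftrightarrow> B \<in> {{a, m}, {m, b}, {b, n}, {n, a}}"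
proof -
  have c: "comb v" using assms by (simp add: quad_def)
  have "adj v {a, b} B \<longleftrightarrow> (\<exists>T \<in> {T \<in> triangles v. {a, b} \<subseteq> T}. B \<subseteq> T)"
    by (auto simp: adj_def)
  also have "\<dots> \<longleftrightarrow> B \<subseteq> {a, m, b} \<or> B \<subseteq> {b, n, a}"
    unfolding quad_triangles[OF assms(1)] by simp
  also have "\<dots> \<longleftrightarrow> B \<in> {{a, m}, {m, b}, {b, n}, {n, a}}"
  proof -
    obtain x y where "B = {x, y}" "x \<noteq> y" using comb_arcs[OF c assms(2)] by (rule arcE)
    then show ?thesis using quad_distinct[OF assms(1)] assms(3) by (auto simp: doubleton_eq_iff)
  qed
  finally show ?thesis .
qed

lemma adj_flip_iff:
  assumes "comb v" "A \<in> v" "B \<in> v" "A \<noteq> B"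
  shows "adj (flip v A) (dual v A) B \<longleftrightarrow> adj v A B"
proof -
  obtain a m b n where A: "A = {a, b}" "a \<noteq> b" and q: "quad v a m b n" using quad_obtain assms(1,2) .
  have "B \<in> flip v A" "B \<noteq> dual v A"
    using assms flip_props(2)[OF assms(1,2)] by (auto simp: flip_eq)
  then show ?thesis
    using quad_adj[OF q, of B] quad_adj[OF quad_flip_quad[OF q], of B] assms(3,4) quad_dual[OF q]
    unfolding A by (auto simp: insert_commute)
qed

text \<open>An arc not adjacent to \<open>B\<close> is no side of the quadrilateral around
  \<open>B\<close>, so this quadrilateral survives the flip.\<close>

lemma dual_flip:
  assumes "comb v" "A \<in> v" "B \<in> v" "A \<noteq> B" "\<not> adj v A B"
  shows "dual (flip v A) B = dual v B"
proof -
  obtain a m b n where B: "B = {a, b}" "a \<noteq> b" and q: "quad v a m b n" using quad_obtain assms(1,3) .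
  have "A \<notin> {{a, m}, {m, b}, {b, n}, {n, a}}"
    using quad_adj[OF q, of A] assms adj_sym unfolding B by blast
  then have "quad (flip v A) a m b n"
    using q flip_props(1)[OF assms(1,2)] assms(4) unfolding quad_def B flip_eq by auto
  then show ?thesis using quad_dual q B by metis
qed

lemma flip_commute:
  assumes "comb v" "A \<in> v" "B \<in> v" "A \<noteq> B" "\<not> adj v A B"
  shows "flip (flip v A) B = flip (flip v B) A"
proof -
  have 1: "dual (flip v A) B = dual v B" "dual (flip v B) A = dual v A"
    using dual_flip assms adj_sym by metis+
  have "dual v A \<noteq> B" "dual v B \<noteq> A" using flip_props(2) assms by metis+
  then show ?thesis unfolding flip_eq[of "flip v A"] flip_eq[of "flip v B"] 1
    using assms(4) by (auto simp: flip_eq)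
qed

subsection \<open>Two-cells\<close>

definition square_cell :: "circle set set \<Rightarrow> circle set \<Rightarrow> circle set \<Rightarrow> circle set set set set" where
  "square_cell v A B =
     {{v, flip v A}, {flip v A, flip (flip v A) B}, {flip (flip v A) B, flip v B}, {flip v B, v}}"

definition pent_cell :: "circle set set \<Rightarrow> circle set \<Rightarrow> circle set \<Rightarrow> circle set set set set" where
  "pent_cell v A B = {e \<in> pants_edges. e \<subseteq> pentagon_triangulations v A B}"

definition cell :: "circle set set \<Rightarrow> circle set \<Rightarrow> circle set \<Rightarrow> circle set set set set" where
  "cell v A B = (if adj v A B then pent_cell v A B else square_cell v A B)"

lemma two_cells_eq: "two_cells = {cell v A B | v A B. comb v \<and> A \<in> v \<and> B \<in> v \<and> A \<noteq> B}"
proof -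
  have sq: "square_cycles = {square_cell v A B | v A B. comb v \<and> A \<in> v \<and> B \<in> v \<and> A \<noteq> B \<and> \<not> adj v A B}"
    unfolding square_cycles_def square_cell_def pants_vertices_eq adj_def by simp
  have pt: "pentagon_cycles = {pent_cell v A B | v A B. comb v \<and> A \<in> v \<and> B \<in> v \<and> A \<noteq> B \<and> adj v A B}"
    unfolding pentagon_cycles_def pent_cell_def pants_vertices_eq adj_def by simp
  have eq: "c \<in> two_cells \<longleftrightarrow>
      (\<exists>v A B. c = square_cell v A B \<and> comb v \<and> A \<in> v \<and> B \<in> v \<and> A \<noteq> B \<and> \<not> adj v A B) \<or>
      (\<exists>v A B. c = pent_cell v A B \<and> comb v \<and> A \<in> v \<and> B \<in> v \<and> A \<noteq> B \<and> adj v A B)" for c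
    unfolding two_cells_def sq pt Un_iff mem_Collect_eq by (rule refl)
  have "c \<in> two_cells \<longleftrightarrow> (\<exists>v A B. c = cell v A B \<and> comb v \<and> A \<in> v \<and> B \<in> v \<and> A \<noteq> B)" for c
  proof
    assume "c \<in> two_cells"
    then show "\<exists>v A B. c = cell v A B \<and> comb v \<and> A \<in> v \<and> B \<in> v \<and> A \<noteq> B"
      unfolding eq
    proof (elim disjE exE conjE)
      fix v A B assume h: "c = square_cell v A B" "comb v" "A \<in> v" "B \<in> v" "A \<noteq> B" "\<not> adj v A B"
      then have "c = cell v A B" by (simp add: cell_def)
      then show ?thesis using h by blast
    next
      fix v A B assume h: "c = pent_cell v A B" "comb v" "A \<in> v" "B \<in> v" "A \<noteq> B" "adj v A B"
      then have "c = cell v A B" by (simp add: cell_def)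
      then show ?thesis using h by blast
    qed
  next
    assume "\<exists>v A B. c = cell v A B \<and> comb v \<and> A \<in> v \<and> B \<in> v \<and> A \<noteq> B"
    then obtain v A B where h: "c = cell v A B" "comb v" "A \<in> v" "B \<in> v" "A \<noteq> B" by blast
    show "c \<in> two_cells"
    proof (cases "adj v A B")
      case True
      then have "c = pent_cell v A B" using h by (simp add: cell_def)
      then show ?thesis unfolding eq using h True by blast
    next
      case False
      then have "c = square_cell v A B" using h by (simp add: cell_def)
      then show ?thesis unfolding eq using h False by blast
    qed
  qed
  then show ?thesis unfolding set_eq_iff mem_Collect_eq by (rule allI)
qed

lemma square_cell_sym:
  assumes "comb v" "A \<in> v" "B \<in> v" "A \<noteq> B" "\<not> adj v A B"
  shows "square_cell v A B = square_cell v B A"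
  using flip_commute[OF assms] by (auto simp: square_cell_def insert_commute)

lemma square_cell_rebase:
  assumes "comb v" "A \<in> v" "B \<in> v" "A \<noteq> B" "\<not> adj v A B"
  shows "square_cell v A B = square_cell (flip v A) (dual v A) B"
  unfolding square_cell_def flip_props(7)[OF assms(1,2)] by (auto simp: insert_commute)

lemma square_cell_edges:
  assumes "comb v" "A \<in> v" "B \<in> v" "A \<noteq> B" "\<not> adj v A B"
  shows "{v, w} \<in> square_cell v A B \<longleftrightarrow> w = flip v A \<or> w = flip v B"
proof -
  have B: "B \<in> flip v A" "dual v A \<in> flip v A" "B \<noteq> dual v A"
    using assms flip_props(2)[OF assms(1,2)] by (auto simp: flip_eq)
  have "flip (flip v A) B \<noteq> v"
    using flip_inj[OF flip_props(1)[OF assms(1,2)] B(1,2)] B(3) flip_props(7)[OF assms(1,2)] by metis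
  then show ?thesis using flip_neq[OF assms(1,2)] flip_neq[OF assms(1,3)]
    unfolding square_cell_def by (auto simp: doubleton_eq_iff)
qed

text \<open>A pentagon with vertices \<open>p, q, r, s, t\<close> in cyclic order, cut by the two diagonals from \<open>p\<close>.\<close>

definition pent :: "circle set set \<Rightarrow> circle \<Rightarrow> circle \<Rightarrow> circle \<Rightarrow> circle \<Rightarrow> circle \<Rightarrow> bool" where
  "pent v p q r s t \<longleftrightarrow> comb v \<and> cyc p q r \<and> cyc p r s \<and> cyc p s t \<and>
     {p, q} \<in> v \<and> {q, r} \<in> v \<and> {r, s} \<in> v \<and> {s, t} \<in> v \<and> {t, p} \<in> v \<and> {p, r} \<in> v \<and> {p, s} \<in> v"

lemma pent_quads:
  assumes "pent v p q r s t"
  shows "quad v p q r s" "quad v p r s t"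
  using assms cyc_rotate unfolding pent_def quad_def by (auto simp: insert_commute)

lemma pent_distinct:
  assumes "pent v p q r s t"
  shows "distinct [p, q, r, s, t]"
  using assms unfolding pent_def cyc_def by auto

text \<open>Two sides of a triangle share a vertex, which becomes \<open>p\<close>; the triangles
  across them supply \<open>q\<close> and \<open>t\<close>. Orientation decides which of the two
  arcs is \<open>{p, r}\<close>.\<close>

lemma pent_exists:
  assumes "comb v" "A \<in> v" "B \<in> v" "A \<noteq> B" "adj v A B"
  obtains p q r s t where "pent v p q r s t" "A = {p, r} \<and> B = {p, s} \<or> A = {p, s} \<and> B = {p, r}"
proof -
  obtain T where T: "T \<in> side_triangles v" "A \<subseteq> T" "B \<subseteq> T"
    using assms(5) comb_triangulation(2)[OF assms(1)] by (auto simp: adj_def)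
  then obtain x y z where xyz: "T = {x, y, z}" "cyc x y z"
    unfolding side_triangles_def by (blast elim: dyadic_triangleE)
  have s: "{x, y} \<in> v" "{y, z} \<in> v" "{z, x} \<in> v" using side_trianglesD T(1) xyz by blast+
  have tri: "C \<in> {{x, y}, {y, z}, {z, x}}" if C: "C \<in> v" "C \<subseteq> T" for C
  proof -
    obtain a b where "C = {a, b}" "a \<noteq> b" using comb_arcs[OF assms(1) C(1)] by (rule arcE)
    then show ?thesis using C(2) xyz by (auto simp: insert_commute)
  qed
  have ex: "\<exists>q t. pent v p q r s t" if c: "cyc p r s" "{p, r} \<in> v" "{r, s} \<in> v" "{s, p} \<in> v" for p r s
  proof -
    obtain q where q: "cyc p q r" "{p, q} \<in> v" "{q, r} \<in> v" by (rule third_vertex_exists[OF assms(1) c(2)])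
    obtain t where t: "cyc s t p" "{s, t} \<in> v" "{t, p} \<in> v" by (rule third_vertex_exists[OF assms(1) c(4)])
    have "pent v p q r s t" unfolding pent_def using q t c assms(1) cyc_rotate by (auto simp: insert_commute)
    then show ?thesis by blast
  qed
  have rot: "cyc y z x" "cyc z x y" using xyz(2) cyc_rotate by blast+
  obtain q1 t1 where 1: "pent v x q1 y z t1" using ex[OF xyz(2) s] by blast
  obtain q2 t2 where 2: "pent v y q2 z x t2" using ex[OF rot(1) s(2,3,1)] by blast
  obtain q3 t3 where 3: "pent v z q3 x y t3" using ex[OF rot(2) s(3,1,2)] by blast
  have "A \<in> {{x, y}, {y, z}, {z, x}}" "B \<in> {{x, y}, {y, z}, {z, x}}" using tri assms(2,3) T by blast+
  then consider "A = {x, y} \<and> B = {x, z} \<or> A = {x, z} \<and> B = {x, y}"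
    | "A = {y, z} \<and> B = {y, x} \<or> A = {y, x} \<and> B = {y, z}"
    | "A = {z, x} \<and> B = {z, y} \<or> A = {z, y} \<and> B = {z, x}"
    using assms(4) by (auto simp: insert_commute)
  then show ?thesis
  proof cases
    case 1
    then show ?thesis using that \<open>pent v x q1 y z t1\<close> by metis
  next
    case 2
    then show ?thesis using that \<open>pent v y q2 z x t2\<close> by metis
  next
    case 3
    then show ?thesis using that \<open>pent v z q3 x y t3\<close> by metis
  qed
qed

lemma pentagon_sym: "pentagon v A B = pentagon v B A"
  by (auto simp: pentagon_def)

lemma pentagon_triangulations_sym: "pentagon_triangulations v A B = pentagon_triangulations v B A"
  by (simp add: pentagon_triangulations_def pentagon_sym[of v A B] insert_commute)

lemma pent_pentagon:
  assumes "pent v p q r s t"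
  shows "pentagon v {p, r} {p, s} = {p, q, r, s, t}"
proof -
  have "pentagon v {p, r} {p, s} =
      \<Union> ({T \<in> triangles v. {p, r} \<subseteq> T} \<union> {T \<in> triangles v. {p, s} \<subseteq> T})"
    unfolding pentagon_def by (intro arg_cong[where f = Union]) auto
  also have "\<dots> = {p, q, r, s, t}"
    unfolding quad_triangles[OF pent_quads(1)[OF assms]] quad_triangles[OF pent_quads(2)[OF assms]] by auto
  finally show ?thesis .
qed

text \<open>After either flip both diagonals again issue from one vertex, \<open>s\<close> or
  \<open>r\<close>, so the shape recurs with rotated labels.\<close>

lemma pent_flip:
  assumes "pent v p q r s t"
  shows "flip v {p, r} = insert {q, s} (v - {{p, r}})" "pent (flip v {p, r}) s t p q r"
    "flip v {p, s} = insert {r, t} (v - {{p, s}})" "pent (flip v {p, s}) r s t p q"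
proof -
  note q = pent_quads[OF assms]
  show f: "flip v {p, r} = insert {q, s} (v - {{p, r}})" "flip v {p, s} = insert {r, t} (v - {{p, s}})"
    using quad_flip[OF q(1)] quad_flip[OF q(2)] .
  have d: "distinct [p, q, r, s, t]" by (rule pent_distinct[OF assms])
  have c: "cyc s t p" "cyc s p q" "cyc s q r" "cyc r s t" "cyc r t p" "cyc r p q"
    using assms unfolding pent_def cyc_def by linarith+
  have "comb (flip v {p, r})" "comb (flip v {p, s})" using quad_comb_flip q by blast+
  then show "pent (flip v {p, r}) s t p q r" "pent (flip v {p, s}) r s t p q"
    using assms c d unfolding pent_def f by (auto simp: insert_commute doubleton_eq_iff)
qed

text \<open>A flip inside the pentagon changes neither its vertex set nor the arcs other than the
  two diagonals, and these data determine the family.\<close>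

lemma pent_triangulations_flip:
  assumes "pent v p q r s t"
  shows "flip v {p, r} - {{s, p}, {s, q}} = v - {{p, r}, {p, s}}"
    and "pentagon_triangulations (flip v {p, r}) {s, p} {s, q} = pentagon_triangulations v {p, r} {p, s}"
    "pentagon_triangulations (flip v {p, s}) {r, t} {r, p} = pentagon_triangulations v {p, r} {p, s}"
proof -
  note f = pent_flip[OF assms]
  have d: "distinct [p, q, r, s, t]" by (rule pent_distinct[OF assms])
  have "{s, q} \<notin> v" "{r, t} \<notin> v"
    using quad_dual_notin[OF pent_quads(1)[OF assms]] quad_dual_notin[OF pent_quads(2)[OF assms]]
    by (auto simp: insert_commute)
  then show "flip v {p, r} - {{s, p}, {s, q}} = v - {{p, r}, {p, s}}"
    unfolding f by (auto simp: insert_commute)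
  moreover have
    "flip v {p, s} - {{r, t}, {r, p}} = v - {{p, r}, {p, s}}"
    using \<open>{r, t} \<notin> v\<close> unfolding f by (auto simp: insert_commute)
  moreover have "pentagon (flip v {p, r}) {s, p} {s, q} = pentagon v {p, r} {p, s}"
    "pentagon (flip v {p, s}) {r, t} {r, p} = pentagon v {p, r} {p, s}"
    unfolding pent_pentagon[OF f(2)] pent_pentagon[OF f(4)] pent_pentagon[OF assms] by auto
  ultimately show "pentagon_triangulations (flip v {p, r}) {s, p} {s, q} = pentagon_triangulations v {p, r} {p, s}"
    "pentagon_triangulations (flip v {p, s}) {r, t} {r, p} = pentagon_triangulations v {p, r} {p, s}"
    unfolding pentagon_triangulations_def by simp_all
qed

lemma pent_cell_sym: "pent_cell v A B = pent_cell v B A"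
  by (simp add: pent_cell_def pentagon_triangulations_sym)

lemma pent_cell_rebase:
  assumes "comb v" "A \<in> v" "B \<in> v" "A \<noteq> B" "adj v A B"
  shows "pent_cell v A B = pent_cell (flip v A) (dual v A) B"
proof -
  obtain p q r s t where p: "pent v p q r s t" "A = {p, r} \<and> B = {p, s} \<or> A = {p, s} \<and> B = {p, r}"
    using pent_exists[OF assms] .
  have dual: "dual v {p, r} = {s, q}" "dual v {p, s} = {r, t}"
    using quad_dual[OF pent_quads(1)[OF p(1)]] quad_dual[OF pent_quads(2)[OF p(1)]] by (auto simp: insert_commute)
  from p(2) show ?thesis
  proof
    assume h: "A = {p, r} \<and> B = {p, s}"
    then have AB: "A = {p, r}" "B = {s, p}" by auto
    show ?thesis unfolding pent_cell_def pentagon_triangulations_sym[of "flip v A" _ B]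
      unfolding AB dual pent_triangulations_flip(2)[OF p(1)] by (simp add: insert_commute)
  next
    assume h: "A = {p, s} \<and> B = {p, r}"
    then have AB: "A = {p, s}" "B = {r, p}" by auto
    show ?thesis unfolding pent_cell_def pentagon_triangulations_sym[of v A B]
      unfolding AB dual pent_triangulations_flip(3)[OF p(1)] by (simp add: insert_commute)
  qed
qed

lemma dual_subset_pentagon: "dual v A \<subseteq> pentagon v A B"
  by (auto simp: dual_def pentagon_def)

lemma arc_subset_pentagon:
  assumes "comb v" "A \<in> v"
  shows "A \<subseteq> pentagon v A B"
proof -
  obtain T where "T \<in> side_triangles v" "A \<subseteq> T" by (rule arc_in_triangle[OF assms])
  then show ?thesis unfolding pentagon_def comb_triangulation(2)[OF assms(1)] by blast
qed

lemma self_in_pentagon_triangulations: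
  assumes "comb v" "A \<in> v" "B \<in> v"
  shows "v \<in> pentagon_triangulations v A B"
proof -
  have "A \<in> arcs" "B \<in> arcs" using comb_arcs assms by blast+
  then have "{A, B} \<subseteq> {C. C \<subseteq> pentagon v A B \<and> card C = 2}"
    using arc_subset_pentagon[OF assms(1,2), of B] arc_subset_pentagon[OF assms(1,3), of A] pentagon_sym[of v A B]
    by (auto simp: arcs_def)
  moreover have "v = v - {A, B} \<union> {A, B}" using assms by auto
  ultimately show ?thesis unfolding pentagon_triangulations_def pants_vertices_eq using assms(1) by blast
qed

lemma flip_in_pentagon_triangulations:
  assumes "comb v" "A \<in> v" "B \<in> v" "A \<noteq> B"
  shows "flip v A \<in> pentagon_triangulations v A B"
proof -
  have "dual v A \<in> arcs" using comb_arcs[OF flip_props(1,3)[OF assms(1,2)]] .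
  moreover have "B \<in> arcs" using comb_arcs assms by blast
  ultimately have "{dual v A, B} \<subseteq> {C. C \<subseteq> pentagon v A B \<and> card C = 2}"
    using dual_subset_pentagon[of v A B] arc_subset_pentagon[OF assms(1,3), of A] pentagon_sym[of v A B]
    by (auto simp: arcs_def)
  moreover have "flip v A = v - {A, B} \<union> {dual v A, B}" using assms by (auto simp: flip_eq)
  ultimately show ?thesis unfolding pentagon_triangulations_def pants_vertices_eq
    using flip_props(1)[OF assms(1,2)] by blast
qed

lemma pent_cell_edges:
  assumes "comb v" "A \<in> v" "B \<in> v" "A \<noteq> B"
  shows "{v, w} \<in> pent_cell v A B \<longleftrightarrow> w = flip v A \<or> w = flip v B"
proof
  assume "{v, w} \<in> pent_cell v A B"
  then have e: "{v, w} \<in> pants_edges" "w \<in> pentagon_triangulations v A B" by (auto simp: pent_cell_def)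
  then obtain C where C: "C \<in> v" "w = flip v C" by (auto simp: edge_iff)
  moreover have "v - {A, B} \<subseteq> w" using e(2) by (auto simp: pentagon_triangulations_def)
  ultimately have "C \<in> {A, B}" using flip_props(5)[OF assms(1) C(1)] by blast
  then show "w = flip v A \<or> w = flip v B" using C by auto
next
  have "flip v B \<in> pentagon_triangulations v A B"
    using flip_in_pentagon_triangulations[OF assms(1,3,2)] assms(4) pentagon_triangulations_sym by metis
  moreover assume "w = flip v A \<or> w = flip v B"
  ultimately show "{v, w} \<in> pent_cell v A B"
    unfolding pent_cell_def
    using flip_in_pentagon_triangulations[OF assms] self_in_pentagon_triangulations[OF assms(1-3)] assms
    by (auto simp: edge_iff)
qed

text \<open>If \<open>{p, s}\<close> is not crossed, the claim is \<open>quad_cross\<close> in the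
  quadrilateral \<open>p, q, r, s\<close>. Otherwise the arc passes both diagonals and has to end at
  \<open>q\<close> and \<open>t\<close> to avoid the outer sides.\<close>

lemma cyc5_cross:
  assumes "cyc p q r" "cyc p r s" "cyc p s t" "cross {p, r} B"
    and "\<not> cross {p, q} B" "\<not> cross {q, r} B" "\<not> cross {r, s} B" "\<not> cross {s, t} B" "\<not> cross {t, p} B"
  shows "B = {q, s} \<or> B = {q, t}"
proof (cases "cross {p, s} B")
  case False
  have "cyc r s p" using assms cyc_rotate by blast
  moreover have "\<not> cross {s, p} B" using False by (simp add: insert_commute)
  ultimately show ?thesis using quad_cross[of p q r s B] assms by blast
next
  case True
  have "cyc s t p" using assms cyc_rotate by blast
  obtain x y where B: "B = {x, y}" "cyc p x r" "cyc r y p"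
    using assms(4) unfolding cross_def by (auto simp: cross_iff doubleton_eq_iff)
  have "cyc p x s" using B(2) assms(2) unfolding cyc_def by linarith
  have x: "x = q"
  proof (rule ccontr)
    assume "x \<noteq> q"
    then have "cyc p x q \<or> cyc q x r"
      using B(2) assms(1) unfolding cyc_def pos_eq_iff[symmetric] by linarith
    moreover have "cyc q y p" "cyc r y q" using assms(1) B(3) unfolding cyc_def by linarith+
    ultimately show False using assms(5,6) B(1) by (auto simp: cross_iff)
  qed
  have "cyc s y p"
  proof (rule ccontr)
    assume n: "\<not> cyc s y p"
    have "y \<noteq> p" using B(3) cyc_distinct by blast
    moreover have "cyc p y s \<or> y = s" using n \<open>y \<noteq> p\<close> cyc_linear[of p y s] assms(2) cyc_distinct cyc_rotate by metis
    ultimately show False using True \<open>cyc p x s\<close> unfolding B(1) cross_iff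
      by (meson cyc_asym cyc_distinct cyc_rotate)
  qed
  moreover have "\<not> cyc s y t \<and> \<not> cyc t y p"
  proof -
    have "cyc t q s" "cyc p q t" using assms(1-3) unfolding cyc_def by linarith+
    then show ?thesis using assms(8,9) x unfolding B(1) cross_iff by blast
  qed
  ultimately have "y = t" using assms(3) unfolding cyc_def pos_eq_iff[symmetric] by linarith
  then show ?thesis using x B by simp
qed

text \<open>\<open>{q, s}\<close> and \<open>{q, t}\<close> are the diagonals crossing
  \<open>{p, r}\<close>: if both are absent, maximality adds \<open>{p, r}\<close>, and non-crossing
  forbids having it together with one of them.\<close>

lemma pent_diagonal_cases:
  assumes "comb w" "cyc p q r" "cyc p r s" "cyc p s t"
    and "{p, q} \<in> w" "{q, r} \<in> w" "{r, s} \<in> w" "{s, t} \<in> w" "{t, p} \<in> w"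
  shows "{p, r} \<in> w \<or> {q, s} \<in> w \<or> {q, t} \<in> w" and "\<not> ({p, r} \<in> w \<and> ({q, s} \<in> w \<or> {q, t} \<in> w))"
proof -
  have "{p, q} \<in> arcs" "{q, r} \<in> arcs" using comb_arcs assms by blast+
  then have arc: "{p, r} \<in> arcs" using cyc_distinct[OF assms(2)] by (simp add: arc_iff)
  show "{p, r} \<in> w \<or> {q, s} \<in> w \<or> {q, t} \<in> w"
  proof (rule ccontr)
    assume n: "\<not> ({p, r} \<in> w \<or> {q, s} \<in> w \<or> {q, t} \<in> w)"
    have "\<not> cross B {p, r}" if B: "B \<in> w" for B
    proof
      assume "cross B {p, r}"
      then have "B = {q, s} \<or> B = {q, t}"
        using cyc5_cross[OF assms(2-4) cross_sym] comb_not_cross[OF assms(1) _ B] assms(5-) by blast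
      then show False using n B by blast
    qed
    then show False using comb_maximal[OF assms(1) arc] n by blast
  qed
  have "cyc p q r" "cyc r s p" "cyc r t p" using assms(2-4) unfolding cyc_def by linarith+
  then have "cross {p, r} {q, s}" "cross {p, r} {q, t}" by (auto simp: cross_iff)
  then show "\<not> ({p, r} \<in> w \<and> ({q, s} \<in> w \<or> {q, t} \<in> w))" using comb_not_cross[OF assms(1)] by blast
qed

text \<open>Four successive flips from \<open>v\<close> produce the five triangulations of the
  pentagon, with apex \<open>p\<close>, \<open>s\<close>, \<open>q\<close>, \<open>t\<close>,
  \<open>r\<close> in turn. Applying \<open>pent_diagonal_cases\<close> at every vertex shows that
  \<open>w\<close> contains both diagonals of one of them and hence equals it.\<close>

lemma pent_triangulation_rebase:
  assumes "pent v p q r s t" "w \<in> pentagon_triangulations v {p, r} {p, s}"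
  shows "\<exists>p' q' r' s' t'. pent w p' q' r' s' t' \<and>
     pentagon_triangulations w {p', r'} {p', s'} = pentagon_triangulations v {p, r} {p, s}"
proof -
  let ?S = "v - {{p, r}, {p, s}}" and ?P = "pentagon_triangulations v {p, r} {p, s}"
  have w: "comb w" "?S \<subseteq> w" using assms(2) by (auto simp: pentagon_triangulations_def pants_vertices_eq)
  define v1 v2 v3 v4 where "v1 = flip v {p, r}" "v2 = flip v1 {s, p}" "v3 = flip v2 {q, s}" "v4 = flip v3 {t, q}"
  note v = v1_v2_v3_v4_def
  have p1: "pent v1 s t p q r" using pent_flip(2)[OF assms(1)] by (simp add: v)
  then have p2: "pent v2 q r s t p" using pent_flip(2)[OF p1] by (simp add: v)
  then have p3: "pent v3 t p q r s" using pent_flip(2)[OF p2] by (simp add: v)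
  then have p4: "pent v4 r s t p q" using pent_flip(2)[OF p3] by (simp add: v)
  have m1: "v1 - {{s, p}, {s, q}} = ?S" and t1: "pentagon_triangulations v1 {s, p} {s, q} = ?P"
    using pent_triangulations_flip(1,2)[OF assms(1)] by (simp_all add: v)
  have m2: "v2 - {{q, s}, {q, t}} = ?S" and t2: "pentagon_triangulations v2 {q, s} {q, t} = ?P"
    using pent_triangulations_flip(1,2)[OF p1] m1 t1 by (simp_all add: v)
  have m3: "v3 - {{t, q}, {t, r}} = ?S" and t3: "pentagon_triangulations v3 {t, q} {t, r} = ?P"
    using pent_triangulations_flip(1,2)[OF p2] m2 t2 by (simp_all add: v)
  have m4: "v4 - {{r, t}, {r, p}} = ?S" and t4: "pentagon_triangulations v4 {r, t} {r, p} = ?P"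
    using pent_triangulations_flip(1,2)[OF p3] m3 t3 by (simp_all add: v)
  have d: "distinct [p, q, r, s, t]" by (rule pent_distinct[OF assms(1)])
  have sides: "{p, q} \<in> w" "{q, r} \<in> w" "{r, s} \<in> w" "{s, t} \<in> w" "{t, p} \<in> w"
  proof -
    have inw: "X \<in> v \<Longrightarrow> X \<noteq> {p, r} \<Longrightarrow> X \<noteq> {p, s} \<Longrightarrow> X \<in> w" for X using w(2) by blast
    have "{p, q} \<in> v \<and> {q, r} \<in> v \<and> {r, s} \<in> v \<and> {s, t} \<in> v \<and> {t, p} \<in> v"
      using assms(1) by (simp add: pent_def)
    moreover have "{p, q} \<noteq> {p, r} \<and> {q, r} \<noteq> {p, r} \<and> {r, s} \<noteq> {p, r} \<and> {s, t} \<noteq> {p, r} \<and> {t, p} \<noteq> {p, r}"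
      "{p, q} \<noteq> {p, s} \<and> {q, r} \<noteq> {p, s} \<and> {r, s} \<noteq> {p, s} \<and> {s, t} \<noteq> {p, s} \<and> {t, p} \<noteq> {p, s}"
      using d by (auto simp: doubleton_eq_iff)
    ultimately show "{p, q} \<in> w" "{q, r} \<in> w" "{r, s} \<in> w" "{s, t} \<in> w" "{t, p} \<in> w"
      by (simp_all add: inw)
  qed
  have c: "cyc p q r" "cyc p r s" "cyc p s t" using assms(1) by (auto simp: pent_def)
  have rot: "cyc q r s \<and> cyc q s t \<and> cyc q t p" "cyc r s t \<and> cyc r t p \<and> cyc r p q"
    "cyc s t p \<and> cyc s p q \<and> cyc s q r" "cyc t p q \<and> cyc t q r \<and> cyc t r s"
    using c unfolding cyc_def by linarith+
  \<comment> \<open>The digits number the vertices \<open>p\<close>, \<open>q\<close>,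
    \<open>r\<close>, \<open>s\<close>, \<open>t\<close> from 1 to 5.\<close>
  define d13 d14 d24 d25 d35 where "d13 \<longleftrightarrow> {p, r} \<in> w" "d14 \<longleftrightarrow> {p, s} \<in> w" "d24 \<longleftrightarrow> {q, s} \<in> w"
    "d25 \<longleftrightarrow> {q, t} \<in> w" "d35 \<longleftrightarrow> {r, t} \<in> w"
  note dd = d13_d14_d24_d25_d35_def
  have "d13 \<or> d24 \<or> d25" "\<not> (d13 \<and> (d24 \<or> d25))"
    using pent_diagonal_cases[OF w(1) c sides] by (simp_all add: dd)
  moreover have "d24 \<or> d35 \<or> d13" "\<not> (d24 \<and> (d35 \<or> d13))"
    using pent_diagonal_cases[of w q r s t p] w(1) rot(1) sides by (simp_all add: dd insert_commute)
  moreover have "d35 \<or> d14 \<or> d24" "\<not> (d35 \<and> (d14 \<or> d24))"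
    using pent_diagonal_cases[of w r s t p q] w(1) rot(2) sides by (simp_all add: dd insert_commute)
  moreover have "d14 \<or> d25 \<or> d35" "\<not> (d14 \<and> (d25 \<or> d35))"
    using pent_diagonal_cases[of w s t p q r] w(1) rot(3) sides by (simp_all add: dd insert_commute)
  moreover have "d25 \<or> d13 \<or> d14" "\<not> (d25 \<and> (d13 \<or> d14))"
    using pent_diagonal_cases[of w t p q r s] w(1) rot(4) sides by (simp_all add: dd insert_commute)
  ultimately have cases: "d13 \<and> d14 \<or> d14 \<and> d24 \<or> d24 \<and> d25 \<or> d25 \<and> d35 \<or> d35 \<and> d13" by blast
  have sub: "X - D = S \<Longrightarrow> S \<subseteq> w \<Longrightarrow> D \<subseteq> w \<Longrightarrow> X \<subseteq> w" for X D S :: "circle set set" by blast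
  from cases consider "d13" "d14" | "d14" "d24" | "d24" "d25" | "d25" "d35" | "d35" "d13" by blast
  then show ?thesis
  proof cases
    case 1
    then have "v \<subseteq> w" using sub[OF refl w(2)] by (simp add: dd)
    then have "v = w" using comb_eqI w(1) assms(1) by (auto simp: pent_def)
    then show ?thesis using assms(1) by blast
  next
    case 2
    then have "v1 \<subseteq> w" using sub[OF m1 w(2)] by (simp add: dd insert_commute)
    then have "v1 = w" using comb_eqI[of v1 w] w(1) p1 by (auto simp: pent_def)
    then show ?thesis using p1 t1 by blast
  next
    case 3
    then have "v2 \<subseteq> w" using sub[OF m2 w(2)] by (simp add: dd insert_commute)
    then have "v2 = w" using comb_eqI[of v2 w] w(1) p2 by (auto simp: pent_def)
    then show ?thesis using p2 t2 by blast
  next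
    case 4
    then have "v3 \<subseteq> w" using sub[OF m3 w(2)] by (simp add: dd insert_commute)
    then have "v3 = w" using comb_eqI[of v3 w] w(1) p3 by (auto simp: pent_def)
    then show ?thesis using p3 t3 by blast
  next
    case 5
    then have "v4 \<subseteq> w" using sub[OF m4 w(2)] by (simp add: dd insert_commute)
    then have "v4 = w" using comb_eqI[of v4 w] w(1) p4 by (auto simp: pent_def)
    then show ?thesis using p4 t4 by blast
  qed
qed

definition corner :: "circle set set \<Rightarrow> circle set \<Rightarrow> circle set \<Rightarrow> bool" where
  "corner v A B \<longleftrightarrow> comb v \<and> A \<in> v \<and> B \<in> v \<and> A \<noteq> B"

lemma corner_sym: "corner v A B \<Longrightarrow> corner v B A"
  by (auto simp: corner_def)

lemma corner_flip: "corner v A B \<Longrightarrow> corner (flip v A) (dual v A) B"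
  using flip_props(1-3)[of v A] by (auto simp: corner_def flip_eq)

lemma cell_sym: "corner v A B \<Longrightarrow> cell v A B = cell v B A"
  unfolding corner_def cell_def using square_cell_sym pent_cell_sym adj_sym by metis

text \<open>The same 2-cell seen from the next vertex of its boundary, where flipping back is the
  new first flip. Iterated, it moves the base vertex around the cell.\<close>

lemma cell_rebase: "corner v A B \<Longrightarrow> cell v A B = cell (flip v A) (dual v A) B"
  unfolding corner_def cell_def
  using adj_flip_iff[of v A B] square_cell_rebase[of v A B] pent_cell_rebase[of v A B] by simp

lemma cell_edges: "corner v A B \<Longrightarrow> {v, w} \<in> cell v A B \<longleftrightarrow> w = flip v A \<or> w = flip v B"
  unfolding corner_def cell_def
  using square_cell_edges[of v A B w] pent_cell_edges[of v A B w] by simp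

lemma cell_edges_flip:
  assumes "corner v A B"
  shows "{flip v A, w} \<in> cell v A B \<longleftrightarrow> w = v \<or> w = flip (flip v A) B"
proof -
  have "flip (flip v A) (dual v A) = v" using assms flip_props(7) by (simp add: corner_def)
  then show ?thesis using cell_edges[OF corner_flip[OF assms]] cell_rebase[OF assms] by simp
qed

lemma cell_two_cell: "corner v A B \<Longrightarrow> cell v A B \<in> two_cells"
  unfolding two_cells_eq corner_def by blast

text \<open>Any boundary vertex can serve as base vertex: for a pentagon by
  \<open>pent_triangulation_rebase\<close>, for a square by walking around it with
  \<open>cell_rebase\<close>.\<close>

lemma two_cell_corner:
  assumes "c \<in> two_cells" "{v, w} \<in> c"
  obtains A B where "corner v A B" "c = cell v A B"
proof -
  obtain u A B where u: "corner u A B" "c = cell u A B"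
    using assms(1) unfolding two_cells_eq corner_def by blast
  have "\<exists>A B. corner v A B \<and> c = cell v A B"
  proof (cases "adj u A B")
    case True
    then have c: "c = pent_cell u A B" using u(2) by (simp add: cell_def)
    obtain p q r s t where p: "pent u p q r s t" "A = {p, r} \<and> B = {p, s} \<or> A = {p, s} \<and> B = {p, r}"
      using u(1) True unfolding corner_def by (metis pent_exists)
    then have c': "c = pent_cell u {p, r} {p, s}" using c pent_cell_sym by blast
    then have "v \<in> pentagon_triangulations u {p, r} {p, s}" using assms(2) by (simp add: pent_cell_def)
    then obtain p' q' r' s' t' where p': "pent v p' q' r' s' t'"
      "pentagon_triangulations v {p', r'} {p', s'} = pentagon_triangulations u {p, r} {p, s}"
      using pent_triangulation_rebase[OF p(1)] by blast
    have d: "distinct [p', q', r', s', t']" by (rule pent_distinct[OF p'(1)])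
    then have cn: "corner v {p', r'} {p', s'}" using p'(1) by (auto simp: corner_def pent_def doubleton_eq_iff)
    have "adj v {p', r'} {p', s'}"
      using quad_adj[OF pent_quads(1)[OF p'(1)], of "{p', s'}"] cn by (auto simp: corner_def insert_commute)
    then have "c = cell v {p', r'} {p', s'}" unfolding c' cell_def pent_cell_def p'(2) by simp
    then show ?thesis using cn by blast
  next
    case False
    then have "c = square_cell u A B" using u(2) by (simp add: cell_def)
    then have "v \<in> {u, flip u A, flip (flip u A) B, flip u B}"
      using assms(2) by (auto simp: square_cell_def doubleton_eq_iff)
    then consider "v = u" | "v = flip u A" | "v = flip (flip u A) B" | "v = flip u B" by blast
    then show ?thesis
    proof cases
      case 1
      then show ?thesis using u by blast
    next
      case 2
      then show ?thesis using u corner_flip cell_rebase by blast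
    next
      case 3
      have 1: "corner (flip u A) B (dual u A)" "c = cell (flip u A) B (dual u A)"
        using corner_sym[OF corner_flip[OF u(1)]] cell_rebase[OF u(1)] cell_sym[OF corner_flip[OF u(1)]] u(2) by simp_all
      show ?thesis using corner_flip[OF 1(1)] cell_rebase[OF 1(1)] 1(2) 3 by blast
    next
      case 4
      have 1: "corner u B A" "c = cell u B A" using corner_sym[OF u(1)] cell_sym[OF u(1)] u(2) by simp_all
      show ?thesis using corner_flip[OF 1(1)] cell_rebase[OF 1(1)] 1(2) 4 by blast
    qed
  qed
  then show ?thesis using that by blast
qed

text \<open>Seen from \<open>v\<close>, a 2-cell has exactly two edges at \<open>v\<close>, and
  different arcs give different flips.\<close>

lemma two_cell_unique:
  assumes "corner v A B" "c \<in> two_cells" "{v, flip v A} \<in> c" "{v, flip v B} \<in> c"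
  shows "c = cell v A B"
proof -
  obtain A' B' where c: "corner v A' B'" "c = cell v A' B'" using two_cell_corner[OF assms(2,3)] .
  have "flip v A = flip v A' \<or> flip v A = flip v B'" "flip v B = flip v A' \<or> flip v B = flip v B'"
    using assms(3,4) cell_edges[OF c(1)] unfolding c(2) by blast+
  then have "A = A' \<or> A = B'" "B = A' \<or> B = B'"
    using flip_inj assms(1) c(1) unfolding corner_def by blast+
  then have "A = A' \<and> B = B' \<or> A = B' \<and> B = A'" using assms(1) by (auto simp: corner_def)
  then show ?thesis using c cell_sym by blast
qed

text \<open>A square closes up after two flips in either order, a pentagon does not.\<close>

lemma adj_iff_flips_not_commute:
  assumes "corner v A B"
  shows "adj v A B \<longleftrightarrow> flip (flip v A) B \<noteq> flip (flip v B) A"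
proof
  assume adj: "adj v A B"
  obtain p q r s t where p: "pent v p q r s t" "A = {p, r} \<and> B = {p, s} \<or> A = {p, s} \<and> B = {p, r}"
    using assms adj unfolding corner_def by (metis pent_exists)
  have dual: "dual v {p, r} = {q, s}" "dual v {p, s} = {r, t}"
    using quad_dual[OF pent_quads(1)[OF p(1)]] quad_dual[OF pent_quads(2)[OF p(1)]] by (auto simp: insert_commute)
  have "cyc q r s \<and> cyc s t q" using p(1) unfolding pent_def cyc_def by linarith
  \<comment> \<open>The two new diagonals of the pentagon cross, so no triangulation contains both;
    this separates the two orders of flipping.\<close>
  then have x: "cross {q, s} {r, t}" by (simp add: cross_iff)
  have in1: "dual v A \<in> flip (flip v A) B" "dual v B \<in> flip (flip v B) A"
    using corner_flip[OF assms] corner_flip[OF corner_sym[OF assms]]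
    by (auto simp: corner_def flip_eq[of "flip v A" B] flip_eq[of "flip v B" A])
  have cr: "cross (dual v A) (dual v B)" using p(2) x dual cross_sym by auto
  have "comb (flip (flip v A) B)" using corner_flip[OF assms] flip_props(1) by (auto simp: corner_def)
  then show "flip (flip v A) B \<noteq> flip (flip v B) A" using in1 cr comb_not_cross by metis
next
  assume "flip (flip v A) B \<noteq> flip (flip v B) A"
  then show "adj v A B" using flip_commute assms unfolding corner_def by blast
qed

subsection \<open>Cellular maps\<close>

text \<open>The image of the 2-cell at \<open>v\<close> is the one spanned by the image flips. On
  its boundary \<open>flip v' A'\<close> has just two neighbours, and injectivity rules out
  \<open>v'\<close>.\<close>

lemma cellular_flip_flip:
  assumes "cellular h" "inj_on h (Collect comb)" "corner v A B" "corner v' A' B'"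
    and "h v = v'" "h (flip v A) = flip v' A'" "h (flip v B) = flip v' B'"
  shows "h (flip (flip v A) B) = flip (flip v' A') B'"
proof -
  let ?c = "cell v A B"
  have c: "?c \<in> two_cells" using cell_two_cell[OF assms(3)] .
  have e: "{v, flip v A} \<in> ?c" "{v, flip v B} \<in> ?c" using cell_edges[OF assms(3)] by auto
  have "(`) h ` ?c \<in> two_cells" using assms(1) c by (auto simp: cellular_def)
  moreover have "h ` {v, flip v A} \<in> (`) h ` ?c" by (rule imageI[OF e(1)])
  moreover have "h ` {v, flip v B} \<in> (`) h ` ?c" by (rule imageI[OF e(2)])
  ultimately have "(`) h ` ?c = cell v' A' B'"
    using assms(5-7) by (intro two_cell_unique[OF assms(4)]) simp_all
  moreover have "h ` {flip v A, flip (flip v A) B} \<in> (`) h ` ?c"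
    using cell_edges_flip[OF assms(3)] by blast
  ultimately have "{flip v' A', h (flip (flip v A) B)} \<in> cell v' A' B'" using assms(6) by simp
  then have "h (flip (flip v A) B) = v' \<or> h (flip (flip v A) B) = flip (flip v' A') B'"
    using cell_edges_flip[OF assms(4)] by blast
  moreover have "h (flip (flip v A) B) \<noteq> v'"
  proof
    assume eq: "h (flip (flip v A) B) = v'"
    have cf: "corner (flip v A) (dual v A) B" by (rule corner_flip[OF assms(3)])
    then have "comb (flip (flip v A) B)" "comb v" using flip_props(1) assms(3) by (auto simp: corner_def)
    then have "flip (flip v A) B = v" using inj_onD[OF assms(2)] eq assms(5) by auto
    also have "v = flip (flip v A) (dual v A)" using flip_props(7) assms(3) by (simp add: corner_def)
    finally show False using cf flip_inj unfolding corner_def by metis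
  qed
  ultimately show ?thesis by blast
qed

text \<open>Adjacency means that the two flips do not commute, and \<open>cellular_flip_flip\<close>
  transports both composites.\<close>

lemma cellular_adj:
  assumes "cellular h" "inj_on h (Collect comb)" "corner v A B" "corner v' A' B'"
    and "h v = v'" "h (flip v A) = flip v' A'" "h (flip v B) = flip v' B'" "adj v A B"
  shows "adj v' A' B'"
proof -
  have "h (flip (flip v A) B) = flip (flip v' A') B'" "h (flip (flip v B) A) = flip (flip v' B') A'"
    using cellular_flip_flip[OF assms(1,2)] assms(3-7) corner_sym by blast+
  moreover have "flip (flip v A) B \<noteq> flip (flip v B) A" using adj_iff_flips_not_commute[OF assms(3)] assms(8) by blast
  moreover have "comb (flip (flip v A) B)" "comb (flip (flip v B) A)"
    using corner_flip[OF assms(3)] corner_flip[OF corner_sym[OF assms(3)]] flip_props(1) by (auto simp: corner_def)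
  ultimately have "flip (flip v' A') B' \<noteq> flip (flip v' B') A'" using inj_onD[OF assms(2)] by (metis mem_Collect_eq)
  then show ?thesis using adj_iff_flips_not_commute[OF assms(4)] by blast
qed

subsection \<open>Maps of dyadic points acting on triangulations\<close>

abbreviation "D \<equiv> dyadic_points"

abbreviation act :: "(circle \<Rightarrow> circle) \<Rightarrow> circle set set \<Rightarrow> circle set set" where
  "act g v \<equiv> (`) g ` v"

definition preserving :: "(circle \<Rightarrow> circle) \<Rightarrow> bool" where
  "preserving g \<longleftrightarrow> (\<forall>a\<in>D. \<forall>b\<in>D. \<forall>c\<in>D. cyc a b c \<longrightarrow> cyc (g a) (g b) (g c))"

definition reversing :: "(circle \<Rightarrow> circle) \<Rightarrow> bool" where
  "reversing g \<longleftrightarrow> (\<forall>a\<in>D. \<forall>b\<in>D. \<forall>c\<in>D. cyc a b c \<longrightarrow> cyc (g c) (g b) (g a))"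

text \<open>A common frame for Thompson maps and the reflection. It looks at dyadic points only; the
  finiteness condition, stated for \<open>E\<close>, passes to every vertex in
  \<open>adm_comb\<close>.\<close>

definition adm :: "(circle \<Rightarrow> circle) \<Rightarrow> bool" where
  "adm g \<longleftrightarrow> bij_betw g D D \<and> (preserving g \<or> reversing g) \<and> finite (act g E - E)"

lemma adm_bij: "adm g \<Longrightarrow> bij_betw g D D"
  by (simp add: adm_def)

lemma adm_inj: "adm g \<Longrightarrow> inj_on g D"
  by (simp add: adm_def bij_betw_def)

lemma adm_in: "adm g \<Longrightarrow> x \<in> D \<Longrightarrow> g x \<in> D"
  using adm_bij bij_betwE by blast

lemma adm_arc: "adm g \<Longrightarrow> A \<in> arcs \<Longrightarrow> g ` A \<in> arcs"
proof -
  assume g: "adm g" and "A \<in> arcs"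
  then obtain a b where A: "A = {a, b}" "a \<noteq> b" "a \<in> D" "b \<in> D" by (blast elim: arcE)
  then have "g a \<noteq> g b" using adm_inj[OF g] by (auto dest: inj_onD)
  then show ?thesis using A adm_in[OF g] by (simp add: arc_iff)
qed

lemma adm_image_inj: "adm g \<Longrightarrow> A \<subseteq> D \<Longrightarrow> B \<subseteq> D \<Longrightarrow> g ` A = g ` B \<Longrightarrow> A = B"
  using adm_inj inj_on_image_eq_iff by blast

lemma adm_act_minus:
  "adm g \<Longrightarrow> v \<subseteq> arcs \<Longrightarrow> w \<subseteq> arcs \<Longrightarrow> act g (v - w) = act g v - act g w"
proof -
  assume g: "adm g" and v: "v \<subseteq> arcs" "w \<subseteq> arcs"
  have "inj_on ((`) g) arcs" using adm_image_inj[OF g] arc_dyadic by (meson inj_onI)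
  then show ?thesis using v inj_on_image_set_diff[of "(`) g" arcs v w] by blast
qed

lemma adm_cross:
  assumes "adm g" "A \<in> arcs" "B \<in> arcs" "cross A B"
  shows "cross (g ` A) (g ` B)"
proof -
  obtain a b c d where A: "A = {a, b}" "B = {c, d}" "cyc a c b" "cyc b d a"
    using assms(4) unfolding cross_def by blast
  have d: "a \<in> D" "b \<in> D" "c \<in> D" "d \<in> D" using assms(2,3) A arc_dyadic by auto
  have "preserving g \<or> reversing g" using assms(1) by (simp add: adm_def)
  then show ?thesis
  proof
    assume "preserving g"
    then have "cyc (g a) (g c) (g b)" "cyc (g b) (g d) (g a)" using A d by (simp_all add: preserving_def)
    then show ?thesis unfolding A by (simp add: cross_iff)
  next
    assume "reversing g"
    then have "cyc (g b) (g c) (g a)" "cyc (g a) (g d) (g b)" using A d by (simp_all add: reversing_def)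
    then show ?thesis unfolding A by (simp add: cross_iff)
  qed
qed

definition dinv :: "(circle \<Rightarrow> circle) \<Rightarrow> circle \<Rightarrow> circle" where
  "dinv g = inv_into D g"

lemma dinv:
  assumes "bij_betw g D D"
  shows "x \<in> D \<Longrightarrow> dinv g (g x) = x" "x \<in> D \<Longrightarrow> g (dinv g x) = x" "x \<in> D \<Longrightarrow> dinv g x \<in> D"
    "bij_betw (dinv g) D D"
  using assms unfolding dinv_def
  by (auto simp: bij_betw_inv_into bij_betw_inv_into_left bij_betw_inv_into_right intro: bij_betwE[OF bij_betw_inv_into, rule_format])

lemma dinv_image:
  assumes "bij_betw g D D" "A \<subseteq> D"
  shows "dinv g ` g ` A = A" "g ` dinv g ` A = A"
proof -
  have "dinv g ` g ` A = id ` A" unfolding image_image using dinv(1)[OF assms(1)] assms(2) by (intro image_cong) auto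
  then show "dinv g ` g ` A = A" by simp
  have "g ` dinv g ` A = id ` A" unfolding image_image using dinv(2)[OF assms(1)] assms(2) by (intro image_cong) auto
  then show "g ` dinv g ` A = A" by simp
qed

lemma dinv_act:
  assumes "bij_betw g D D" "v \<subseteq> arcs"
  shows "act (dinv g) (act g v) = v" "act g (act (dinv g) v) = v"
proof -
  have "act (dinv g) (act g v) = id ` v"
    unfolding image_image[of "(`) (dinv g)"]
  proof (rule image_cong[OF refl])
    fix A assume "A \<in> v"
    then show "dinv g ` g ` A = id A" using dinv_image(1)[OF assms(1) arc_dyadic] assms(2) by auto
  qed
  then show "act (dinv g) (act g v) = v" by simp
  have "act g (act (dinv g) v) = id ` v"
    unfolding image_image[of "(`) g"]
  proof (rule image_cong[OF refl])
    fix A assume "A \<in> v"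
    then show "g ` dinv g ` A = id A" using dinv_image(2)[OF assms(1) arc_dyadic] assms(2) by auto
  qed
  then show "act g (act (dinv g) v) = v" by simp
qed

lemma preserving_dinv: "bij_betw g D D \<Longrightarrow> preserving g \<Longrightarrow> preserving (dinv g)"
proof -
  assume g: "bij_betw g D D" and p: "preserving g"
  have "cyc (dinv g a) (dinv g b) (dinv g c)" if h: "a \<in> D" "b \<in> D" "c \<in> D" "cyc a b c" for a b c
  proof (rule ccontr)
    note d = dinv[OF g]
    assume "\<not> cyc (dinv g a) (dinv g b) (dinv g c)"
    moreover have "dinv g a \<noteq> dinv g b" "dinv g b \<noteq> dinv g c" "dinv g a \<noteq> dinv g c"
      using h cyc_distinct d(2) by metis+
    ultimately have "cyc (dinv g c) (dinv g b) (dinv g a)" using cyc_linear by blast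
    then have "cyc (g (dinv g c)) (g (dinv g b)) (g (dinv g a))" using p h d(3) unfolding preserving_def by blast
    then show False using h cyc_asym d(2) by metis
  qed
  then show ?thesis by (simp add: preserving_def)
qed

lemma reversing_dinv: "bij_betw g D D \<Longrightarrow> reversing g \<Longrightarrow> reversing (dinv g)"
proof -
  assume g: "bij_betw g D D" and p: "reversing g"
  have "cyc (dinv g c) (dinv g b) (dinv g a)" if h: "a \<in> D" "b \<in> D" "c \<in> D" "cyc a b c" for a b c
  proof (rule ccontr)
    note d = dinv[OF g]
    assume "\<not> cyc (dinv g c) (dinv g b) (dinv g a)"
    moreover have "dinv g a \<noteq> dinv g b" "dinv g b \<noteq> dinv g c" "dinv g a \<noteq> dinv g c"
      using h cyc_distinct d(2) by metis+
    ultimately have "cyc (dinv g a) (dinv g b) (dinv g c)" using cyc_linear by blast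
    then have "cyc (g (dinv g c)) (g (dinv g b)) (g (dinv g a))" using p h d(3) unfolding reversing_def by blast
    then show False using h cyc_asym d(2) by metis
  qed
  then show ?thesis by (simp add: reversing_def)
qed

lemma adm_cross_iff:
  assumes "adm g" "A \<in> arcs" "B \<in> arcs"
  shows "cross (g ` A) (g ` B) \<longleftrightarrow> cross A B"
proof
  assume x: "cross (g ` A) (g ` B)"
  obtain a b where A: "A = {a, b}" "a \<noteq> b" "a \<in> D" "b \<in> D" using assms(2) by (rule arcE)
  obtain c d where B: "B = {c, d}" "c \<noteq> d" "c \<in> D" "d \<in> D" using assms(3) by (rule arcE)
  have ne: "g x = g y \<Longrightarrow> x = y" if "x \<in> D" "y \<in> D" for x y using adm_inj[OF assms(1)] that by (auto dest: inj_onD)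
  have lin: "cyc (g x) (g y) (g z) \<Longrightarrow> cyc x y z \<or> cyc z y x" if "x \<in> D" "y \<in> D" "z \<in> D" for x y z
    using cyc_linear[of x y z] cyc_distinct[of "g x" "g y" "g z"] by auto
  have "preserving g \<or> reversing g" using assms(1) by (simp add: adm_def)
  then show "cross A B"
  proof
    assume "preserving g"
    then have "cyc (g x) (g y) (g z) \<Longrightarrow> cyc x y z" if "x \<in> D" "y \<in> D" "z \<in> D" for x y z
      using lin[OF that] that cyc_asym unfolding preserving_def by blast
    then show ?thesis using x A B by (auto simp: cross_iff)
  next
    assume "reversing g"
    then have "cyc (g x) (g y) (g z) \<Longrightarrow> cyc z y x" if "x \<in> D" "y \<in> D" "z \<in> D" for x y z
      using lin[OF that] that cyc_asym unfolding reversing_def by blast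
    then show ?thesis using x A B by (auto simp: cross_iff)
  qed
qed (use adm_cross assms in blast)

lemma adm_comb:
  assumes "adm g" "comb v"
  shows "comb (act g v)"
proof -
  have va: "v \<subseteq> arcs" using assms(2) by (simp add: comb_def)
  show ?thesis unfolding comb_def
  proof (intro conjI ballI impI)
    show "act g v \<subseteq> arcs" using adm_arc[OF assms(1)] va by auto
    show "\<not> cross A B" if AB: "A \<in> act g v" "B \<in> act g v" for A B
    proof -
      obtain A' B' where *: "A = g ` A'" "B = g ` B'" "A' \<in> v" "B' \<in> v" using AB by blast
      then show ?thesis using adm_cross_iff[OF assms(1)] va comb_not_cross[OF assms(2)] by blast
    qed
    fix A assume A: "A \<in> arcs" "\<forall>B\<in>act g v. \<not> cross B A"
    then obtain a b where ab: "A = {a, b}" "a \<noteq> b" "a \<in> D" "b \<in> D" by (blast elim: arcE)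
    define A' where "A' = dinv g ` A"
    note d = dinv[OF adm_bij[OF assms(1)]]
    have A': "g ` A' = A" using dinv_image(2)[OF adm_bij[OF assms(1)] arc_dyadic[OF A(1)]] by (simp add: A'_def)
    have "dinv g a \<noteq> dinv g b" using ab d(2) by metis
    then have arc: "A' \<in> arcs" using ab d(3) by (simp add: A'_def arc_iff)
    have "\<not> cross B A'" if "B \<in> v" for B
      using adm_cross[OF assms(1) _ arc] A(2) A' va that by blast
    then have "A' \<in> v" using comb_maximal[OF assms(2) arc] by blast
    then show "A \<in> act g v" using A' by blast
  next
    have "act g v - E \<subseteq> act g (v - E) \<union> (act g E - E)" by blast
    moreover have "finite (act g (v - E) \<union> (act g E - E))"
      using assms by (simp add: comb_def adm_def)
    ultimately show "finite (act g v - E)" by (rule finite_subset)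
  qed
qed

lemma adm_dinv:
  assumes "adm g"
  shows "adm (dinv g)"
proof -
  note b = adm_bij[OF assms]
  \<comment> \<open>Finiteness for the inverse concerns the opposite difference
    \<open>E - act g E\<close>, finite because \<open>act g E\<close> is again a vertex.\<close>
  have "act (dinv g) E - E = act (dinv g) (E - act g E)"
  proof -
    have sub: "act g E \<subseteq> arcs" using adm_comb[OF assms comb_base] by (simp add: comb_def)
    have "inj_on ((`) (dinv g)) arcs"
    proof (rule inj_onI)
      fix A B assume "A \<in> arcs" "B \<in> arcs" "dinv g ` A = dinv g ` B"
      then show "A = B" using dinv_image(2)[OF b arc_dyadic] by metis
    qed
    then have "act (dinv g) (E - act g E) = act (dinv g) E - act (dinv g) (act g E)"
      by (rule inj_on_image_set_diff[OF _ order_trans[OF Diff_subset base_subset_arcs] sub])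
    then show ?thesis using dinv_act(1)[OF b base_subset_arcs] by simp
  qed
  moreover have "finite (E - act g E)" using comb_finite adm_comb[OF assms comb_base] by blast
  ultimately have "finite (act (dinv g) E - E)" by simp
  then show ?thesis using assms dinv(4)[OF b] preserving_dinv[OF b] reversing_dinv[OF b]
    by (auto simp: adm_def)
qed

lemma preserving_comp:
  assumes "\<And>x. x \<in> D \<Longrightarrow> h x \<in> D"
  shows "preserving g \<Longrightarrow> preserving h \<Longrightarrow> preserving (g \<circ> h)"
    and "preserving g \<Longrightarrow> reversing h \<Longrightarrow> reversing (g \<circ> h)"
    and "reversing g \<Longrightarrow> preserving h \<Longrightarrow> reversing (g \<circ> h)"
    and "reversing g \<Longrightarrow> reversing h \<Longrightarrow> preserving (g \<circ> h)"
  using assms by (simp_all add: preserving_def reversing_def)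

lemma act_comp: "act (g \<circ> h) v = act g (act h v)"
  by (simp add: image_image image_comp)

lemma adm_comp:
  assumes "adm g" "adm h"
  shows "adm (g \<circ> h)"
proof -
  have "bij_betw (g \<circ> h) D D" using bij_betw_trans adm_bij assms by blast
  moreover have "preserving (g \<circ> h) \<or> reversing (g \<circ> h)"
    using preserving_comp[of h g] adm_in[OF assms(2)] assms unfolding adm_def by blast
  moreover have "act (g \<circ> h) E - E \<subseteq> act g (act h E - E) \<union> (act g E - E)"
    unfolding act_comp by blast
  then have "finite (act (g \<circ> h) E - E)"
    by (rule finite_subset) (use assms in \<open>auto simp: adm_def\<close>)
  ultimately show ?thesis by (simp add: adm_def)
qed

text \<open>A reversing map exchanges the two sides of the diagonal, which swaps the roles of
  \<open>m\<close> and \<open>n\<close>.\<close>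

lemma adm_quad:
  assumes "adm g" "quad v a m b n"
  shows "quad (act g v) (g a) (g m) (g b) (g n) \<or> quad (act g v) (g a) (g n) (g b) (g m)"
proof -
  have c: "comb v" using assms(2) by (simp add: quad_def)
  have "{a, b} \<in> arcs" "{a, m} \<in> arcs" "{b, n} \<in> arcs"
    using assms(2) comb_arcs[OF c] unfolding quad_def by blast+
  then have d: "a \<in> D" "b \<in> D" "m \<in> D" "n \<in> D" by (auto simp: arc_iff)
  have i: "{x, y} \<in> v \<Longrightarrow> {g x, g y} \<in> act g v" for x y by (rule image_eqI[of _ _ "{x, y}"]) auto
  have s: "{g a, g b} \<in> act g v" "{g a, g m} \<in> act g v" "{g m, g b} \<in> act g v"
    "{g b, g n} \<in> act g v" "{g n, g a} \<in> act g v"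
    using assms(2) i unfolding quad_def by blast+
  have cy: "cyc a m b" "cyc b n a" using assms(2) by (simp_all add: quad_def)
  have "preserving g \<or> reversing g" using assms(1) by (simp add: adm_def)
  then show ?thesis
  proof
    assume "preserving g"
    then have "cyc (g a) (g m) (g b)" "cyc (g b) (g n) (g a)" using cy d by (simp_all add: preserving_def)
    then show ?thesis using s adm_comb[OF assms(1) c] by (simp add: quad_def)
  next
    assume "reversing g"
    then have "cyc (g b) (g m) (g a)" "cyc (g a) (g n) (g b)" using cy d by (simp_all add: reversing_def)
    then show ?thesis using s adm_comb[OF assms(1) c] by (simp add: quad_def insert_commute)
  qed
qed

lemma adm_dual:
  assumes "adm g" "comb v" "A \<in> v"
  shows "dual (act g v) (g ` A) = g ` dual v A"
proof -
  obtain a m b n where A: "A = {a, b}" "a \<noteq> b" and q: "quad v a m b n" using quad_obtain[OF assms(2,3)] .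
  have "dual (act g v) {g a, g b} = {g m, g n}"
    using adm_quad[OF assms(1) q] quad_dual by (metis insert_commute)
  then show ?thesis using quad_dual[OF q] A by simp
qed

lemma adm_flip:
  assumes "adm g" "comb v" "A \<in> v"
  shows "act g (flip v A) = flip (act g v) (g ` A)"
proof -
  have va: "v \<subseteq> arcs" using assms(2) by (simp add: comb_def)
  then have "act g (v - {A}) = act g v - {g ` A}"
    using adm_act_minus[OF assms(1) va, of "{A}"] assms(3) by auto
  then show ?thesis using adm_dual[OF assms] by (simp add: flip_eq)
qed

lemma adm_corner:
  assumes "adm g" "corner v A B"
  shows "corner (act g v) (g ` A) (g ` B)"
proof -
  have c: "comb v" "A \<in> v" "B \<in> v" "A \<noteq> B" using assms(2) by (auto simp: corner_def)
  then have "A \<subseteq> D" "B \<subseteq> D" using comb_arcs arc_dyadic by blast+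
  then have "g ` A \<noteq> g ` B" using adm_image_inj[OF assms(1)] c(4) by blast
  then show ?thesis using c adm_comb[OF assms(1)] by (simp add: corner_def)
qed

lemma adm_act_inj: "adm g \<Longrightarrow> comb v \<Longrightarrow> comb w \<Longrightarrow> act g v = act g w \<Longrightarrow> v = w"
  using dinv_act(1)[OF adm_bij] unfolding comb_def by metis

lemma adm_flip_flip:
  assumes "adm g" "corner v A B"
  shows "act g (flip (flip v A) B) = flip (flip (act g v) (g ` A)) (g ` B)"
  using adm_flip[OF assms(1)] assms(2) corner_flip[OF assms(2)] unfolding corner_def by metis

lemma adm_adj:
  assumes "adm g" "corner v A B"
  shows "adj (act g v) (g ` A) (g ` B) \<longleftrightarrow> adj v A B"
proof -
  note c = corner_sym[OF assms(2)]
  have "comb (flip (flip v A) B)" "comb (flip (flip v B) A)"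
    using corner_flip[OF assms(2)] corner_flip[OF c] flip_props(1) by (auto simp: corner_def)
  then show ?thesis
    unfolding adj_iff_flips_not_commute[OF assms(2)] adj_iff_flips_not_commute[OF adm_corner[OF assms]]
      adm_flip_flip[OF assms, symmetric] adm_flip_flip[OF assms(1) c, symmetric]
    using adm_act_inj[OF assms(1)] by metis
qed

text \<open>Writes the pentagon through arcs and their duals, the form in which admissible maps
  transport it.\<close>

lemma pentagon_eq:
  assumes "comb v" "A \<in> v" "B \<in> v"
  shows "pentagon v A B = A \<union> dual v A \<union> B \<union> dual v B"
  using dual_subset_pentagon[of v A B] dual_subset_pentagon[of v B A] arc_subset_pentagon[OF assms(1,2), of B]
    arc_subset_pentagon[OF assms(1,3), of A] pentagon_sym[of v A B]
  by (auto simp: dual_def pentagon_def)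

lemma adm_pentagon:
  assumes "adm g" "corner v A B"
  shows "pentagon (act g v) (g ` A) (g ` B) = g ` pentagon v A B"
  using adm_corner[OF assms] adm_dual[OF assms(1)] assms(2)
  by (simp add: corner_def pentagon_eq image_Un)

lemma pentagon_dyadic:
  assumes "corner v A B"
  shows "pentagon v A B \<subseteq> D"
proof -
  have "A \<in> arcs" "B \<in> arcs" "dual v A \<in> arcs" "dual v B \<in> arcs"
    using assms comb_arcs flip_props(1,3) unfolding corner_def by blast+
  then show ?thesis using arc_dyadic assms by (simp add: pentagon_eq corner_def)
qed

lemma adm_pentagon_triangulations:
  assumes "adm g" "corner v A B" "w \<in> pentagon_triangulations v A B"
  shows "act g w \<in> pentagon_triangulations (act g v) (g ` A) (g ` B)"
proof -
  have c: "comb v" "A \<in> v" "B \<in> v" using assms(2) by (auto simp: corner_def)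
  have va: "v \<subseteq> arcs" using c by (simp add: comb_def)
  obtain X where w: "comb w" "X \<subseteq> {C. C \<subseteq> pentagon v A B \<and> card C = 2}" "w = v - {A, B} \<union> X"
    using assms(3) unfolding pentagon_triangulations_def pants_vertices_eq by blast
  have "act g (v - {A, B}) = act g v - {g ` A, g ` B}"
    using adm_act_minus[OF assms(1) va, of "{A, B}"] va c by auto
  then have "act g w = act g v - {g ` A, g ` B} \<union> act g X" unfolding w(3) image_Un by simp
  moreover have "act g X \<subseteq> {C. C \<subseteq> pentagon (act g v) (g ` A) (g ` B) \<and> card C = 2}"
  proof clarify
    fix C assume "C \<in> X"
    then have C: "C \<subseteq> pentagon v A B" "card C = 2" using w(2) by auto
    then have "inj_on g C" using adm_inj[OF assms(1)] pentagon_dyadic[OF assms(2)] by (meson inj_on_subset)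
    then show "g ` C \<subseteq> pentagon (act g v) (g ` A) (g ` B) \<and> card (g ` C) = 2"
      using C unfolding adm_pentagon[OF assms(1,2)] by (auto simp: card_image)
  qed
  ultimately show ?thesis unfolding pentagon_triangulations_def pants_vertices_eq
    using adm_comb[OF assms(1) w(1)] by blast
qed

lemma adm_edge:
  assumes "adm g" "e \<in> pants_edges"
  shows "act g ` e \<in> pants_edges"
proof -
  obtain v w where e: "e = {v, w}" using assms(2) by (auto simp: pants_edges_def)
  then obtain A where A: "comb v" "A \<in> v" "w = flip v A" using assms(2) edge_iff by blast
  have "{act g v, act g w} \<in> pants_edges"
    unfolding edge_iff A(3) adm_flip[OF assms(1) A(1,2)] using adm_comb[OF assms(1) A(1)] A(2) by blast
  then show ?thesis by (simp add: e)
qed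

lemma edge_comb: "e \<in> pants_edges \<Longrightarrow> v \<in> e \<Longrightarrow> comb v"
  by (auto simp: pants_edges_def pants_vertices_eq)

lemma comb_arcs_subset: "comb v \<Longrightarrow> v \<subseteq> arcs"
  by (simp add: comb_def)

text \<open>One inclusion holds for every admissible map; applied to \<open>dinv g\<close> it gives
  the other.\<close>

lemma adm_pent_cell:
  assumes "adm g" "corner v A B"
  shows "(`) (act g) ` pent_cell v A B = pent_cell (act g v) (g ` A) (g ` B)"
proof -
  have sub: "act g ` e \<in> pent_cell (act g v) (g ` A) (g ` B)"
    if "adm g" "corner v A B" "e \<in> pent_cell v A B" for g v A B e
    using that adm_edge adm_pentagon_triangulations unfolding pent_cell_def by blast
  note b = adm_bij[OF assms(1)]
  have d: "comb v" "A \<subseteq> D" "B \<subseteq> D" using assms(2) comb_arcs arc_dyadic unfolding corner_def by blast+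
  show ?thesis
  proof (intro equalityI subsetI)
    fix e assume "e \<in> (`) (act g) ` pent_cell v A B"
    then show "e \<in> pent_cell (act g v) (g ` A) (g ` B)" using sub[OF assms] by blast
  next
    fix e assume e: "e \<in> pent_cell (act g v) (g ` A) (g ` B)"
    then have "act (dinv g) ` e \<in> pent_cell (act (dinv g) (act g v)) (dinv g ` g ` A) (dinv g ` g ` B)"
      using sub[OF adm_dinv[OF assms(1)] adm_corner[OF assms]] by blast
    then have "act (dinv g) ` e \<in> pent_cell v A B"
      using dinv_act(1)[OF b comb_arcs_subset[OF d(1)]] dinv_image(1)[OF b] d by simp
    moreover have "act g ` act (dinv g) ` e = e"
    proof -
      have "act g ` act (dinv g) ` e = id ` e" unfolding image_image[of "act g"]
      proof (rule image_cong[OF refl])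
        fix w assume "w \<in> e"
        then have "w \<subseteq> arcs" using e edge_comb comb_arcs_subset unfolding pent_cell_def by blast
        then show "act g (act (dinv g) w) = id w" using dinv_act(2)[OF b] by simp
      qed
      then show ?thesis by simp
    qed
    ultimately show "e \<in> (`) (act g) ` pent_cell v A B" by (metis image_eqI)
  qed
qed

lemma adm_cell:
  assumes "adm g" "corner v A B"
  shows "(`) (act g) ` cell v A B = cell (act g v) (g ` A) (g ` B)"
proof (cases "adj v A B")
  case True
  then show ?thesis using adm_pent_cell[OF assms] adm_adj[OF assms] by (simp add: cell_def)
next
  case False
  have "act g (flip v A) = flip (act g v) (g ` A)" "act g (flip v B) = flip (act g v) (g ` B)"
    using adm_flip[OF assms(1)] assms(2) by (auto simp: corner_def)
  then show ?thesis using False adm_adj[OF assms] adm_flip_flip[OF assms]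
    by (simp add: cell_def square_cell_def)
qed

lemma adm_cellular: "adm g \<Longrightarrow> cellular (act g)"
proof -
  assume g: "adm g"
  have "(`) (act g) ` c \<in> two_cells" if c: "c \<in> two_cells" for c
  proof -
    obtain v A B where "corner v A B" "c = cell v A B"
      using c unfolding two_cells_eq corner_def by blast
    then show ?thesis using adm_cell[OF g] cell_two_cell[OF adm_corner[OF g]] by simp
  qed
  then show ?thesis using adm_edge[OF g] by (simp add: cellular_def)
qed

lemma two_cell_edges: "c \<in> two_cells \<Longrightarrow> c \<subseteq> pants_edges"
proof -
  assume "c \<in> two_cells"
  then obtain v A B where c: "corner v A B" "c = cell v A B"
    unfolding two_cells_eq corner_def by blast
  show ?thesis
  proof (cases "adj v A B")
    case True
    then show ?thesis using c by (auto simp: cell_def pent_cell_def)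
  next
    case False
    have 1: "comb (flip v A)" "B \<in> flip v A" "comb (flip v B)" "A \<in> flip v B"
      using corner_flip[OF c(1)] corner_flip[OF corner_sym[OF c(1)]] by (auto simp: corner_def)
    have "flip (flip v A) B = flip (flip v B) A" using False adj_iff_flips_not_commute[OF c(1)] by blast
    then have "{flip v B, flip (flip v A) B} \<in> pants_edges" "{flip v A, flip (flip v A) B} \<in> pants_edges"
      using 1 edge_iff by metis+
    moreover have "{v, flip v A} \<in> pants_edges" "{v, flip v B} \<in> pants_edges"
      using c(1) by (auto simp: corner_def edge_iff)
    ultimately show ?thesis using False c(2) by (simp add: cell_def square_cell_def insert_commute)
  qed
qed

text \<open>Automorphisms are stored as functions restricted to the vertex set, while
  \<open>act g\<close> is total; edges and cells consist of vertices, so the difference is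
  invisible.\<close>

lemma cellular_cong:
  assumes "\<And>v. comb v \<Longrightarrow> f v = f' v"
  shows "cellular f \<longleftrightarrow> cellular f'"
proof -
  have e: "f ` e = f' ` e" if "e \<in> pants_edges" for e
    using that edge_comb assms by (intro image_cong) auto
  have "(`) f ` c = (`) f' ` c" if "c \<in> two_cells" for c
    by (rule image_cong[OF refl]) (rule e, rule subsetD[OF two_cell_edges[OF that]])
  then show ?thesis using e by (simp add: cellular_def)
qed

subsection \<open>Thompson maps on dyadic cells\<close>

text \<open>\<open>F\<close> maps the dyadic interval number \<open>a\<close> of level \<open>n\<close> affinely onto the one with number \<open>j\<close>
  of level \<open>m\<close>.\<close>

definition affine_cell :: "(real \<Rightarrow> real) \<Rightarrow> nat \<Rightarrow> int \<Rightarrow> nat \<Rightarrow> int \<Rightarrow> bool" where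
  "affine_cell F n a m j \<longleftrightarrow> (\<forall>x. of_int a / 2 ^ n \<le> x \<longrightarrow> x \<le> (of_int a + 1) / 2 ^ n \<longrightarrow>
     F x = (of_int j + (2 ^ n * x - of_int a)) / 2 ^ m)"

text \<open>A normal form for lifts of Thompson maps: for periodic \<open>F\<close> it gives the
  breaks, slopes and dyadicity (\<open>thompson_mapI\<close>), and every Thompson map attains it at
  a sufficiently fine level (\<open>thompson_mapE\<close>).\<close>

definition dyadic_affine :: "(real \<Rightarrow> real) \<Rightarrow> nat \<Rightarrow> bool" where
  "dyadic_affine F n \<longleftrightarrow> (\<forall>a. \<exists>m j. affine_cell F n a m j)"

lemma affine_cell_ends:
  assumes "affine_cell F n a m j"
  shows "F (of_int a / 2 ^ n) = of_int j / 2 ^ m" "F ((of_int a + 1) / 2 ^ n) = (of_int j + 1) / 2 ^ m"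
proof -
  have "of_int a / (2 :: real) ^ n \<le> (of_int a + 1) / 2 ^ n" by (simp add: divide_right_mono)
  then show "F (of_int a / 2 ^ n) = of_int j / 2 ^ m" "F ((of_int a + 1) / 2 ^ n) = (of_int j + 1) / 2 ^ m"
    using assms unfolding affine_cell_def by simp_all
qed

lemma affine_cell_refine:
  assumes "affine_cell F n a m j" "0 \<le> r" "r < 2 ^ k"
  shows "affine_cell F (n + k) (a * 2 ^ k + r) (m + k) (j * 2 ^ k + r)"
  unfolding affine_cell_def
proof (intro allI impI)
  fix x :: real
  let ?K = "(2 :: real) ^ k" and ?N = "(2 :: real) ^ n"
  have pos: "?K > 0" "?N > 0" by simp_all
  assume "of_int (a * 2 ^ k + r) / 2 ^ (n + k) \<le> x" "x \<le> (of_int (a * 2 ^ k + r) + 1) / 2 ^ (n + k)"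
  then have x: "of_int a * ?K + of_int r \<le> x * (?N * ?K)" "x * (?N * ?K) \<le> of_int a * ?K + of_int r + 1"
    by (simp_all add: power_add pos_divide_le_eq pos_le_divide_eq)
  have "of_int (r + 1) \<le> (of_int (2 ^ k) :: real)" using assms(3) unfolding of_int_le_iff by simp
  then have r: "0 \<le> (of_int r :: real)" "of_int r + 1 \<le> ?K" using assms(2) by simp_all
  have "x * (?N * ?K) = (x * ?N) * ?K" by (simp only: mult.assoc)
  moreover have "(of_int a + 1) * ?K = of_int a * ?K + ?K" by (simp only: distrib_right mult_1)
  ultimately have "of_int a * ?K \<le> (x * ?N) * ?K" "(x * ?N) * ?K \<le> (of_int a + 1) * ?K"
    using x r by linarith+
  then have "of_int a \<le> x * ?N" "x * ?N \<le> of_int a + 1"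
    using mult_right_le_imp_le[OF _ pos(1)] by blast+
  then have "of_int a / ?N \<le> x" "x \<le> (of_int a + 1) / ?N" by (simp_all add: pos_divide_le_eq pos_le_divide_eq)
  then have "F x = (of_int j + (2 ^ n * x - of_int a)) / 2 ^ m"
    using assms(1) unfolding affine_cell_def by blast
  also have "\<dots> = ((of_int j + (2 ^ n * x - of_int a)) * ?K) / (2 ^ m * ?K)" by simp
  also have "(of_int j + (2 ^ n * x - of_int a)) * ?K =
      of_int (j * 2 ^ k + r) + (2 ^ (n + k) * x - of_int (a * 2 ^ k + r))"
    by (simp add: power_add algebra_simps)
  finally show "F x = (of_int (j * 2 ^ k + r) + (2 ^ (n + k) * x - of_int (a * 2 ^ k + r))) / 2 ^ (m + k)"
    by (simp add: power_add)
qed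

text \<open>Refining the source by \<open>k\<close> levels refines the image by \<open>k\<close>
  levels. The bound \<open>m \<ge> k\<close> lets a second map be affine on the image
  (\<open>dyadic_affine_comp\<close>) and keeps image levels positive
  (\<open>thompson_adm\<close>).\<close>

lemma dyadic_affine_refine:
  assumes "dyadic_affine F n"
  obtains m j where "m \<ge> k" "affine_cell F (n + k) b m j"
proof -
  let ?a = "b div 2 ^ k" and ?r = "b mod 2 ^ k"
  obtain m j where mj: "affine_cell F n ?a m j" using assms unfolding dyadic_affine_def by blast
  have "affine_cell F (n + k) (?a * 2 ^ k + ?r) (m + k) (j * 2 ^ k + ?r)"
    by (rule affine_cell_refine[OF mj]) simp_all
  then show ?thesis using that[of "m + k"] by (simp add: div_mult_mod_eq)
qed

lemma dyadic_affine_comp: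
  assumes "dyadic_affine F p" "dyadic_affine G q"
  shows "dyadic_affine (F \<circ> G) (q + p)"
  unfolding dyadic_affine_def
proof
  fix b
  obtain m c where mc: "m \<ge> p" "affine_cell G (q + p) b m c" by (rule dyadic_affine_refine[OF assms(2)])
  obtain l j where lj: "affine_cell F (p + (m - p)) c l j" by (rule dyadic_affine_refine[OF assms(1)])
  then have F: "affine_cell F m c l j" using mc by simp
  have "affine_cell (F \<circ> G) (q + p) b l j"
    unfolding affine_cell_def
  proof (intro allI impI)
    fix x :: real assume x: "of_int b / 2 ^ (q + p) \<le> x" "x \<le> (of_int b + 1) / 2 ^ (q + p)"
    then have "G x = (of_int c + (2 ^ (q + p) * x - of_int b)) / 2 ^ m"
      using mc(2) unfolding affine_cell_def by blast
    then have G: "2 ^ m * G x = of_int c + (2 ^ (q + p) * x - of_int b)" by simp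
    have "of_int b \<le> 2 ^ (q + p) * x" "2 ^ (q + p) * x \<le> of_int b + 1"
      using x by (simp_all add: pos_divide_le_eq pos_le_divide_eq mult.commute)
    then have "of_int c \<le> G x * 2 ^ m" "G x * 2 ^ m \<le> of_int c + 1" using G by (simp_all add: mult.commute)
    then have "of_int c / 2 ^ m \<le> G x" "G x \<le> (of_int c + 1) / 2 ^ m"
      by (simp_all add: pos_divide_le_eq pos_le_divide_eq)
    then have "F (G x) = (of_int j + (2 ^ m * G x - of_int c)) / 2 ^ l"
      using F unfolding affine_cell_def by blast
    then show "(F \<circ> G) x = (of_int j + (2 ^ (q + p) * x - of_int b)) / 2 ^ l" using G by simp
  qed
  then show "\<exists>m j. affine_cell (F \<circ> G) (q + p) b m j" by blast
qed

lemma lift_add_int: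
  fixes F :: "real \<Rightarrow> real"
  assumes "\<And>x. F (x + 1) = F x + 1"
  shows "F (x + of_int l) = F x + of_int l"
proof (induction l rule: int_induct[where k = 0])
  case (step1 i)
  then show ?case using assms[of "x + of_int i"] by (simp add: add.assoc)
next
  case (step2 i)
  then show ?case using assms[of "x + of_int (i - 1)"] by (simp add: add.assoc)
qed simp

text \<open>The floor selects the cell extending to the right of \<open>x\<close>, the ceiling in
  \<open>ceiling_cell\<close> the one extending to its left; they differ exactly at division
  points.\<close>

lemma floor_cell: "of_int \<lfloor>2 ^ n * x\<rfloor> / 2 ^ n \<le> x" "x < (of_int \<lfloor>2 ^ n * x\<rfloor> + 1) / (2 :: real) ^ n"
proof -
  have "of_int \<lfloor>2 ^ n * x\<rfloor> \<le> 2 ^ n * x" "2 ^ n * x < of_int \<lfloor>2 ^ n * x\<rfloor> + 1" by linarith+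
  then show "of_int \<lfloor>2 ^ n * x\<rfloor> / 2 ^ n \<le> x" "x < (of_int \<lfloor>2 ^ n * x\<rfloor> + 1) / (2 :: real) ^ n"
    by (simp_all add: pos_divide_le_eq pos_less_divide_eq mult.commute)
qed

lemma ceiling_cell: "of_int (\<lceil>2 ^ n * x\<rceil> - 1) / 2 ^ n < x" "x \<le> (of_int (\<lceil>2 ^ n * x\<rceil> - 1) + 1) / (2 :: real) ^ n"
proof -
  have "of_int (\<lceil>2 ^ n * x\<rceil> - 1) < 2 ^ n * x" "2 ^ n * x \<le> of_int (\<lceil>2 ^ n * x\<rceil> - 1) + 1" by linarith+
  then show "of_int (\<lceil>2 ^ n * x\<rceil> - 1) / 2 ^ n < x" "x \<le> (of_int (\<lceil>2 ^ n * x\<rceil> - 1) + 1) / (2 :: real) ^ n"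
    by (simp_all add: pos_divide_less_eq pos_le_divide_eq mult.commute)
qed

lemma affine_cell_slope:
  assumes "affine_cell F n a m j" "of_int a / 2 ^ n \<le> x" "x \<le> (of_int a + 1) / 2 ^ n"
    "of_int a / 2 ^ n \<le> y" "y \<le> (of_int a + 1) / 2 ^ n"
  shows "F y = F x + 2 ^ n / 2 ^ m * (y - x)"
proof -
  have "F x = (of_int j + (2 ^ n * x - of_int a)) / 2 ^ m" "F y = (of_int j + (2 ^ n * y - of_int a)) / 2 ^ m"
    using assms unfolding affine_cell_def by blast+
  then show ?thesis by (simp add: field_simps)
qed

lemma dyadic_affine_local:
  assumes "dyadic_affine F n"
  obtains e k l where "e > 0" "\<And>y. y \<in> {x - e..x} \<Longrightarrow> F y = F x + 2 ^ n / 2 ^ k * (y - x)"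
    "\<And>y. y \<in> {x..x + e} \<Longrightarrow> F y = F x + 2 ^ n / 2 ^ l * (y - x)"
proof -
  let ?b = "\<lfloor>2 ^ n * x\<rfloor>" and ?a = "\<lceil>2 ^ n * x\<rceil> - 1"
  obtain l j where l: "affine_cell F n ?b l j" using assms unfolding dyadic_affine_def by blast
  obtain k i where k: "affine_cell F n ?a k i" using assms unfolding dyadic_affine_def by blast
  define e where "e = min (x - of_int ?a / 2 ^ n) ((of_int ?b + 1) / 2 ^ n - x)"
  have "e > 0" using floor_cell[where n = n and x = x] ceiling_cell[where n = n and x = x] by (simp add: e_def)
  moreover have "F y = F x + 2 ^ n / 2 ^ k * (y - x)" if "y \<in> {x - e..x}" for y
  proof (rule affine_cell_slope[OF k])
    have "e \<le> x - of_int ?a / 2 ^ n" unfolding e_def by (rule min.cobounded1)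
    then show "of_int ?a / 2 ^ n \<le> y" using that by (auto simp del: of_int_diff)
    show "y \<le> (of_int ?a + 1) / 2 ^ n" using that ceiling_cell(2)[where n = n and x = x] by (auto simp del: of_int_diff)
  qed (use ceiling_cell[where n = n and x = x] in auto)
  moreover have "F y = F x + 2 ^ n / 2 ^ l * (y - x)" if "y \<in> {x..x + e}" for y
  proof (rule affine_cell_slope[OF l])
    have "e \<le> (of_int ?b + 1) / 2 ^ n - x" unfolding e_def by (rule min.cobounded2)
    then show "y \<le> (of_int ?b + 1) / 2 ^ n" using that by auto
    show "of_int ?b / 2 ^ n \<le> y" using that floor_cell(1)[where n = n and x = x] by auto
  qed (use floor_cell[where n = n and x = x] in auto)
  ultimately show ?thesis by (rule that)
qed

lemma eventually_at_rightI':
  fixes x :: real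
  assumes "e > 0" "\<And>y. y \<in> {x..x + e} \<Longrightarrow> y \<noteq> x \<Longrightarrow> P y"
  shows "eventually P (at_right x)"
  unfolding eventually_at_right_field using assms by (intro exI[of _ "x + e"]) simp

lemma eventually_at_leftI':
  fixes x :: real
  assumes "e > 0" "\<And>y. y \<in> {x - e..x} \<Longrightarrow> y \<noteq> x \<Longrightarrow> P y"
  shows "eventually P (at_left x)"
  unfolding eventually_at_left_field using assms by (intro exI[of _ "x - e"]) simp

lemma right_slope_unique:
  fixes F :: "real \<Rightarrow> real"
  assumes "(F has_real_derivative d) (at x)" "e > 0" "\<And>y. y \<in> {x..x + e} \<Longrightarrow> F y = F x + m * (y - x)"
  shows "d = m"
proof -
  have "((\<lambda>y. (F y - F x) / (y - x)) \<longlongrightarrow> d) (at_right x)"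
    using assms(1) unfolding has_field_derivative_iff by (rule filterlim_mono) (simp_all add: at_le)
  moreover have "\<forall>\<^sub>F y in at_right x. (F y - F x) / (y - x) = m"
  proof (rule eventually_at_rightI'[OF assms(2)])
    fix y assume y: "y \<in> {x..x + e}" "y \<noteq> x"
    show "(F y - F x) / (y - x) = m" using assms(3)[OF y(1)] y(2) by simp
  qed
  ultimately have "((\<lambda>y. m) \<longlongrightarrow> d) (at_right x)" by (rule Lim_transform_eventually)
  then show ?thesis by (simp add: tendsto_const_iff)
qed

lemma left_slope_unique:
  fixes F :: "real \<Rightarrow> real"
  assumes "(F has_real_derivative d) (at x)" "e > 0" "\<And>y. y \<in> {x - e..x} \<Longrightarrow> F y = F x + m * (y - x)"
  shows "d = m"
proof -
  have "((\<lambda>y. (F y - F x) / (y - x)) \<longlongrightarrow> d) (at_left x)"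
    using assms(1) unfolding has_field_derivative_iff by (rule filterlim_mono) (simp_all add: at_le)
  moreover have "\<forall>\<^sub>F y in at_left x. (F y - F x) / (y - x) = m"
  proof (rule eventually_at_leftI'[OF assms(2)])
    fix y assume y: "y \<in> {x - e..x}" "y \<noteq> x"
    show "(F y - F x) / (y - x) = m" using assms(3)[OF y(1)] y(2) by simp
  qed
  ultimately have "((\<lambda>y. m) \<longlongrightarrow> d) (at_left x)" by (rule Lim_transform_eventually)
  then show ?thesis by (simp add: tendsto_const_iff)
qed

lemma dyadic_affine_continuous:
  assumes "dyadic_affine F n"
  shows "continuous_on UNIV F"
proof -
  have "isCont F x" for x
  proof -
    obtain e k l where e: "e > 0" "\<And>y. y \<in> {x - e..x} \<Longrightarrow> F y = F x + 2 ^ n / 2 ^ k * (y - x)"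
      "\<And>y. y \<in> {x..x + e} \<Longrightarrow> F y = F x + 2 ^ n / 2 ^ l * (y - x)" by (rule dyadic_affine_local[where x = x, OF assms]) (rule that)
    have "((\<lambda>y. F x + 2 ^ n / 2 ^ k * (y - x)) \<longlongrightarrow> F x + 2 ^ n / 2 ^ k * (x - x)) (at_left x)"
      by (intro tendsto_intros)
    moreover have "\<forall>\<^sub>F y in at_left x. F x + 2 ^ n / 2 ^ k * (y - x) = F y"
      by (rule eventually_at_leftI'[OF e(1)]) (rule e(2)[symmetric])
    ultimately have "(F \<longlongrightarrow> F x + 2 ^ n / 2 ^ k * (x - x)) (at_left x)" by (rule Lim_transform_eventually)
    then have 1: "(F \<longlongrightarrow> F x) (at_left x)" by simp
    have "((\<lambda>y. F x + 2 ^ n / 2 ^ l * (y - x)) \<longlongrightarrow> F x + 2 ^ n / 2 ^ l * (x - x)) (at_right x)"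
      by (intro tendsto_intros)
    moreover have "\<forall>\<^sub>F y in at_right x. F x + 2 ^ n / 2 ^ l * (y - x) = F y"
      by (rule eventually_at_rightI'[OF e(1)]) (rule e(3)[symmetric])
    ultimately have "(F \<longlongrightarrow> F x + 2 ^ n / 2 ^ l * (x - x)) (at_right x)" by (rule Lim_transform_eventually)
    then have 2: "(F \<longlongrightarrow> F x) (at_right x)" by simp
    show ?thesis unfolding isCont_def filterlim_split_at_real using 1 2 by (simp add: filterlim_at_split)
  qed
  then show ?thesis by (simp add: continuous_at_imp_continuous_on)
qed

lemma dyadic_affine_strict_mono:
  assumes "dyadic_affine F n"
  shows "strict_mono F"
proof (rule strict_monoI)
  fix x y :: real assume xy: "x < y"
  have step: "F (of_int a / 2 ^ n) < F (of_int (a + 1) / 2 ^ n)" for a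
  proof -
    obtain m j where "affine_cell F n a m j" using assms unfolding dyadic_affine_def by blast
    from affine_cell_ends[OF this] show ?thesis by (simp add: divide_strict_right_mono)
  qed
  have mono: "F (of_int a / 2 ^ n) \<le> F (of_int b / 2 ^ n)" if "a \<le> b" for a b
    using that
  proof (induction b rule: int_ge_induct)
    case (step i)
    then show ?case using \<open>\<And>a. F (of_int a / 2 ^ n) < F (of_int (a + 1) / 2 ^ n)\<close>[of i] by linarith
  qed simp
  have inc: "F u < F w" if "of_int a / 2 ^ n \<le> u" "u < w" "w \<le> (of_int a + 1) / 2 ^ n" for a u w
  proof -
    obtain m j where "affine_cell F n a m j" using assms unfolding dyadic_affine_def by blast
    from affine_cell_slope[OF this, of u w] show ?thesis using that by simp
  qed
  let ?a = "\<lfloor>2 ^ n * x\<rfloor>" and ?b = "\<lfloor>2 ^ n * y\<rfloor>"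
  have "?a \<le> ?b" using xy by (intro floor_mono) simp
  show "F x < F y"
  proof (cases "?a = ?b")
    case True
    then show ?thesis using inc[of ?a x y] floor_cell(1)[where n = n and x = x] floor_cell(2)[where n = n and x = y] xy by simp
  next
    case False
    have "F x < F ((of_int ?a + 1) / 2 ^ n)"
      using inc[of ?a x "(of_int ?a + 1) / 2 ^ n"] floor_cell[where n = n and x = x] floor_cell(2)[where n = n and x = x] by simp
    also have "\<dots> \<le> F (of_int ?b / 2 ^ n)" using mono[of "?a + 1" ?b] False \<open>?a \<le> ?b\<close> by simp
    also have "\<dots> \<le> F y"
      using inc[of ?b "of_int ?b / 2 ^ n" y] floor_cell(1)[where n = n and x = y] floor_cell(2)[where n = n and x = y]
      by (cases "of_int ?b / 2 ^ n = y") auto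
    finally show ?thesis .
  qed
qed

lemma dyadic_affine_surj:
  assumes "dyadic_affine F n" "\<And>x. F (x + 1) = F x + 1"
  shows "\<exists>x. F x = y"
proof -
  define l where "l = \<lfloor>y - F 0\<rfloor>"
  have "F (of_int l) \<le> y" "y \<le> F (of_int (l + 1))"
    using lift_add_int[of F 0 l] lift_add_int[of F 0 "l + 1"] assms(2) unfolding l_def by (simp_all, linarith+)
  moreover have "continuous_on {of_int l..of_int (l + 1)} F"
    using dyadic_affine_continuous[OF assms(1)] continuous_on_subset by blast
  ultimately show ?thesis using IVT'[of F "of_int l" y "of_int (l + 1)"] by auto
qed

lemma dyadicI: "of_int a / 2 ^ n \<in> dyadic"
  by (auto simp: dyadic_def)

lemma dyadic_affine_dyadic_iff:
  assumes "dyadic_affine F n"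
  shows "F x \<in> dyadic \<longleftrightarrow> x \<in> dyadic"
proof -
  let ?a = "\<lfloor>2 ^ n * x\<rfloor>"
  obtain m j where "affine_cell F n ?a m j" using assms unfolding dyadic_affine_def by blast
  then have F: "F x = (of_int j + (2 ^ n * x - of_int ?a)) / 2 ^ m"
    using floor_cell(1)[where n = n and x = x] floor_cell(2)[where n = n and x = x] unfolding affine_cell_def by (meson less_imp_le)
  show ?thesis
  proof
    assume "F x \<in> dyadic"
    then obtain b k where "F x = of_int b / 2 ^ k" by (auto simp: dyadic_def)
    then have "x = of_int (b * 2 ^ m + (?a - j) * 2 ^ k) / 2 ^ (n + k)"
      using F by (simp add: field_simps power_add)
    then show "x \<in> dyadic" using dyadicI by metis
  next
    assume "x \<in> dyadic"
    then obtain b k where "x = of_int b / 2 ^ k" by (auto simp: dyadic_def)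
    then have b: "x * 2 ^ k = of_int b" by simp
    have "F x = ((of_int j + (2 ^ n * x - of_int ?a)) * 2 ^ k) / (2 ^ m * 2 ^ k)" using F by simp
    also have "(of_int j + (2 ^ n * x - of_int ?a)) * 2 ^ k = (of_int j - of_int ?a) * 2 ^ k + 2 ^ n * (x * 2 ^ k)"
      by (simp add: algebra_simps)
    finally have "F x = of_int ((j - ?a) * 2 ^ k + b * 2 ^ n) / 2 ^ (m + k)"
      unfolding b by (simp add: power_add mult.commute)
    then show "F x \<in> dyadic" using dyadicI by metis
  qed
qed

lemma dyadic_add_int: "x \<in> dyadic \<Longrightarrow> x + of_int k \<in> dyadic"
proof -
  assume "x \<in> dyadic"
  then obtain a n where "x = of_int a / 2 ^ n" by (auto simp: dyadic_def)
  then have "x + of_int k = of_int (a + k * 2 ^ n) / 2 ^ n" by (simp add: field_simps)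
  then show ?thesis using dyadicI by metis
qed

lemma to_circle_dyadic_iff: "to_circle x \<in> D \<longleftrightarrow> x \<in> dyadic"
proof
  assume "to_circle x \<in> D"
  then obtain y where y: "y \<in> dyadic" "to_circle x = to_circle y" by (auto simp: dyadic_points_def)
  then obtain k where "x - y = of_int k" by (auto simp: to_circle_eq_iff elim: Ints_cases)
  then have "x = y + of_int k" by simp
  then show "x \<in> dyadic" using dyadic_add_int y by simp
qed (auto simp: dyadic_points_def)

lemma thompson_mapI:
  assumes "dyadic_affine F n" "\<And>x. F (x + 1) = F x + 1" "\<And>x. t (to_circle x) = to_circle (F x)"
  shows "thompson_map t"
  unfolding thompson_map_def
proof (intro conjI exI[of _ F])
  show "is_lift F t"
    unfolding is_lift_def using dyadic_affine_continuous dyadic_affine_strict_mono assms by blast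
  show "piecewise_linear F"
    unfolding piecewise_linear_def
  proof
    fix x
    obtain e k l where "e > 0" "\<And>y. y \<in> {x - e..x} \<Longrightarrow> F y = F x + 2 ^ n / 2 ^ k * (y - x)"
      "\<And>y. y \<in> {x..x + e} \<Longrightarrow> F y = F x + 2 ^ n / 2 ^ l * (y - x)" by (rule dyadic_affine_local[where x = x, OF assms(1)]) (rule that)
    then show "\<exists>e>0. \<exists>m m'. (\<forall>y\<in>{x - e..x}. F y = F x + m * (y - x)) \<and> (\<forall>y\<in>{x..x + e}. F y = F x + m' * (y - x))"
      by blast
  qed
  have nd: "to_circle ` {x. \<not> F differentiable (at x)} \<subseteq> grid n"
  proof clarify
    fix x assume nd: "\<not> F differentiable (at x)"
    let ?a = "\<lfloor>2 ^ n * x\<rfloor>"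
    have "x = of_int ?a / 2 ^ n"
    proof (rule ccontr)
      assume "x \<noteq> of_int ?a / 2 ^ n"
      then have x: "x \<in> {of_int ?a / 2 ^ n<..<(of_int ?a + 1) / 2 ^ n}"
        using floor_cell(1)[where n = n and x = x] floor_cell(2)[where n = n and x = x] by simp
      obtain m j where c: "affine_cell F n ?a m j" using assms unfolding dyadic_affine_def by blast
      have "((\<lambda>y. F x + 2 ^ n / 2 ^ m * (y - x)) has_real_derivative 2 ^ n / 2 ^ m) (at x)"
        by (auto intro!: derivative_eq_intros)
      then have "(F has_real_derivative 2 ^ n / 2 ^ m) (at x)"
      proof (rule has_field_derivative_transform_within_open[OF _ open_greaterThanLessThan x])
        fix y :: real assume y: "y \<in> {of_int ?a / 2 ^ n<..<(of_int ?a + 1) / 2 ^ n}"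
        show "F x + 2 ^ n / 2 ^ m * (y - x) = F y"
          using affine_cell_slope[OF c, of x y] x y by auto
      qed
      then show False using nd by (auto simp: real_differentiable_def)
    qed
    then show "to_circle x \<in> grid n" unfolding grid_def by (metis rangeI)
  qed
  show "finite (to_circle ` {x. \<not> F differentiable (at x)})" using nd finite_grid by (rule finite_subset)
  show "to_circle ` {x. \<not> F differentiable (at x)} \<subseteq> D" using nd by (auto simp: dyadic_points_eq)
  show "\<forall>x d. (F has_real_derivative d) (at x) \<longrightarrow> (\<exists>k::int. d = 2 powi k)"
  proof (intro allI impI)
    fix x d assume d: "(F has_real_derivative d) (at x)"
    obtain e k l where e: "e > 0" "\<And>y. y \<in> {x - e..x} \<Longrightarrow> F y = F x + 2 ^ n / 2 ^ k * (y - x)"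
      "\<And>y. y \<in> {x..x + e} \<Longrightarrow> F y = F x + 2 ^ n / 2 ^ l * (y - x)" by (rule dyadic_affine_local[where x = x, OF assms(1)]) (rule that)
    have "d = 2 ^ n / 2 ^ l" by (rule right_slope_unique[OF d e(1,3)])
    also have "\<dots> = 2 powi (int n - int l)" by (simp add: power_int_diff)
    finally show "\<exists>k::int. d = 2 powi k" by blast
  qed
  show "t ` D = D"
  proof (intro equalityI subsetI)
    fix c assume "c \<in> t ` D"
    then obtain x where "x \<in> dyadic" "c = t (to_circle x)" by (auto simp: dyadic_points_def)
    then show "c \<in> D" using assms(3) dyadic_affine_dyadic_iff[OF assms(1)] to_circle_dyadic_iff by simp
  next
    fix c assume c: "c \<in> D"
    obtain x where x: "F x = pos c" using dyadic_affine_surj[OF assms(1,2)] by blast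
    then have "t (to_circle x) = c" using assms(3) by simp
    moreover have "x \<in> dyadic"
      using dyadic_affine_dyadic_iff[OF assms(1), of x] x c to_circle_dyadic_iff[of "pos c"] by simp
    ultimately show "c \<in> t ` D" using to_circle_dyadic_iff by blast
  qed
qed

text \<open>Differentiability makes the left and right slopes of the local pieces agree, so the
  derivative is locally constant and hence constant. The point \<open>y\<close> is returned because
  the power-of-2 condition speaks of derivatives at points.\<close>

lemma affine_between:
  fixes F :: "real \<Rightarrow> real"
  assumes "p < q" "continuous_on {p..q} F" "piecewise_linear F"
    and "\<And>x. x \<in> {p<..<q} \<Longrightarrow> F differentiable (at x)"
  obtains d y where "(F has_real_derivative d) (at y)" "\<And>x. x \<in> {p..q} \<Longrightarrow> F x = F p + d * (x - p)"
proof -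
  have der: "(F has_real_derivative deriv F x) (at x)" if "x \<in> {p<..<q}" for x
    using assms(4)[OF that] real_differentiable_def DERIV_deriv_iff_real_differentiable by blast
  have loc: "\<exists>e>0. \<forall>y\<in>{x - e<..<x + e}. F y = F x + deriv F x * (y - x)" if x: "x \<in> {p<..<q}" for x
  proof -
    obtain e m m' where e: "e > 0" "\<forall>y\<in>{x - e..x}. F y = F x + m * (y - x)" "\<forall>y\<in>{x..x + e}. F y = F x + m' * (y - x)"
      using assms(3) unfolding piecewise_linear_def by blast
    have dm: "deriv F x = m" by (rule left_slope_unique[OF der[OF x] e(1)]) (rule e(2)[rule_format])
    have dm': "deriv F x = m'" by (rule right_slope_unique[OF der[OF x] e(1)]) (rule e(3)[rule_format])
    have "F y = F x + deriv F x * (y - x)" if "y \<in> {x - e<..<x + e}" for y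
    proof (cases "y \<le> x")
      case True
      then have "y \<in> {x - e..x}" using that by simp
      from bspec[OF e(2) this] show ?thesis unfolding dm .
    next
      case False
      then have "y \<in> {x..x + e}" using that by simp
      from bspec[OF e(3) this] show ?thesis unfolding dm' .
    qed
    then show ?thesis using e(1) by blast
  qed
  have dz: "(deriv F has_real_derivative 0) (at x)" if x: "x \<in> {p<..<q}" for x
  proof -
    obtain e where e: "e > 0" "\<forall>y\<in>{x - e<..<x + e}. F y = F x + deriv F x * (y - x)" using loc[OF x] by blast
    have eqd: "deriv F y = deriv F x" if y: "y \<in> {x - e<..<x + e}" for y
    proof (rule DERIV_imp_deriv)
      have "((\<lambda>z. F x + deriv F x * (z - x)) has_real_derivative deriv F x) (at y)"
        by (auto intro!: derivative_eq_intros)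
      then show "(F has_real_derivative deriv F x) (at y)"
        by (rule has_field_derivative_transform_within_open[OF _ open_greaterThanLessThan y]) (rule e(2)[rule_format, symmetric])
    qed
    have c: "((\<lambda>z. deriv F x) has_real_derivative 0) (at x)" by simp
    have xin: "x \<in> {x - e<..<x + e}" using e(1) by simp
    show ?thesis
      by (rule has_field_derivative_transform_within_open[OF c open_greaterThanLessThan xin]) (rule eqd[symmetric])
  qed
  have z: "(deriv F has_real_derivative 0) (at x within {p<..<q})" if "x \<in> {p<..<q}" for x
    by (rule has_field_derivative_at_within[OF dz[OF that]])
  have "\<exists>d. \<forall>x\<in>{p<..<q}. deriv F x = d"
    by (rule has_field_derivative_zero_constant[OF convex_real_interval(8) z])
  then obtain d where d: "\<And>x. x \<in> {p<..<q} \<Longrightarrow> deriv F x = d" by metis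
  have dd: "(F has_real_derivative d) (at x)" if "x \<in> {p<..<q}" for x using der[OF that] d[OF that] by simp
  have const: "F x - d * x = F p - d * p" if "x \<in> {p..q}" for x
  proof (rule DERIV_isconst2[OF assms(1), of "\<lambda>x. F x - d * x"])
    show "continuous_on {p..q} (\<lambda>x. F x - d * x)" using assms(2) by (intro continuous_intros)
    show "((\<lambda>x. F x - d * x) has_real_derivative 0) (at z)" if "p < z" "z < q" for z
      using dd[of z] that by (auto intro!: derivative_eq_intros)
  qed (use that in auto)
  have "F x = F p + d * (x - p)" if "x \<in> {p..q}" for x
    using const[OF that] by (simp add: algebra_simps)
  moreover have "(F has_real_derivative d) (at ((p + q) / 2))" using dd assms(1) by simp
  ultimately show ?thesis using that by blast
qed

text \<open>All breaks lie in some \<open>grid N\<close>, so \<open>F\<close> is affine on each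
  interval of level \<open>N\<close>, with slope a power of 2 and dyadic starting value. Up to
  integer translation there are \<open>2 ^ N\<close> such intervals, so one refinement by
  \<open>K\<close> further levels makes all image intervals standard.\<close>

lemma thompson_mapE:
  assumes "thompson_map t"
  obtains F n where "is_lift F t" "dyadic_affine F n"
proof -
  obtain F where F: "is_lift F t" "piecewise_linear F"
    and fin: "finite (to_circle ` {x. \<not> F differentiable (at x)})"
    and sub: "to_circle ` {x. \<not> F differentiable (at x)} \<subseteq> D"
    and pow: "\<And>x d. (F has_real_derivative d) (at x) \<Longrightarrow> \<exists>k::int. d = 2 powi k"
    and tD: "t ` D = D"
    using assms unfolding thompson_map_def by blast
  have cont: "continuous_on UNIV F" and per: "\<And>x. F (x + 1) = F x + 1"
    and t: "\<And>x. t (to_circle x) = to_circle (F x)" using F(1) by (auto simp: is_lift_def)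
  obtain N where N: "to_circle ` {x. \<not> F differentiable (at x)} \<subseteq> grid N" using finite_subset_grid[OF fin sub] by blast
  have cell: "\<exists>k c s. F (of_int i / 2 ^ N) = of_int c / 2 ^ s \<and>
      (\<forall>x. of_int i / 2 ^ N \<le> x \<longrightarrow> x \<le> (of_int i + 1) / 2 ^ N \<longrightarrow>
        F x = F (of_int i / 2 ^ N) + 2 powi k * (x - of_int i / 2 ^ N))" for i
  proof -
    let ?p = "of_int i / (2 :: real) ^ N" and ?q = "(of_int i + 1) / (2 :: real) ^ N"
    have pq: "?p < ?q" by (simp add: divide_strict_right_mono)
    have diff: "F differentiable (at x)" if x: "x \<in> {?p<..<?q}" for x
    proof (rule ccontr)
      assume "\<not> F differentiable (at x)"
      then have "to_circle x \<in> grid N" using N by blast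
      then obtain j where "x = of_int j / 2 ^ N" by (rule grid_lift)
      then have "of_int i < (of_int j :: real)" "(of_int j :: real) < of_int i + 1"
        using x by (simp_all add: divide_less_cancel)
      then have "i < j" "j < i + 1" by (simp, metis of_int_1 of_int_add of_int_less_iff)
      then show False by simp
    qed
    have "continuous_on {?p..?q} F" using cont continuous_on_subset by blast
    then obtain d y where d: "(F has_real_derivative d) (at y)" "\<And>x. x \<in> {?p..?q} \<Longrightarrow> F x = F ?p + d * (x - ?p)"
      using affine_between[OF pq _ F(2) diff] by metis
    obtain k where k: "d = 2 powi k" using pow[OF d(1)] by blast
    have "to_circle (F ?p) \<in> D" using t[of ?p] tD to_circle_dyadic_iff[of ?p] dyadicI by (metis imageI)
    then have "F ?p \<in> dyadic" using to_circle_dyadic_iff by blast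
    then obtain c s where "F ?p = of_int c / 2 ^ s" by (auto simp: dyadic_def)
    moreover have "F x = F ?p + 2 powi k * (x - ?p)" if "?p \<le> x" "x \<le> ?q" for x using d(2)[of x] that k by simp
    ultimately show ?thesis by blast
  qed
  then obtain k c s where kcs: "\<And>i. F (of_int i / 2 ^ N) = of_int (c i) / 2 ^ s i"
    "\<And>i x. of_int i / 2 ^ N \<le> x \<Longrightarrow> x \<le> (of_int i + 1) / 2 ^ N \<Longrightarrow>
        F x = F (of_int i / 2 ^ N) + 2 powi (k i) * (x - of_int i / 2 ^ N)"
    by metis
  \<comment> \<open>Large enough that the image level \<open>N + K - k i\<close> is at least the
    level \<open>s i\<close> of the starting value.\<close>
  define K where "K = Max ((\<lambda>i. nat \<bar>k i\<bar> + s i) ` {0..<2 ^ N})"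
  have K: "nat \<bar>k i\<bar> + s i \<le> K" if "i \<in> {0..<2 ^ N}" for i
    unfolding K_def using that by (intro Max_ge) auto
  have "\<exists>m j. affine_cell F (N + K) a m j" for a
  proof -
    define b where "b = a div 2 ^ K"
    define i where "i = b mod 2 ^ N"
    define l where "l = b div 2 ^ N"
    have b: "b = i + l * 2 ^ N" by (simp add: i_def l_def mod_div_mult_eq)
    have "i \<in> {0..<2 ^ N}" by (simp add: i_def)
    then have Ki: "nat \<bar>k i\<bar> + s i \<le> K" by (rule K)
    \<comment> \<open>Slope \<open>2 powi k i\<close> times source length
      \<open>1 / 2 ^ (N + K)\<close> is the image length \<open>1 / 2 ^ m\<close>.\<close>
    define m where "m = nat (int (N + K) - k i)"
    have m: "int m = int (N + K) - k i" "s i \<le> m" using Ki by (auto simp: m_def)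
    \<comment> \<open>Starting value at \<open>i\<close> in units of \<open>1 / 2 ^ m\<close>, plus
      the number of small intervals passed since then. The last term is the translation by
      \<open>l\<close>, which shifts the source number by \<open>2 ^ (N + K)\<close> and the image
      number by \<open>2 ^ m\<close> per unit.\<close>
    define j where "j = c i * 2 ^ (m - s i) + a - i * 2 ^ K + l * (2 ^ m - 2 ^ (N + K))"
    have "affine_cell F (N + K) a m j"
      unfolding affine_cell_def
    proof (intro allI impI)
      fix x :: real assume x: "of_int a / 2 ^ (N + K) \<le> x" "x \<le> (of_int a + 1) / 2 ^ (N + K)"
      let ?y = "x - of_int l"
      have a: "b * 2 ^ K \<le> a" "a + 1 \<le> (b + 1) * 2 ^ K"
      proof -
        have "a = b * 2 ^ K + a mod 2 ^ K" by (simp add: b_def div_mult_mod_eq)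
        moreover have "0 \<le> a mod 2 ^ K" "a mod 2 ^ K < 2 ^ K" by simp_all
        moreover have "(b + 1) * 2 ^ K = b * 2 ^ K + 2 ^ K" by (simp add: distrib_right)
        ultimately show "b * 2 ^ K \<le> a" "a + 1 \<le> (b + 1) * 2 ^ K" by linarith+
      qed
      have e: "of_int b / 2 ^ N = (of_int (b * 2 ^ K) / 2 ^ (N + K) :: real)"
        "(of_int b + 1) / 2 ^ N = (of_int ((b + 1) * 2 ^ K) / 2 ^ (N + K) :: real)"
        by (simp_all add: power_add)
      have "of_int (b * 2 ^ K) \<le> (of_int a :: real)" "of_int (a + 1) \<le> (of_int ((b + 1) * 2 ^ K) :: real)"
        using a by (simp_all only: of_int_le_iff)
      then have "of_int (b * 2 ^ K) / (2 :: real) ^ (N + K) \<le> of_int a / 2 ^ (N + K)"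
        "of_int (a + 1) / (2 :: real) ^ (N + K) \<le> of_int ((b + 1) * 2 ^ K) / 2 ^ (N + K)"
        by (intro divide_right_mono; simp)+
      then have bx: "of_int b / 2 ^ N \<le> x" "x \<le> (of_int b + 1) / 2 ^ N"
        unfolding e using x by simp_all
      have bi: "of_int b / (2 :: real) ^ N = of_int i / 2 ^ N + of_int l"
        "(of_int b + 1) / (2 :: real) ^ N = (of_int i + 1) / 2 ^ N + of_int l"
        unfolding b by (simp_all add: add_divide_distrib)
      have y: "of_int i / 2 ^ N \<le> ?y" "?y \<le> (of_int i + 1) / 2 ^ N"
        using bx unfolding bi by (simp_all only: le_diff_eq diff_le_eq)
      have "F x = F (?y + of_int l)" by simp
      also have "\<dots> = F ?y + of_int l" using lift_add_int[of F ?y l] per by simp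
      also have "F ?y = of_int (c i) / 2 ^ s i + 2 powi (k i) * (?y - of_int i / 2 ^ N)"
        using kcs(2)[OF y] kcs(1)[of i] by simp
      also have "(2 :: real) powi (k i) = 2 ^ (N + K) / 2 ^ m"
      proof -
        have "k i = int (N + K) - int m" using m(1) by simp
        then show ?thesis by (simp add: power_int_diff del: of_nat_add)
      qed
      also have "of_int (c i) / 2 ^ s i = (of_int (c i * 2 ^ (m - s i)) / 2 ^ m :: real)"
      proof -
        have "(2 :: real) ^ m = 2 ^ s i * 2 ^ (m - s i)" using m(2) by (simp flip: power_add)
        then show ?thesis by simp
      qed
      also have "of_int (c i * 2 ^ (m - s i)) / 2 ^ m + 2 ^ (N + K) / 2 ^ m * (?y - of_int i / 2 ^ N) + of_int l =
          (of_int (c i * 2 ^ (m - s i)) + 2 ^ (N + K) * (?y - of_int i / 2 ^ N) + of_int l * 2 ^ m) / 2 ^ m"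
        by (simp add: add_divide_distrib)
      also have "2 ^ (N + K) * (?y - of_int i / 2 ^ N) = 2 ^ (N + K) * x - 2 ^ (N + K) * of_int l - of_int i * 2 ^ K"
        by (simp add: power_add right_diff_distrib)
      finally show "F x = (of_int j + (2 ^ (N + K) * x - of_int a)) / 2 ^ m"
        unfolding j_def by (simp add: algebra_simps)
    qed
    then show ?thesis by blast
  qed
  then have "dyadic_affine F (N + K)" by (simp add: dyadic_affine_def)
  then show ?thesis using that F(1) by blast
qed

section \<open>Thompson maps as admissible maps\<close>

lemma thompson_comp:
  assumes "thompson_map t" "thompson_map u"
  shows "thompson_map (t \<circ> u)"
proof -
  obtain F p where F: "is_lift F t" "dyadic_affine F p" using thompson_mapE[OF assms(1)] .
  obtain G q where G: "is_lift G u" "dyadic_affine G q" using thompson_mapE[OF assms(2)] .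
  show ?thesis
  proof (rule thompson_mapI[OF dyadic_affine_comp[OF F(2) G(2)]])
    show "(F \<circ> G) (x + 1) = (F \<circ> G) x + 1" for x using F(1) G(1) by (simp add: is_lift_def)
    show "(t \<circ> u) (to_circle x) = to_circle ((F \<circ> G) x)" for x using F(1) G(1) by (simp add: is_lift_def)
  qed
qed

lemma affine_cell_stdarc:
  assumes "affine_cell F n a m j" "\<And>x. t (to_circle x) = to_circle (F x)"
  shows "t ` stdarc n a = stdarc m j"
  using affine_cell_ends[OF assms(1)] by (simp add: stdarc_def assms(2))

lemma thompson_cyc:
  assumes "is_lift F t" "cyc a b c"
  shows "cyc (t a) (t b) (t c)"
proof -
  have "cyc (to_circle (pos a)) b c" using assms(2) by simp
  then obtain y z where yz: "b = to_circle y" "c = to_circle z" "pos a < y" "y < z" "z < pos a + 1"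
    by (rule cyc_lift)
  have "F (pos a) < F y" "F y < F z" "F z < F (pos a) + 1"
    using assms(1) yz unfolding is_lift_def by (metis strict_mono_less)+
  then have "cyc (to_circle (F (pos a))) (to_circle (F y)) (to_circle (F z))" by (rule cyc_to_circle)
  moreover have "t a = to_circle (F (pos a))" "t b = to_circle (F y)" "t c = to_circle (F z)"
    using assms(1) yz(1,2) unfolding is_lift_def by (metis to_circle_pos)+
  ultimately show ?thesis by simp
qed

lemma thompson_inj: "is_lift F t \<Longrightarrow> inj t"
proof (rule injI)
  fix a b assume F: "is_lift F t" and eq: "t a = t b"
  have "to_circle (F (pos a)) = to_circle (F (pos b))" using F eq unfolding is_lift_def by (metis to_circle_pos)
  then obtain l where "F (pos a) - F (pos b) = of_int l" by (auto simp: to_circle_eq_iff elim: Ints_cases)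
  then have "F (pos a) = F (pos b + of_int l)" using lift_add_int[of F "pos b" l] F by (simp add: is_lift_def)
  then have "pos a = pos b + of_int l" using F unfolding is_lift_def by (metis strict_mono_eq)
  then show "a = b" by (metis to_circle_add_int to_circle_pos)
qed

lemma thompson_preserving:
  assumes "thompson_map t"
  shows "preserving t"
proof -
  obtain F n where "is_lift F t" "dyadic_affine F n" using thompson_mapE[OF assms] .
  then show ?thesis using thompson_cyc by (simp add: preserving_def)
qed

text \<open>A base arc of level above \<open>n\<close> spans a cell on which the lift is affine, so
  its image is a standard arc of positive level; only arcs with ends in \<open>grid n\<close> can
  leave \<open>E\<close>.\<close>

lemma thompson_adm:
  assumes "thompson_map t"
  shows "adm t"
proof -
  obtain F n where F: "is_lift F t" "dyadic_affine F n" using thompson_mapE[OF assms] .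
  have t: "\<And>x. t (to_circle x) = to_circle (F x)" using F(1) by (simp add: is_lift_def)
  have "bij_betw t D D"
    using thompson_inj[OF F(1)] assms unfolding bij_betw_def thompson_map_def by (metis inj_on_subset subset_UNIV)
  moreover have "act t E - E \<subseteq> act t (Pow (grid n))"
  proof
    fix B assume "B \<in> act t E - E"
    then obtain A where A: "A \<in> E" "t ` A \<notin> E" and B: "B = t ` A" by blast
    obtain p a where pa: "A = stdarc p a" "p \<ge> 1" using A(1) by (auto simp: base_eq)
    have "p \<le> n"
    proof (rule ccontr)
      assume "\<not> p \<le> n"
      then have p: "p = n + (p - n)" "p - n \<ge> 1" by simp_all
      obtain m j where mj: "m \<ge> p - n" "affine_cell F (n + (p - n)) a m j"
        by (rule dyadic_affine_refine[OF F(2)])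
      then have "t ` stdarc p a = stdarc m j"
        using affine_cell_stdarc[of F p a m j t] t p(1) by simp
      moreover have "m \<ge> 1" using mj(1) p(2) by simp
      ultimately show False using A(2) pa(1) by auto
    qed
    then have "A \<subseteq> grid n" using pa(1) stdarc_subset_grid grid_mono by blast
    then show "B \<in> act t (Pow (grid n))" using B by blast
  qed
  then have "finite (act t E - E)" by (rule finite_subset) (simp add: finite_grid)
  ultimately show ?thesis using thompson_preserving[OF assms] by (simp add: adm_def)
qed

section \<open>The reflection as an admissible map\<close>

lemma reflection_to_circle [simp]: "reflection (to_circle x) = to_circle (- x)"
  by (rule reflection.abs_eq)

lemma reflection_reflection [simp]: "reflection (reflection c) = c"
proof -
  have "reflection (reflection (to_circle (pos c))) = to_circle (pos c)" by (simp only: reflection_to_circle minus_minus)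
  then show ?thesis by simp
qed

lemma reflection_reversing: "reversing reflection"
proof -
  have "cyc (reflection c) (reflection b) (reflection a)" if h: "cyc a b c" for a b c
  proof -
    have "cyc (to_circle (pos a)) b c" using h by simp
    then obtain y z where yz: "b = to_circle y" "c = to_circle z" "pos a < y" "y < z" "z < pos a + 1"
      by (rule cyc_lift)
    then have "cyc (to_circle (- z)) (to_circle (- y)) (to_circle (- pos a))" by (intro cyc_to_circle) auto
    moreover have "reflection a = to_circle (- pos a)" by (metis reflection_to_circle to_circle_pos)
    ultimately show ?thesis using yz by simp
  qed
  then show ?thesis by (simp add: reversing_def)
qed

lemma dyadic_uminus: "x \<in> dyadic \<Longrightarrow> - x \<in> dyadic"
proof -
  assume "x \<in> dyadic"
  then obtain a n where "x = of_int a / 2 ^ n" by (auto simp: dyadic_def)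
  then have "- x = of_int (- a) / 2 ^ n" by simp
  then show ?thesis using dyadicI by metis
qed

lemma reflection_dyadic: "c \<in> D \<Longrightarrow> reflection c \<in> D"
  using dyadic_uminus by (auto simp: dyadic_points_def)

lemma reflection_stdarc: "reflection ` stdarc n i = stdarc n (- i - 1)"
proof -
  have "- (of_int i / 2 ^ n) = (of_int (- i - 1) + 1) / (2 :: real) ^ n"
    "- ((of_int i + 1) / 2 ^ n) = of_int (- i - 1) / (2 :: real) ^ n"
    unfolding minus_divide_left by simp_all
  then show ?thesis
    unfolding stdarc_def image_insert image_empty reflection_to_circle by (simp only: insert_commute)
qed

lemma act_reflection_subset: "act reflection E \<subseteq> E"
proof clarify
  fix A assume "A \<in> E"
  then obtain n i where "A = stdarc n i" "n \<ge> 1" by (auto simp: base_eq)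
  then show "reflection ` A \<in> E" unfolding reflection_stdarc by (simp add: stdarc_in_base reflection_stdarc)
qed

lemma reflection_adm: "adm reflection"
proof -
  have "bij_betw reflection D D"
    by (rule bij_betwI[of _ _ _ reflection]) (auto intro: reflection_dyadic)
  moreover have "act reflection E - E = {}" using act_reflection_subset by blast
  then have "finite (act reflection E - E)" by (simp only: finite.emptyI)
  ultimately show ?thesis using reflection_reversing by (simp add: adm_def)
qed

subsection \<open>Two generators\<close>

definition circle_map :: "(real \<Rightarrow> real) \<Rightarrow> circle \<Rightarrow> circle" where
  "circle_map F c = to_circle (F (pos c))"

lemma circle_map_to_circle:
  assumes "\<And>x. F (x + 1) = F x + 1"
  shows "circle_map F (to_circle x) = to_circle (F x)"
proof -
  have "F x = F (frac x + of_int \<lfloor>x\<rfloor>)" by (simp add: frac_def)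
  also have "\<dots> = F (frac x) + of_int \<lfloor>x\<rfloor>" using lift_add_int[of F "frac x" "\<lfloor>x\<rfloor>"] assms by simp
  finally show ?thesis by (simp add: circle_map_def)
qed

text \<open>The quarter turn exchanges the diagonals of the square \<open>0, 1/4, 1/2, 3/4\<close>
  and sends all finer base arcs to base arcs, so it realises a flip
  (\<open>act_rot_base\<close>).\<close>

definition rot_lift :: "real \<Rightarrow> real" where
  "rot_lift x = x + 1 / 4"

text \<open>Cycles the triangle with vertices \<open>0\<close>, \<open>1/2\<close>, \<open>3/4\<close>.\<close>

definition tri_lift :: "real \<Rightarrow> real" where
  "tri_lift x = of_int \<lfloor>x\<rfloor> +
     (if frac x \<le> 1 / 2 then frac x / 2 + 1 / 2 else if frac x \<le> 3 / 4 then frac x + 1 / 4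
      else 2 * frac x - 1 / 2)"

abbreviation "rot \<equiv> circle_map rot_lift"
abbreviation "tri \<equiv> circle_map tri_lift"

lemma rot_lift_cell: "affine_cell rot_lift 2 a 2 (a + 1)"
  by (auto simp: affine_cell_def rot_lift_def field_simps)

lemma tri_lift_cells:
  "affine_cell tri_lift 2 (4 * q) 3 (8 * q + 4)" "affine_cell tri_lift 2 (4 * q + 1) 3 (8 * q + 5)"
  "affine_cell tri_lift 2 (4 * q + 2) 2 (4 * q + 3)" "affine_cell tri_lift 2 (4 * q + 3) 1 (2 * q + 2)"
proof -
  have val: "tri_lift x = of_int q + (if x - of_int q \<le> 1 / 2 then (x - of_int q) / 2 + 1 / 2
      else if x - of_int q \<le> 3 / 4 then (x - of_int q) + 1 / 4 else 2 * (x - of_int q) - 1 / 2)"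
    if "of_int q \<le> x" "x \<le> of_int q + 1" for x
  proof (cases "x = of_int q + 1")
    case True
    then have "\<lfloor>x\<rfloor> = q + 1" "frac x = 0" by (simp_all add: frac_def)
    then show ?thesis using True by (simp add: tri_lift_def)
  next
    case False
    then have "\<lfloor>x\<rfloor> = q" using that by (simp add: floor_eq_iff)
    then show ?thesis by (simp add: tri_lift_def frac_def)
  qed
  show "affine_cell tri_lift 2 (4 * q) 3 (8 * q + 4)"
    unfolding affine_cell_def by (intro allI impI, subst val) (auto simp: field_simps)
  show "affine_cell tri_lift 2 (4 * q + 1) 3 (8 * q + 5)"
    unfolding affine_cell_def by (intro allI impI, subst val) (auto simp: field_simps)
  show "affine_cell tri_lift 2 (4 * q + 2) 2 (4 * q + 3)"
    unfolding affine_cell_def by (intro allI impI, subst val) (auto simp: field_simps)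
  show "affine_cell tri_lift 2 (4 * q + 3) 1 (2 * q + 2)"
    unfolding affine_cell_def by (intro allI impI, subst val) (auto simp: field_simps)
qed

lemma tri_lift_cell: "\<exists>m\<ge>1. \<exists>j. affine_cell tri_lift 2 a m j"
proof -
  have "a = 4 * (a div 4) + a mod 4" by simp
  moreover have "a mod 4 = 0 \<or> a mod 4 = 1 \<or> a mod 4 = 2 \<or> a mod 4 = 3" by presburger
  ultimately have "a = 4 * (a div 4) \<or> a = 4 * (a div 4) + 1 \<or> a = 4 * (a div 4) + 2 \<or> a = 4 * (a div 4) + 3"
    by presburger
  moreover have "(1 :: nat) \<le> 3" "(1 :: nat) \<le> 2" "(1 :: nat) \<le> 1" by simp_all
  ultimately show ?thesis using tri_lift_cells[of "a div 4"] by metis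
qed

lemma rot_lift_1: "rot_lift (x + 1) = rot_lift x + 1"
  by (simp add: rot_lift_def)

lemma tri_lift_1: "tri_lift (x + 1) = tri_lift x + 1"
  by (simp add: tri_lift_def frac_def)

lemmas rot_to_circle = circle_map_to_circle[of rot_lift, OF rot_lift_1]
lemmas tri_to_circle = circle_map_to_circle[of tri_lift, OF tri_lift_1]

lemma thompson_rot: "thompson_map rot"
proof (rule thompson_mapI[of rot_lift 2])
  show "dyadic_affine rot_lift 2" using rot_lift_cell unfolding dyadic_affine_def by blast
qed (fact rot_lift_1 rot_to_circle)+

lemma thompson_tri: "thompson_map tri"
proof (rule thompson_mapI[of tri_lift 2])
  show "dyadic_affine tri_lift 2" using tri_lift_cell unfolding dyadic_affine_def by blast
qed (fact tri_lift_1 tri_to_circle)+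

lemma thompson_id: "thompson_map id"
proof (rule thompson_mapI[of "\<lambda>x. x" 0])
  have "affine_cell (\<lambda>x. x) 0 a 0 a" for a by (simp add: affine_cell_def)
  then show "dyadic_affine (\<lambda>x. x) 0" by (auto simp: dyadic_affine_def)
qed simp_all

text \<open>Arcs of level \<open>n \<ge> 2\<close> refine a cell of level 2, so their images are
  standard of level \<open>m + (n - 2)\<close>. Only the single arc of level 1 remains to be checked
  by hand for \<open>rot\<close> and \<open>tri\<close>.\<close>

lemma stdarc_image_base:
  assumes "\<And>a. \<exists>m\<ge>1. \<exists>j. affine_cell F 2 a m j" "\<And>x. t (to_circle x) = to_circle (F x)" "n \<ge> 2"
  shows "t ` stdarc n b \<in> E"
proof -
  let ?k = "n - 2"
  obtain m j where mj: "m \<ge> 1" "affine_cell F 2 (b div 2 ^ ?k) m j" using assms(1) by blast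
  have "affine_cell F (2 + ?k) (b div 2 ^ ?k * 2 ^ ?k + b mod 2 ^ ?k) (m + ?k) (j * 2 ^ ?k + b mod 2 ^ ?k)"
    by (rule affine_cell_refine[OF mj(2)]) simp_all
  then have "affine_cell F n b (m + ?k) (j * 2 ^ ?k + b mod 2 ^ ?k)"
    unfolding div_mult_mod_eq using assms(3) by (simp only: le_add_diff_inverse)
  then have "t ` stdarc n b = stdarc (m + ?k) (j * 2 ^ ?k + b mod 2 ^ ?k)"
    using affine_cell_stdarc[of F n b "m + ?k" _ t] assms(2) by blast
  then show ?thesis using mj(1) by auto
qed

lemma stdarc_1: "stdarc 1 i = {to_circle 0, to_circle (1 / 2)}"
proof -
  have "i = i mod 2 + (i div 2) * 2 ^ 1" by simp
  then have "stdarc 1 i = stdarc 1 (i mod 2)" using stdarc_shift[of 1 "i mod 2" "i div 2"] by simp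
  moreover have "i mod 2 = 0 \<or> i mod 2 = 1" by presburger
  moreover have "stdarc 1 1 = {to_circle (1 / 2), to_circle (0 + 1)}" by (simp add: stdarc_def)
  moreover have "stdarc 1 0 = {to_circle 0, to_circle (1 / 2)}" by (simp add: stdarc_def)
  ultimately show ?thesis by (elim disjE) (simp_all only: to_circle_add_1 insert_commute)
qed

lemma tri_values: "tri (to_circle 0) = to_circle (1 / 2)" "tri (to_circle (1 / 2)) = to_circle (3 / 4)"
  "tri (to_circle (3 / 4)) = to_circle 0"
proof -
  show "tri (to_circle 0) = to_circle (1 / 2)" "tri (to_circle (1 / 2)) = to_circle (3 / 4)"
    unfolding tri_to_circle by (simp_all add: tri_lift_def frac_def)
  have "tri_lift (3 / 4) = 0 + 1" by (simp add: tri_lift_def frac_def)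
  then show "tri (to_circle (3 / 4)) = to_circle 0" unfolding tri_to_circle by (simp only: to_circle_add_1)
qed

lemma act_tri_base: "act tri E = E"
proof (rule comb_eqI[OF adm_comb[OF thompson_adm[OF thompson_tri] comb_base] comb_base])
  show "act tri E \<subseteq> E"
  proof clarify
    fix A assume "A \<in> E"
    then obtain n i where A: "A = stdarc n i" "n \<ge> 1" by (auto simp: base_eq)
    show "tri ` A \<in> E"
    proof (cases "n = 1")
      case True
      have "tri ` stdarc 1 i = {to_circle (1 / 2), to_circle (3 / 4)}" unfolding stdarc_1 by (simp add: tri_values)
      also have "\<dots> = stdarc 2 2" by (simp add: stdarc_def)
      finally show ?thesis using A True by auto
    next
      case False
      then show ?thesis using stdarc_image_base[of tri_lift tri n i] tri_lift_cell tri_to_circle A by simp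
    qed
  qed
qed

abbreviation "arc0 \<equiv> {to_circle 0, to_circle (1 / 2)}"

lemma quad_base: "quad E (to_circle 0) (to_circle (1 / 4)) (to_circle (1 / 2)) (to_circle (3 / 4))"
proof -
  have "{to_circle (3 / 4), to_circle (0 + 1)} = stdarc 2 3" by (simp add: stdarc_def)
  then have e: "{to_circle (3 / 4), to_circle 0} = stdarc 2 3" unfolding to_circle_add_1 .
  have s: "stdarc 2 0 = {to_circle 0, to_circle (1 / 4)}" "stdarc 2 1 = {to_circle (1 / 4), to_circle (1 / 2)}"
    "stdarc 2 2 = {to_circle (1 / 2), to_circle (3 / 4)}" by (simp_all add: stdarc_def)
  have "cyc (to_circle 0) (to_circle (1 / 4)) (to_circle (1 / 2))" by (intro cyc_to_circle) auto
  moreover have "cyc (to_circle (1 / 2)) (to_circle (3 / 4)) (to_circle (0 + 1))" by (intro cyc_to_circle) auto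
  then have "cyc (to_circle (1 / 2)) (to_circle (3 / 4)) (to_circle 0)" unfolding to_circle_add_1 .
  ultimately show ?thesis
    unfolding quad_def e s[symmetric] stdarc_1[of 0, symmetric] using comb_base by auto
qed

lemma arc0_base: "arc0 \<in> E"
  using quad_base by (simp add: quad_def)

text \<open>One inclusion suffices by \<open>comb_eqI\<close>. Arcs of level at least 2 go to base
  arcs, and none goes to \<open>arc0\<close>, because the image of \<open>arc0\<close> crosses
  \<open>arc0\<close>.\<close>

lemma act_rot_base: "act rot E = flip E arc0"
proof (rule comb_eqI[OF adm_comb[OF thompson_adm[OF thompson_rot] comb_base]])
  show "comb (flip E arc0)" by (rule quad_comb_flip[OF quad_base])
  have r0: "rot ` arc0 = {to_circle (1 / 4), to_circle (3 / 4)}"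
    by (simp add: rot_to_circle rot_lift_def)
  have "cross arc0 (rot ` arc0)" unfolding r0 by (rule quad_cross_dual[OF quad_base])
  then have no: "arc0 \<notin> act rot E"
    using comb_not_cross[OF adm_comb[OF thompson_adm[OF thompson_rot] comb_base]] arc0_base by blast
  show "act rot E \<subseteq> flip E arc0"
  proof clarify
    fix A assume "A \<in> E"
    then obtain n i where A: "A = stdarc n i" "n \<ge> 1" by (auto simp: base_eq)
    show "rot ` A \<in> flip E arc0"
    proof (cases "n = 1")
      case True
      then have "A = arc0" using A stdarc_1 by simp
      then show ?thesis unfolding quad_flip[OF quad_base] using r0 by simp
    next
      case False
      have "\<exists>m\<ge>1. \<exists>j. affine_cell rot_lift 2 a m j" for a using rot_lift_cell by (metis one_le_numeral)
      then have "rot ` A \<in> E" using stdarc_image_base[of rot_lift rot n i] rot_to_circle A False by simp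
      moreover have "rot ` A \<noteq> arc0" using no \<open>A \<in> E\<close> by blast
      ultimately show ?thesis unfolding quad_flip[OF quad_base] by blast
    qed
  qed
qed

text \<open>The half turn flips the same square twice. It exchanges the ends of \<open>arc0\<close>,
  which later reverses the direction of an arc (\<open>reach_swap\<close>).\<close>

lemma act_rot_rot_base: "act (rot \<circ> rot) E = E"
proof -
  have "act (rot \<circ> rot) E = act rot (flip E arc0)" unfolding act_comp act_rot_base ..
  also have "\<dots> = flip (flip E arc0) (rot ` arc0)"
    unfolding adm_flip[OF thompson_adm[OF thompson_rot] comb_base arc0_base] act_rot_base ..
  also have "rot ` arc0 = dual E arc0"
    unfolding quad_dual[OF quad_base] by (simp add: rot_to_circle rot_lift_def)
  finally show ?thesis using flip_props(7)[OF comb_base arc0_base] by simp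
qed

lemma rot_rot_values: "(rot \<circ> rot) (to_circle 0) = to_circle (1 / 2)" "(rot \<circ> rot) (to_circle (1 / 2)) = to_circle 0"
proof -
  show "(rot \<circ> rot) (to_circle 0) = to_circle (1 / 2)" by (simp add: rot_to_circle rot_lift_def)
  have "(rot \<circ> rot) (to_circle (1 / 2)) = to_circle (0 + 1)" by (simp add: rot_to_circle rot_lift_def)
  then show "(rot \<circ> rot) (to_circle (1 / 2)) = to_circle 0" unfolding to_circle_add_1 .
qed

subsection \<open>Connectivity under flips\<close>

definition flip_step :: "circle set set \<Rightarrow> circle set set \<Rightarrow> bool" where
  "flip_step v w \<longleftrightarrow> comb v \<and> (\<exists>A\<in>v. w = flip v A)"

text \<open>Flipping the arc crossing \<open>{a, b}\<close> closest to \<open>a\<close> yields an arc ending at \<open>a\<close>.\<close>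

lemma flip_towards:
  assumes "comb v" "a \<noteq> b" "finite {A \<in> v. cross A {a, b}}" "{A \<in> v. cross A {a, b}} \<noteq> {}"
  obtains A where "A \<in> v" "cross A {a, b}" "\<not> cross (dual v A) {a, b}"
proof -
  define S where "S = {(y, x). {x, y} \<in> v \<and> cyc a x b \<and> cyc b y a}"
  have "S \<subseteq> \<Union> {A \<in> v. cross A {a, b}} \<times> \<Union> {A \<in> v. cross A {a, b}}"
  proof clarify
    fix y x assume "(y, x) \<in> S"
    then have "{x, y} \<in> {A \<in> v. cross A {a, b}}" using cross_sym[of "{a, b}" "{x, y}"] by (auto simp: S_def cross_iff)
    then show "y \<in> \<Union> {A \<in> v. cross A {a, b}} \<and> x \<in> \<Union> {A \<in> v. cross A {a, b}}" by blast
  qed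
  moreover have "finite (\<Union> {A \<in> v. cross A {a, b}})"
    using assms(3) finite_arc comb_arcs[OF assms(1)] by blast
  ultimately have fin: "finite S" using finite_subset by blast
  obtain A where A: "A \<in> v" "cross A {a, b}" using assms(4) by blast
  then have "cross {a, b} A" using cross_sym by blast
  moreover obtain x y where xy: "A = {x, y}" using comb_arcs[OF assms(1) A(1)] by (rule arcE)
  ultimately have "cyc a x b \<and> cyc b y a \<or> cyc a y b \<and> cyc b x a" by (simp add: cross_iff)
  then have "(y, x) \<in> S \<or> (x, y) \<in> S" using A(1) xy by (auto simp: S_def insert_commute)
  then have "S \<noteq> {}" by blast
  define l where "l = (\<lambda>q. len (fst q) (snd q))"
  have "Min (l ` S) \<in> l ` S" using fin \<open>S \<noteq> {}\<close> by (intro Min_in) auto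
  then obtain q where "q \<in> S" "l q = Min (l ` S)" by auto
  moreover obtain y x where "q = (y, x)" by (cases q)
  ultimately have yx: "(y, x) \<in> S" "\<And>q'. q' \<in> S \<Longrightarrow> len y x \<le> l q'"
    using fin by (auto simp: l_def)
  then have S: "{y, x} \<in> v" "cyc a x b" "cyc b y a" by (auto simp: S_def insert_commute)
  obtain m n where q: "quad v y m x n" using quad_exists[OF assms(1) S(1)] .
  have m: "cyc y m x" "{y, m} \<in> v" "{m, x} \<in> v" using q by (simp_all add: quad_def)
  have "cyc y a x" using S unfolding cyc_def by linarith
  \<comment> \<open>Otherwise one of the two other sides of the triangle \<open>y, m, x\<close>
    would still cross \<open>{a, b}\<close> and be shorter than the minimal one.\<close>
  have "m = a"
  proof (rule ccontr)
    assume "m \<noteq> a"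
    then consider "cyc y m a" | "cyc a m x"
      using \<open>cyc y a x\<close> m(1) unfolding cyc_def pos_eq_iff[symmetric] by linarith
    then show False
    proof cases
      case 1
      then have "cyc b m a" using S unfolding cyc_def by linarith
      then have "(m, x) \<in> S" using S m by (simp add: S_def insert_commute)
      then have "len y x \<le> len m x" using yx(2) by (auto simp: l_def)
      then show False using cyc_len'[OF m(1)] by simp
    next
      case 2
      then have "cyc a m b" using S unfolding cyc_def by linarith
      then have "(y, m) \<in> S" using S m by (simp add: S_def insert_commute)
      then have "len y x \<le> len y m" using yx(2) by (auto simp: l_def)
      then show False using cyc_len[OF m(1)] by simp
    qed
  qed
  then have "dual v {y, x} = {a, n}" using quad_dual[OF q] by simp
  moreover have "\<not> cross {a, n} {a, b}" by (auto simp: cross_iff dest: cyc_distinct)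
  moreover have "cross {y, x} {a, b}" using S cross_sym[of "{a, b}" "{y, x}"] by (auto simp: cross_iff)
  ultimately show ?thesis using that S(1) by simp
qed

text \<open>Flips from \<open>flip_towards\<close> lower the number of arcs crossing
  \<open>B\<close> until \<open>B\<close> itself appears. The flipped arcs cross a base arc, so they
  are outside \<open>E\<close> and no base arc is lost on the way.\<close>

lemma flip_reach_more:
  assumes "comb v" "B \<in> E - v"
  shows "\<exists>w. flip_step\<^sup>*\<^sup>* v w \<and> comb w \<and> E - w \<subset> E - v"
  using assms
proof (induction "card {A \<in> v. cross A B}" arbitrary: v rule: less_induct)
  case less
  have c: "comb v" by (rule less.prems(1))
  have B: "B \<in> E" "B \<notin> v" using less.prems by auto
  obtain a b where ab: "B = {a, b}" "a \<noteq> b" using B(1) base_subset_arcs by (blast elim: arcE)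
  have sub: "{A \<in> v. cross A B} \<subseteq> v - E" using base_not_cross B(1) by blast
  then have fin: "finite {A \<in> v. cross A B}" using c by (auto simp: comb_def intro: finite_subset)
  have ne: "{A \<in> v. cross A B} \<noteq> {}" using comb_maximal[OF c] B base_subset_arcs by blast
  obtain A where A: "A \<in> v" "cross A B" "\<not> cross (dual v A) B"
    using flip_towards[OF c ab(2)] fin ne unfolding ab(1) by blast
  have step: "flip_step v (flip v A)" using c A(1) by (auto simp: flip_step_def)
  have c': "comb (flip v A)" by (rule flip_props(1)[OF c A(1)])
  have "A \<notin> E" using A sub by blast
  then have Esub: "E - flip v A \<subseteq> E - v" by (auto simp: flip_eq)
  show ?case
  proof (cases "B \<in> flip v A")
    case True
    then have "E - flip v A \<subset> E - v" using Esub B by blast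
    then show ?thesis using step c' by blast
  next
    case False
    have "{C \<in> flip v A. cross C B} \<subset> {C \<in> v. cross C B}"
    proof (rule psubsetI)
      show "{C \<in> flip v A. cross C B} \<subseteq> {C \<in> v. cross C B}" using A(3) by (auto simp: flip_eq)
      have "A \<notin> {C \<in> flip v A. cross C B}" using flip_props(5)[OF c A(1)] by blast
      then show "{C \<in> flip v A. cross C B} \<noteq> {C \<in> v. cross C B}" using A by blast
    qed
    then have "card {C \<in> flip v A. cross C B} < card {C \<in> v. cross C B}" by (rule psubset_card_mono[OF fin])
    then obtain w where w: "flip_step\<^sup>*\<^sup>* (flip v A) w" "comb w" "E - w \<subset> E - flip v A"
      using less.hyps[OF _ c'] False B(1) by blast
    then show ?thesis using step Esub by (meson converse_rtranclp_into_rtranclp psubset_subset_trans)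
  qed
qed

lemma flip_connected: "comb v \<Longrightarrow> flip_step\<^sup>*\<^sup>* v E"
proof (induction "card (E - v)" arbitrary: v rule: less_induct)
  case less
  show ?case
  proof (cases "E - v = {}")
    case True
    then have "E = v" using comb_eqI[OF comb_base less.prems] by blast
    then show ?thesis by simp
  next
    case False
    then obtain B where "B \<in> E - v" by blast
    then obtain w where w: "flip_step\<^sup>*\<^sup>* v w" "comb w" "E - w \<subset> E - v"
      using flip_reach_more[OF less.prems] by blast
    then have "card (E - w) < card (E - v)" using comb_finite[OF less.prems] by (intro psubset_card_mono)
    then have "flip_step\<^sup>*\<^sup>* w E" using less.hyps w(2) by blast
    then show ?thesis using w(1) by simp
  qed
qed

text \<open>A path of flips from \<open>v\<close> to \<open>E\<close> is read backwards, undoing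
  each flip by flipping the dual arc.\<close>

lemma flip_induct [consumes 1, case_names base flip]:
  assumes "comb v" "P E" "\<And>v A. comb v \<Longrightarrow> A \<in> v \<Longrightarrow> P v \<Longrightarrow> P (flip v A)"
  shows "P v"
  using flip_connected[OF assms(1)]
proof (induction rule: converse_rtranclp_induct)
  case (step y z)
  then obtain A where A: "comb y" "A \<in> y" "z = flip y A" by (auto simp: flip_step_def)
  note f = flip_props[OF A(1,2)]
  have "P (flip (flip y A) (dual y A))" using assms(3)[OF f(1,3)] step.IH A(3) by simp
  then show ?case using f(7) by simp
qed (rule assms(2))

subsection \<open>Transitivity of Thompson's group\<close>

abbreviation "pt n i \<equiv> to_circle (of_int i / 2 ^ n)"

lemma stdarc_pt: "stdarc n i = {pt n i, pt n (i + 1)}"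
  by (simp add: stdarc_def)

lemma pt_double: "pt (Suc n) (2 * i) = pt n i"
  by simp

lemma mid_triangle:
  assumes "n \<ge> 1"
  shows "cyc (pt n i) (pt (Suc n) (2 * i + 1)) (pt n (i + 1))"
    "{pt n i, pt n (i + 1)} \<in> E"
    "{pt n i, pt (Suc n) (2 * i + 1)} \<in> E" "{pt (Suc n) (2 * i + 1), pt n (i + 1)} \<in> E"
proof -
  have "(1 :: real) / 2 ^ n < 1" using assms by simp
  then show "cyc (pt n i) (pt (Suc n) (2 * i + 1)) (pt n (i + 1))"
    by (intro cyc_to_circle) (auto simp: field_simps)
  show "{pt n i, pt n (i + 1)} \<in> E" using stdarc_in_base[OF assms] by (simp only: stdarc_pt)
  have "stdarc (Suc n) (2 * i) \<in> E" "stdarc (Suc n) (2 * i + 1) \<in> E" by auto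
  moreover have "pt (Suc n) (2 * i + 1 + 1) = pt n (i + 1)"
    using pt_double[where n = n and i = "i + 1"] by (simp only: distrib_left mult_1_right add.assoc one_add_one)
  ultimately show "{pt n i, pt (Suc n) (2 * i + 1)} \<in> E" "{pt (Suc n) (2 * i + 1), pt n (i + 1)} \<in> E"
    unfolding stdarc_pt pt_double by simp_all
qed

text \<open>The aim is that the stabiliser of \<open>E\<close> in Thompson's group acts transitively
  on directed base arcs, starting from the arc from 0 to 1/2.\<close>

definition reach :: "circle \<Rightarrow> circle \<Rightarrow> bool" where
  "reach p q \<longleftrightarrow> (\<exists>u. thompson_map u \<and> act u E = E \<and> u (to_circle 0) = p \<and> u (to_circle (1 / 2)) = q)"

lemma reach_swap: "reach p q \<Longrightarrow> reach q p"
proof -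
  assume "reach p q"
  then obtain u where u: "thompson_map u" "act u E = E" "u (to_circle 0) = p" "u (to_circle (1 / 2)) = q"
    unfolding reach_def by blast
  have "thompson_map (u \<circ> (rot \<circ> rot))" using thompson_comp thompson_rot u(1) by blast
  moreover have "act (u \<circ> (rot \<circ> rot)) E = E" unfolding act_comp[of u] act_rot_rot_base by (rule u(2))
  moreover have "(u \<circ> (rot \<circ> rot)) (to_circle 0) = q" "(u \<circ> (rot \<circ> rot)) (to_circle (1 / 2)) = p"
    using rot_rot_values u(3,4) by (simp_all only: comp_apply)
  ultimately show ?thesis unfolding reach_def by blast
qed

lemma thompson_base_image:
  assumes "thompson_map u" "act u E = E" "{x, y} \<in> E"
  shows "{u x, u y} \<in> E"
proof -
  have "u ` {x, y} \<in> act u E" using assms(3) by (rule imageI)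
  then show ?thesis using assms(2) by simp
qed

lemma dyadic_base_points: "to_circle 0 \<in> D" "to_circle (1 / 4) \<in> D" "to_circle (1 / 2) \<in> D" "to_circle (3 / 4) \<in> D"
proof -
  have "{to_circle 0, to_circle (1 / 2)} \<in> arcs" "{to_circle 0, to_circle (1 / 4)} \<in> arcs" "{to_circle (3 / 4), to_circle 0} \<in> arcs"
    using quad_base base_subset_arcs unfolding quad_def by blast+
  then show "to_circle 0 \<in> D" "to_circle (1 / 4) \<in> D" "to_circle (1 / 2) \<in> D" "to_circle (3 / 4) \<in> D"
    by (simp_all add: arc_iff)
qed

text \<open>Precomposition with \<open>tri\<close> moves the marked side around the image of the
  triangle \<open>0, 1/2, 3/4\<close>; the third vertex of that image is \<open>m\<close> by
  uniqueness.\<close>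

lemma reach_triangle:
  assumes "reach p q" "cyc q m p" "{q, m} \<in> E" "{m, p} \<in> E"
  shows "reach q m" "reach m p"
proof -
  obtain u where u: "thompson_map u" "act u E = E" "u (to_circle 0) = p" "u (to_circle (1 / 2)) = q"
    using assms(1) unfolding reach_def by blast
  have cy: "cyc (to_circle (1 / 2)) (to_circle (3 / 4)) (to_circle 0)" using quad_base by (simp add: quad_def)
  have "cyc q (u (to_circle (3 / 4))) p"
    using thompson_preserving[OF u(1)] dyadic_base_points cy u(3,4) unfolding preserving_def by metis
  moreover have "{q, u (to_circle (3 / 4))} \<in> E" "{u (to_circle (3 / 4)), p} \<in> E"
    using thompson_base_image[OF u(1,2)] quad_base u(3,4) unfolding quad_def by metis+
  ultimately have m: "u (to_circle (3 / 4)) = m" using third_vertex_unique[OF comb_base] assms(2-4) by blast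
  have t1: "thompson_map (u \<circ> tri)" using thompson_comp thompson_tri u(1) by blast
  have a1: "act (u \<circ> tri) E = E" unfolding act_comp act_tri_base by (rule u(2))
  have v1: "(u \<circ> tri) (to_circle 0) = q" "(u \<circ> tri) (to_circle (1 / 2)) = m" "(u \<circ> tri) (to_circle (3 / 4)) = p"
    using tri_values u(3,4) m by (simp_all only: comp_apply)
  show "reach q m" using t1 a1 v1 unfolding reach_def by blast
  have "thompson_map (u \<circ> tri \<circ> tri)" using thompson_comp thompson_tri t1 by blast
  moreover have "act (u \<circ> tri \<circ> tri) E = E" unfolding act_comp[of _ tri] act_tri_base by (rule u(2))
  moreover have "(u \<circ> tri \<circ> tri) (to_circle 0) = m" "(u \<circ> tri \<circ> tri) (to_circle (1 / 2)) = p"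
    using tri_values v1 by (simp_all only: comp_apply)
  ultimately show "reach m p" unfolding reach_def by blast
qed

lemma reach_stdarc: "reach (pt (Suc n) i) (pt (Suc n) (i + 1))"
proof (induction n arbitrary: i)
  case 0
  have r0: "reach (to_circle 0) (to_circle (1 / 2))" unfolding reach_def using thompson_id by (intro exI[of _ id]) auto
  have "i = 2 * (i div 2) \<or> i = 2 * (i div 2) + 1" by presburger
  then show ?case
  proof
    assume i: "i = 2 * (i div 2)"
    define q where "q = i div 2"
    have "of_int i / 2 ^ Suc 0 = 0 + (of_int q :: real)" "of_int (i + 1) / 2 ^ Suc 0 = 1 / 2 + (of_int q :: real)"
      unfolding q_def by (subst i, simp add: field_simps)+
    then show ?case using r0 by (simp only: to_circle_add_int)
  next
    assume i: "i = 2 * (i div 2) + 1"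
    define q where "q = i div 2"
    have "of_int i / 2 ^ Suc 0 = 1 / 2 + (of_int q :: real)" "of_int (i + 1) / 2 ^ Suc 0 = 0 + (of_int (q + 1) :: real)"
      unfolding q_def by (subst i, simp add: field_simps)+
    then show ?case using reach_swap[OF r0] by (simp only: to_circle_add_int)
  qed
next
  case (Suc n)
  define j where "j = i div 2"
  have "1 \<le> Suc n" by simp
  note t = mid_triangle[OF this, of j]
  \<comment> \<open>\<open>reach_triangle\<close> uses the triangle on the interval from
    \<open>q\<close> to \<open>p\<close>; to descend into the dyadic interval, its arc has to be
    taken backwards.\<close>
  have sw: "reach (pt (Suc n) (j + 1)) (pt (Suc n) j)" using reach_swap Suc.IH by blast
  note r = reach_triangle[OF sw t(1,3,4)]
  have "i = 2 * j \<or> i = 2 * j + 1" unfolding j_def by presburger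
  then show ?case
  proof
    assume "i = 2 * j"
    then show ?thesis using r(1) by (simp only: pt_double)
  next
    assume i: "i = 2 * j + 1"
    then have "i + 1 = 2 * (j + 1)" by simp
    then show ?thesis using r(2) i by (simp only: pt_double)
  qed
qed

lemma reach_base_arc:
  assumes "{p, q} \<in> E"
  shows "reach p q"
proof -
  obtain n i where ni: "{p, q} = stdarc n i" "n \<ge> 1" using assms by (auto simp: base_eq)
  then obtain n' where n': "n = Suc n'" by (cases n) auto
  have "p = pt n i \<and> q = pt n (i + 1) \<or> p = pt n (i + 1) \<and> q = pt n i"
    using ni(1) unfolding stdarc_pt doubleton_eq_iff by blast
  then show ?thesis using reach_stdarc[where n = n' and i = i] reach_swap n' by blast
qed

text \<open>\<open>rot\<close> flips \<open>arc0\<close> in \<open>E\<close>; then \<open>u\<close>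
  carries \<open>arc0\<close> to the preimage of \<open>A\<close> while keeping \<open>E\<close>,
  and \<open>t\<close> carries \<open>E\<close> to \<open>v\<close>. The composite thus realises the
  flip at \<open>A\<close>.\<close>

lemma thompson_transitive: "comb v \<Longrightarrow> \<exists>t. thompson_map t \<and> act t E = v"
proof (induction rule: flip_induct)
  case base
  show ?case by (intro exI[of _ id] conjI) (rule thompson_id, simp)
next
  case (flip v A)
  then obtain t where t: "thompson_map t" "act t E = v" by blast
  then obtain B where B: "B \<in> E" "A = t ` B" using flip.hyps(2) by blast
  obtain p q where pq: "B = {p, q}" using B(1) base_subset_arcs by (blast elim: arcE)
  obtain u where u: "thompson_map u" "act u E = E" "u (to_circle 0) = p" "u (to_circle (1 / 2)) = q"
    using reach_base_arc[OF B(1)[unfolded pq]] unfolding reach_def by blast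
  have "act (t \<circ> u \<circ> rot) E = act t (act u (flip E arc0))"
    unfolding act_comp act_rot_base ..
  also have "act u (flip E arc0) = flip E B"
    unfolding adm_flip[OF thompson_adm[OF u(1)] comb_base arc0_base] u(2) pq using u(3,4) by simp
  also have "act t (flip E B) = flip v A"
    unfolding adm_flip[OF thompson_adm[OF t(1)] comb_base B(1)] t(2) B(2) ..
  finally have "act (t \<circ> u \<circ> rot) E = flip v A" .
  moreover have "thompson_map (t \<circ> u \<circ> rot)"
    by (intro thompson_comp t(1) u(1) thompson_rot)
  ultimately show ?case by blast
qed

text \<open>A map \<open>t\<close> from \<open>E\<close> to \<open>v\<close> is corrected by a
  stabiliser element placing 0 and 1/2 at the preimages of \<open>p\<close> and \<open>s\<close>;
  orientation and uniqueness of third vertices then place 1/4.\<close>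

lemma thompson_transitive_triangles:
  assumes "comb v" "cyc p q s" "{p, q} \<in> v" "{q, s} \<in> v" "{s, p} \<in> v"
  obtains t where "thompson_map t" "act t E = v" "t (to_circle 0) = p" "t (to_circle (1 / 4)) = q" "t (to_circle (1 / 2)) = s"
proof -
  obtain t where t: "thompson_map t" "act t E = v" using thompson_transitive[OF assms(1)] by blast
  note b = adm_bij[OF thompson_adm[OF t(1)]]
  note d = dinv[OF b]
  have D: "p \<in> D" "q \<in> D" "s \<in> D" using comb_arcs[OF assms(1)] assms(3,4) arc_iff by blast+
  have E: "{dinv t x, dinv t y} \<in> E" if xy: "{x, y} \<in> v" for x y
  proof -
    have "dinv t ` {x, y} \<in> act (dinv t) (act t E)" unfolding t(2) using xy by (rule imageI)
    then show ?thesis using dinv_act(1)[OF b base_subset_arcs] by simp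
  qed
  have c: "cyc (dinv t p) (dinv t q) (dinv t s)"
    using preserving_dinv[OF b thompson_preserving[OF t(1)]] D assms(2) by (simp add: preserving_def)
  have "{dinv t p, dinv t s} \<in> E" using E[OF assms(5)] by (simp add: insert_commute)
  then have "reach (dinv t p) (dinv t s)" by (rule reach_base_arc)
  then obtain u where u: "thompson_map u" "act u E = E" "u (to_circle 0) = dinv t p" "u (to_circle (1 / 2)) = dinv t s"
    unfolding reach_def by blast
  have "cyc (to_circle 0) (to_circle (1 / 4)) (to_circle (1 / 2))" using quad_base by (simp add: quad_def)
  then have "cyc (dinv t p) (u (to_circle (1 / 4))) (dinv t s)"
    using thompson_preserving[OF u(1)] dyadic_base_points u(3,4) unfolding preserving_def by metis
  moreover have "{dinv t p, u (to_circle (1 / 4))} \<in> E" "{u (to_circle (1 / 4)), dinv t s} \<in> E"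
    using thompson_base_image[OF u(1,2)] quad_base u(3,4) unfolding quad_def by metis+
  ultimately have "u (to_circle (1 / 4)) = dinv t q"
    using third_vertex_unique[OF comb_base _ _ _ c E[OF assms(3)] E[OF assms(4)]] by blast
  then have "(t \<circ> u) (to_circle 0) = p" "(t \<circ> u) (to_circle (1 / 4)) = q" "(t \<circ> u) (to_circle (1 / 2)) = s"
    using u(3,4) d(2) D by simp_all
  moreover have "thompson_map (t \<circ> u)" using thompson_comp t(1) u(1) by blast
  moreover have "act (t \<circ> u) E = v" unfolding act_comp u(2) by (rule t(2))
  ultimately show ?thesis using that by blast
qed

subsection \<open>Rigidity\<close>

lemma cellular_flip_image:
  assumes "cellular h" "comb v" "A \<in> v"
  obtains A' where "comb (h v)" "A' \<in> h v" "h (flip v A) = flip (h v) A'"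
proof -
  have "{v, flip v A} \<in> pants_edges" using assms by (auto simp: edge_iff)
  then have "h ` {v, flip v A} \<in> pants_edges" using assms(1) unfolding cellular_def by blast
  then have "comb (h v) \<and> (\<exists>A'\<in>h v. h (flip v A) = flip (h v) A')" by (simp add: edge_iff)
  then show ?thesis using that by blast
qed

text \<open>Adjacency to \<open>{a, b}\<close> leaves only \<open>{b, n}\<close> and
  \<open>{n, a}\<close> as images of these two arcs. They cannot be exchanged: after flipping
  \<open>{a, b}\<close>, the arc \<open>{m, b}\<close> is adjacent to \<open>{b, n}\<close> but
  opposite to \<open>{n, a}\<close>.\<close>

lemma cellular_fix_triangle:
  assumes "cellular h" "inj_on h (Collect comb)" "quad v a m b n" "h v = v"
    and fx: "h (flip v {a, b}) = flip v {a, b}" "h (flip v {a, m}) = flip v {a, m}" "h (flip v {m, b}) = flip v {m, b}"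
  shows "h (flip v {b, n}) = flip v {b, n}" "h (flip v {n, a}) = flip v {n, a}"
proof -
  note q = assms(3)[unfolded quad_def] and d = quad_distinct[OF assms(3)]
  have c: "comb v" using q by blast
  have ne: "A' \<noteq> B" if "h (flip v A) = flip v A'" "h (flip v B) = flip v B" "A \<noteq> B" "A \<in> v" "B \<in> v" for A A' B
  proof
    assume "A' = B"
    then have "h (flip v A) = h (flip v B)" using that by simp
    then have "flip v A = flip v B" using inj_onD[OF assms(2)] flip_props(1)[OF c] that by blast
    then show False using flip_inj[OF c] that by blast
  qed
  have cand: "\<exists>A'. A' \<in> v \<and> h (flip v A) = flip v A' \<and> A' \<in> {{b, n}, {n, a}}"
    if A: "A \<in> {{b, n}, {n, a}}" for A
  proof -
    have Av: "A \<in> v" "A \<noteq> {a, b}" "A \<noteq> {a, m}" "A \<noteq> {m, b}" using A q d by (auto simp: doubleton_eq_iff)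
    obtain A' where A': "A' \<in> v" "h (flip v A) = flip v A'"
      using cellular_flip_image[OF assms(1) c Av(1)] assms(4) by metis
    have n': "A' \<noteq> {a, b}" "A' \<noteq> {a, m}" "A' \<noteq> {m, b}"
      using ne[OF A'(2) fx(1)] ne[OF A'(2) fx(2)] ne[OF A'(2) fx(3)] Av q by blast+
    have "adj v {a, b} A" using quad_adj[OF assms(3) Av(1,2)] A by blast
    then have "adj v {a, b} A'"
      using cellular_adj[OF assms(1,2), of v "{a, b}" A v "{a, b}" A'] Av A' n' c q assms(4) fx(1)
      by (simp add: corner_def)
    then show ?thesis using quad_adj[OF assms(3) A'(1) n'(1)] A' n' by blast
  qed
  obtain X where X: "X \<in> v" "h (flip v {b, n}) = flip v X" "X \<in> {{b, n}, {n, a}}" using cand[of "{b, n}"] by blast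
  obtain Y where Y: "Y \<in> v" "h (flip v {n, a}) = flip v Y" "Y \<in> {{b, n}, {n, a}}" using cand[of "{n, a}"] by blast
  have s: "{b, n} \<noteq> {a, b}" "{m, b} \<noteq> {a, b}" "{n, a} \<noteq> {a, b}" "{b, n} \<noteq> {n, a}" "{m, b} \<noteq> {b, n}" "{m, b} \<noteq> {n, a}"
    using d by (auto simp: doubleton_eq_iff)
  have "X \<noteq> {n, a}"
  proof
    assume Xna: "X = {n, a}"
    let ?w = "flip v {a, b}"
    have co: "corner v {a, b} {m, b}" "corner v {a, b} {b, n}" "corner v {a, b} {n, a}"
      using q s c by (auto simp: corner_def)
    have w: "h ?w = ?w" by (rule fx(1))
    have h1: "h (flip ?w {m, b}) = flip ?w {m, b}"
      using cellular_flip_flip[OF assms(1,2) co(1) co(1) assms(4) fx(1) fx(3)] .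
    have h2: "h (flip ?w {b, n}) = flip ?w {n, a}"
      using cellular_flip_flip[OF assms(1,2) co(2) co(3) assms(4) fx(1)] X(2) Xna by simp
    have cw: "corner ?w {m, b} {b, n}" "corner ?w {m, b} {n, a}"
      using corner_flip[OF co(1)] corner_flip[OF co(2)] corner_flip[OF co(3)] s by (auto simp: corner_def)
    note qw = quad_flip_quad[OF assms(3)]
    have "{m, b, n} \<in> triangles ?w" using quad_triangles[OF qw] by blast
    then have "adj ?w {m, b} {b, n}" unfolding adj_def by (intro bexI[of _ "{m, b, n}"]) auto
    then have "adj ?w {m, b} {n, a}" using cellular_adj[OF assms(1,2) cw w h1 h2] by blast
    then obtain T where T: "T \<in> triangles ?w" "{m, b} \<subseteq> T" "{n, a} \<subseteq> T" unfolding adj_def by blast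
    then have "card T = 3" by (simp add: triangles_def dyadic_triangles_def)
    moreover have "{m, b, n, a} \<subseteq> T" "card {m, b, n, a} = 4" using T d by auto
    ultimately show False using card_mono[of T "{m, b, n, a}"] card_gt_0_iff[of T] by simp
  qed
  then have "X = {b, n}" using X by blast
  then show bn: "h (flip v {b, n}) = flip v {b, n}" using X by simp
  have "Y \<noteq> {b, n}" using ne[OF Y(2) bn] s q by blast
  then show "h (flip v {n, a}) = flip v {n, a}" using Y by auto
qed

text \<open>\<open>cellular_fix_triangle\<close> passes from a triangle to its neighbour, first
  across \<open>arc0\<close> and then down the dyadic levels. The larger triangle at an arc has
  sides of that level and of the level above, so the induction carries two consecutive
  levels.\<close>

lemma cellular_rigid_base:
  assumes "cellular h" "inj_on h (Collect comb)" "h E = E"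
    and "h (flip E arc0) = flip E arc0"
    and "h (flip E {to_circle 0, to_circle (1 / 4)}) = flip E {to_circle 0, to_circle (1 / 4)}"
    and "h (flip E {to_circle (1 / 4), to_circle (1 / 2)}) = flip E {to_circle (1 / 4), to_circle (1 / 2)}"
    and "A \<in> E"
  shows "h (flip E A) = flip E A"
proof -
  define fixed where "fixed A \<longleftrightarrow> h (flip E A) = flip E A" for A
  have step: "fixed {b, n} \<and> fixed {n, a}" if "quad E a m b n" "fixed {a, b}" "fixed {a, m}" "fixed {m, b}" for a m b n
    using cellular_fix_triangle[OF assms(1,2) that(1) assms(3)] that(2-4) unfolding fixed_def by blast
  have f0: "fixed arc0" "fixed {to_circle 0, to_circle (1 / 4)}" "fixed {to_circle (1 / 4), to_circle (1 / 2)}"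
    using assms(4-6) by (simp_all add: fixed_def)
  have f1: "fixed {to_circle (1 / 2), to_circle (3 / 4)}" "fixed {to_circle (3 / 4), to_circle 0}"
    using step[OF quad_base f0] by auto
  have 2: "fixed (stdarc 2 i)" for i
  proof -
    have "i = i mod 4 + (i div 4) * 2 ^ 2" by simp
    then have e: "stdarc 2 i = stdarc 2 (i mod 4)" using stdarc_shift[of 2 "i mod 4" "i div 4"] by simp
    have s: "stdarc 2 0 = {to_circle 0, to_circle (1 / 4)}" "stdarc 2 1 = {to_circle (1 / 4), to_circle (1 / 2)}"
      "stdarc 2 2 = {to_circle (1 / 2), to_circle (3 / 4)}" "stdarc 2 3 = {to_circle (3 / 4), to_circle (0 + 1)}"
      by (simp_all add: stdarc_def)
    have "i mod 4 = 0 \<or> i mod 4 = 1 \<or> i mod 4 = 2 \<or> i mod 4 = 3" by presburger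
    then show ?thesis unfolding e using s f0 f1 unfolding to_circle_add_1 by (elim disjE) simp_all
  qed
  have all: "(\<forall>i. fixed (stdarc (Suc n) i)) \<and> (\<forall>i. fixed (stdarc (Suc (Suc n)) i))" for n
  proof (induction n)
    case 0
    have "fixed (stdarc (Suc 0) i)" for i using f0(1) stdarc_1[of i] by simp
    moreover have "fixed (stdarc (Suc (Suc 0)) i)" for i using 2[of i] by (simp add: numeral_2_eq_2)
    ultimately show ?case by blast
  next
    case (Suc n)
    let ?N = "Suc (Suc n)"
    have "fixed (stdarc (Suc ?N) i)" for i
    proof -
      define j where "j = i div 2"
      define k where "k = j div 2"
      define l m r where "l = pt ?N j" "m = pt (Suc ?N) (2 * j + 1)" "r = pt ?N (j + 1)"
      have t: "cyc l m r" "{l, r} \<in> E" "{l, m} \<in> E" "{m, r} \<in> E"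
        using mid_triangle[of ?N j] unfolding l_m_r_def by simp_all
      have IH: "fixed {pt (Suc n) x, pt (Suc n) (x + 1)}" "fixed {pt ?N x, pt ?N (x + 1)}" for x
        using Suc.IH by (simp_all only: stdarc_pt)
      \<comment> \<open>Third vertex on the outer side of \<open>{l, r}\<close>: the end of the
        parent interval not shared by the half from \<open>l\<close> to \<open>r\<close>.\<close>
      define g where "g = (if j = 2 * k then pt (Suc n) (k + 1) else pt (Suc n) k)"
      note u = mid_triangle[of "Suc n" k]
      have jk: "j = 2 * k \<or> j = 2 * k + 1" unfolding k_def by presburger
      have g: "cyc r g l \<and> {r, g} \<in> E \<and> {g, l} \<in> E \<and> fixed {r, g} \<and> fixed {g, l}"
        using jk
      proof
        assume j: "j = 2 * k"
        have e: "l = pt (Suc n) k" "r = pt ?N (2 * k + 1)" "g = pt (Suc n) (k + 1)" "pt ?N (j + 1 + 1) = g"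
        proof -
          show "l = pt (Suc n) k" unfolding l_m_r_def j by (rule pt_double)
          show "r = pt ?N (2 * k + 1)" unfolding l_m_r_def j ..
          show g: "g = pt (Suc n) (k + 1)" using j by (simp only: g_def if_True simp_thms)
          have "j + 1 + 1 = 2 * (k + 1)" using j by simp
          then show "pt ?N (j + 1 + 1) = g" unfolding g by (simp only: pt_double)
        qed
        have "fixed {r, g}" using IH(2)[of "j + 1"] unfolding e(4) l_m_r_def(3)[symmetric] .
        moreover have "fixed {g, l}" using IH(1)[of k] unfolding e(1,3) by (simp only: insert_commute)
        moreover have "cyc r g l" using u(1) cyc_rotate unfolding e by simp
        moreover have "{r, g} \<in> E" "{g, l} \<in> E" using u unfolding e by (simp_all only: insert_commute le_add1 plus_1_eq_Suc One_nat_def)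
        ultimately show ?thesis by blast
      next
        assume j: "j = 2 * k + 1"
        have e: "l = pt ?N (2 * k + 1)" "r = pt (Suc n) (k + 1)" "g = pt (Suc n) k" "pt ?N (j - 1) = g"
        proof -
          show "l = pt ?N (2 * k + 1)" unfolding l_m_r_def j ..
          have "j + 1 = 2 * (k + 1)" using j by simp
          then show "r = pt (Suc n) (k + 1)" unfolding l_m_r_def by (simp only: pt_double)
          have "j \<noteq> 2 * k" using j by simp
          then show g: "g = pt (Suc n) k" by (simp only: g_def if_False simp_thms)
          have "j - 1 = 2 * k" using j by simp
          then show "pt ?N (j - 1) = g" unfolding g by (simp only: pt_double)
        qed
        have "fixed {g, l}" using IH(2)[of "j - 1"] unfolding e(4) l_m_r_def(1) by simp
        moreover have "fixed {r, g}" using IH(1)[of k] unfolding e(2,3) by (simp only: insert_commute)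
        moreover have "cyc r g l" using u(1) cyc_rotate unfolding e by simp
        moreover have "{r, g} \<in> E" "{g, l} \<in> E" using u unfolding e by (simp_all only: insert_commute le_add1 plus_1_eq_Suc One_nat_def)
        ultimately show ?thesis by blast
      qed
      have "quad E r g l m" unfolding quad_def using g t comb_base by (simp add: insert_commute)
      moreover have "fixed {r, l}" using IH(2)[of j] unfolding l_m_r_def(1,3)[symmetric] by (simp only: insert_commute)
      ultimately have f: "fixed {l, m}" "fixed {m, r}" using step[of r g l m] g by blast+
      have "i = 2 * j \<or> i = 2 * j + 1" unfolding j_def by presburger
      then show ?thesis
      proof
        assume i: "i = 2 * j"
        show ?thesis unfolding stdarc_pt i pt_double using f(1) unfolding l_m_r_def .
      next
        assume i: "i = 2 * j + 1"
        then have "i + 1 = 2 * (j + 1)" by simp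
        then show ?thesis using f(2) unfolding l_m_r_def stdarc_pt by (simp only: i[symmetric] pt_double)
      qed
    qed
    then show ?case using Suc.IH by blast
  qed
  obtain n i where "A = stdarc n i" "n \<ge> 1" using assms(7) by (auto simp: base_eq)
  moreover then obtain n' where "n = Suc n'" by (cases n) auto
  ultimately show ?thesis using all[of n'] unfolding fixed_def by blast
qed

text \<open>The induction must carry a vertex together with all its flips:
  \<open>cellular_flip_flip\<close> then determines the flips at each neighbour.\<close>

lemma cellular_rigid:
  assumes "cellular h" "inj_on h (Collect comb)" "h E = E" "\<And>A. A \<in> E \<Longrightarrow> h (flip E A) = flip E A" "comb v"
  shows "h v = v"
proof -
  have "h v = v \<and> (\<forall>A\<in>v. h (flip v A) = flip v A)"
    using assms(5)
  proof (induction rule: flip_induct)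
    case base
    then show ?case using assms(3,4) by blast
  next
    case (flip v A)
    have "h (flip (flip v A) B) = flip (flip v A) B" if B: "B \<in> flip v A" for B
    proof (cases "B = dual v A")
      case True
      then show ?thesis using flip flip_props(7) by simp
    next
      case False
      then have "corner v A B" using B flip by (auto simp: corner_def flip_eq)
      then show ?thesis using cellular_flip_flip[OF assms(1,2)] flip unfolding corner_def by blast
    qed
    then show ?case using flip by blast
  qed
  then show ?thesis by blast
qed

subsection \<open>The isomorphism\<close>

text \<open>In the pentagon around \<open>A\<close> and \<open>B\<close>, the only further arc
  adjacent to both is the third side \<open>{r, s}\<close> of their common triangle.\<close>

lemma clique_triangle:
  assumes "comb v" "A \<in> v" "B \<in> v" "C \<in> v" "A \<noteq> B" "B \<noteq> C" "A \<noteq> C"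
    and "adj v A B" "adj v A C" "adj v B C"
  obtains x y z where "A = {x, y}" "B = {y, z}" "C = {x, z}" "distinct [x, y, z]"
proof -
  obtain p q r s t where p: "pent v p q r s t" "A = {p, r} \<and> B = {p, s} \<or> A = {p, s} \<and> B = {p, r}"
    using pent_exists[OF assms(1-3,5,8)] .
  note d = pent_distinct[OF p(1)] and qd = pent_quads[OF p(1)]
  have C: "C \<noteq> {p, r}" "C \<noteq> {p, s}" using p(2) assms(6,7) by auto
  have a: "adj v {p, r} C" "adj v {p, s} C" using p(2) assms(9,10) by auto
  have "C \<in> {{p, q}, {q, r}, {r, s}, {s, p}}" by (rule iffD1[OF quad_adj[OF qd(1) assms(4) C(1)] a(1)])
  moreover have "C \<in> {{p, r}, {r, s}, {s, t}, {t, p}}" by (rule iffD1[OF quad_adj[OF qd(2) assms(4) C(2)] a(2)])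
  ultimately have "C = {r, s}" using d C by (auto simp: doubleton_eq_iff)
  then show ?thesis using p(2) that[of r p s] that[of s p r] d by (auto simp: insert_commute)
qed

text \<open>The map attached to the pair \<open>(t, k)\<close> of the semidirect product:
  \<open>t\<close> after the \<open>k\<close>-th power of the reflection, with \<open>k\<close>
  being 0 or 1.\<close>

definition twist :: "(circle \<Rightarrow> circle) \<Rightarrow> int \<Rightarrow> circle \<Rightarrow> circle" where
  "twist t k = (if k = 0 then t else t \<circ> reflection)"

lemma adm_twist: "thompson_map t \<Longrightarrow> adm (twist t k)"
  using thompson_adm adm_comp reflection_adm by (simp add: twist_def)

lemma thompson_gamma:
  assumes "thompson_map t"
  shows "thompson_map (gamma_R t)"
proof -
  obtain F n where F: "is_lift F t" "dyadic_affine F n" using thompson_mapE[OF assms] .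
  show ?thesis
  \<comment> \<open>The lift conjugated by negation; negation sends the interval with number
    \<open>a\<close> to the one with number \<open>- a - 1\<close>.\<close>
  proof (rule thompson_mapI[of "\<lambda>x. - F (- x)" n])
    show "dyadic_affine (\<lambda>x. - F (- x)) n"
      unfolding dyadic_affine_def
    proof
      fix a
      obtain m j where mj: "affine_cell F n (- a - 1) m j" using F(2) unfolding dyadic_affine_def by blast
      have "affine_cell (\<lambda>x. - F (- x)) n a m (- j - 1)"
        unfolding affine_cell_def
      proof (intro allI impI)
        fix x :: real assume x: "of_int a / 2 ^ n \<le> x" "x \<le> (of_int a + 1) / 2 ^ n"
        then have "of_int (- a - 1) / 2 ^ n \<le> - x" "- x \<le> (of_int (- a - 1) + 1) / 2 ^ n"
          by (simp_all add: field_simps)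
        then have "F (- x) = (of_int j + (2 ^ n * (- x) - of_int (- a - 1))) / 2 ^ m"
          using mj unfolding affine_cell_def by blast
        then show "- F (- x) = (of_int (- j - 1) + (2 ^ n * x - of_int a)) / 2 ^ m"
          by (simp add: field_simps)
      qed
      then show "\<exists>m j. affine_cell (\<lambda>x. - F (- x)) n a m j" by blast
    qed
    show "- F (- (x + 1)) = - F (- x) + 1" for x
    proof -
      have "F (- x) = F (- x - 1 + 1)" by simp
      also have "\<dots> = F (- x - 1) + 1" using F(1) unfolding is_lift_def by blast
      finally show ?thesis by simp
    qed
    show "gamma_R t (to_circle x) = to_circle (- F (- x))" for x
      using F(1) by (simp add: gamma_R_def is_lift_def)
  qed
qed

lemma dyadic_dense:
  fixes x :: real
  assumes "e > 0"
  obtains y where "y \<in> dyadic" "dist y x < e"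
proof -
  obtain n where n: "(1 / 2) ^ n < e" using real_arch_pow_inv[of e "1 / 2"] assms by auto
  let ?y = "of_int \<lfloor>2 ^ n * x\<rfloor> / (2 :: real) ^ n"
  have "?y \<le> x" "x < ?y + 1 / 2 ^ n"
    using floor_cell[where n = n and x = x] by (simp_all add: add_divide_distrib)
  then have "dist ?y x < e" using n by (simp add: dist_real_def power_one_over)
  then show ?thesis using that dyadicI by blast
qed

text \<open>The points where the two lifts differ by an integer form a closed set containing the
  dense set of dyadic numbers.\<close>

lemma thompson_eqI:
  assumes "thompson_map t" "thompson_map u" "\<And>c. c \<in> D \<Longrightarrow> t c = u c"
  shows "t = u"
proof
  fix c
  obtain F n where F: "is_lift F t" "dyadic_affine F n" using thompson_mapE[OF assms(1)] .
  obtain G m where G: "is_lift G u" "dyadic_affine G m" using thompson_mapE[OF assms(2)] .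
  define S where "S = {x. F x - G x \<in> \<int>}"
  have "closed S"
  proof -
    have "continuous_on UNIV (\<lambda>x. F x - G x)"
      using F(1) G(1) unfolding is_lift_def by (intro continuous_intros) auto
    then have "closed ((\<lambda>x. F x - G x) -` \<int>)"
      by (rule closed_vimage[OF closed_Ints])
    then show ?thesis by (simp add: S_def vimage_def)
  qed
  have "x \<in> S" if "x \<in> dyadic" for x
  proof -
    have "to_circle (F x) = to_circle (G x)"
      using assms(3)[of "to_circle x"] that to_circle_dyadic_iff F(1) G(1) unfolding is_lift_def by metis
    then show ?thesis by (simp add: S_def to_circle_eq_iff)
  qed
  then have "\<exists>y\<in>S. dist y x < e" if "e > 0" for x e :: real
    using dyadic_dense[OF that] by metis
  then have "x \<in> closure S" for x unfolding closure_approachable by blast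
  then have "pos c \<in> S" using \<open>closed S\<close> by (metis closure_closed)
  then have "t (to_circle (pos c)) = u (to_circle (pos c))"
    using F(1) G(1) by (simp add: S_def is_lift_def to_circle_eq_iff del: to_circle_pos)
  then show "t c = u c" by simp
qed

text \<open>Comparing flips of \<open>E\<close> recovers the image of every base arc from the action
  on vertices. A dyadic point is the common end of two base arcs, whose images determine its
  image.\<close>

lemma adm_act_eq_imp:
  assumes "adm g" "adm g'" "\<And>v. comb v \<Longrightarrow> act g v = act g' v" "x \<in> D"
  shows "g x = g' x"
proof -
  have arc: "g ` A = g' ` A" if A: "A \<in> E" for A
  proof -
    have "flip (act g E) (g ` A) = act g (flip E A)" using adm_flip[OF assms(1) comb_base A] by simp
    also have "\<dots> = act g' (flip E A)" by (rule assms(3)[OF flip_props(1)[OF comb_base A]])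
    also have "\<dots> = flip (act g E) (g' ` A)" using adm_flip[OF assms(2) comb_base A] assms(3)[OF comb_base] by simp
    finally have "flip (act g E) (g ` A) = flip (act g E) (g' ` A)" .
    moreover have "g ` A \<in> act g E" using A by blast
    moreover have "g' ` A \<in> act g E" unfolding assms(3)[OF comb_base] using A by blast
    ultimately show ?thesis by (intro flip_inj[OF adm_comb[OF assms(1) comb_base]])
  qed
  obtain n i where "x = pt n i" using assms(4) by (auto simp: dyadic_points_eq grid_def)
  define k where "k = i * 2"
  have "x = pt (Suc n) k" unfolding k_def \<open>x = pt n i\<close> using pt_double[where n = n and i = i] by (simp only: mult.commute)
  define y z where "y = pt (Suc n) (k + 1)" "z = pt (Suc (Suc n)) (2 * k + 1)"
  have "1 \<le> Suc n" by simp
  note t = mid_triangle[OF this, of k, folded \<open>x = pt (Suc n) k\<close> y_z_def]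
  have "y \<noteq> z" using cyc_distinct[OF t(1)] by blast
  moreover have "y \<in> D" "z \<in> D" using t base_subset_arcs arc_iff by blast+
  ultimately have "g' y \<noteq> g' z" using adm_inj[OF assms(2)] by (auto dest: inj_onD)
  moreover have "{g x, g y} = {g' x, g' y}" "{g x, g z} = {g' x, g' z}"
    using arc[OF t(2)] arc[OF t(3)] by simp_all
  ultimately show ?thesis by (auto simp: doubleton_eq_iff)
qed

lemma preserving_not_reversing: "preserving g \<Longrightarrow> \<not> reversing g"
proof
  assume "preserving g" "reversing g"
  moreover have "cyc (to_circle 0) (to_circle (1 / 4)) (to_circle (1 / 2))" using quad_base by (simp add: quad_def)
  ultimately have "cyc (g (to_circle 0)) (g (to_circle (1 / 4))) (g (to_circle (1 / 2)))"
    "cyc (g (to_circle (1 / 2))) (g (to_circle (1 / 4))) (g (to_circle 0))"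
    using dyadic_base_points unfolding preserving_def reversing_def by blast+
  then show False using cyc_asym by blast
qed

text \<open>Preserving or reversing the cyclic order reveals \<open>k\<close>; then \<open>t\<close>
  is known on dyadic points and hence everywhere.\<close>

lemma twist_inj:
  assumes "thompson_map t" "thompson_map t'" "k \<in> {0, 1}" "k' \<in> {0, 1}"
    and "\<And>v. comb v \<Longrightarrow> act (twist t k) v = act (twist t' k') v"
  shows "t = t' \<and> k = k'"
proof -
  have eq: "twist t k x = twist t' k' x" if "x \<in> D" for x
    using adm_act_eq_imp[OF adm_twist[OF assms(1)] adm_twist[OF assms(2)] assms(5) that] .
  have pres: "preserving t" "preserving t'" using thompson_preserving assms by blast+
  have rev: "reversing (t \<circ> reflection)" "reversing (t' \<circ> reflection)"
    using preserving_comp(2)[of reflection t, OF reflection_dyadic pres(1) reflection_reversing]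
      preserving_comp(2)[of reflection t', OF reflection_dyadic pres(2) reflection_reversing] by blast+
  have cong: "preserving g \<longleftrightarrow> preserving g'" if "\<And>x. x \<in> D \<Longrightarrow> g x = g' x" for g g'
    using that by (simp add: preserving_def)
  have "k = k'"
    using cong[of "twist t k" "twist t' k'"] eq assms(3,4) pres rev preserving_not_reversing
    by (auto simp: twist_def)
  moreover have "t c = t' c" if c: "c \<in> D" for c
  proof (cases "k = 0")
    case True
    then show ?thesis using eq[OF c] \<open>k = k'\<close> by (simp add: twist_def)
  next
    case False
    then show ?thesis using eq[OF reflection_dyadic[OF c]] \<open>k = k'\<close> by (simp add: twist_def)
  qed
  ultimately show ?thesis using thompson_eqI[OF assms(1,2)] by blast
qed

abbreviation "V \<equiv> pants_vertices"

lemma comb_V: "v \<in> V \<longleftrightarrow> comb v"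
  by (simp add: pants_vertices_eq)

lemma adm_bij_V: "adm g \<Longrightarrow> bij_betw (act g) V V"
proof (rule bij_betwI[of _ _ _ "act (dinv g)"])
  assume g: "adm g"
  show "act g \<in> V \<rightarrow> V" using adm_comb[OF g] by (simp add: comb_V)
  show "act (dinv g) \<in> V \<rightarrow> V" using adm_comb[OF adm_dinv[OF g]] by (simp add: comb_V)
  show "act (dinv g) (act g v) = v" "act g (act (dinv g) v) = v" if "v \<in> V" for v
    using dinv_act[OF adm_bij[OF g]] that comb_arcs_subset by (simp_all add: comb_V)
qed

lemma adm_aut: "adm g \<Longrightarrow> restrict (act g) V \<in> carrier Aut_pants_complex"
proof -
  assume g: "adm g"
  have b: "bij_betw (restrict (act g) V) V V" using adm_bij_V[OF g] by (simp add: bij_betw_restrict_eq)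
  have "cellular (restrict (act g) V)"
    using cellular_cong[of "restrict (act g) V" "act g"] adm_cellular[OF g] by (simp add: comb_V)
  moreover have "inv_into V (restrict (act g) V) v = act (dinv g) v" if v: "comb v" for v
  proof (rule inv_into_f_eq)
    show "inj_on (restrict (act g) V) V" using b by (simp add: bij_betw_def)
    show "act (dinv g) v \<in> V" using adm_comb[OF adm_dinv[OF g] v] by (simp add: comb_V)
    then show "restrict (act g) V (act (dinv g) v) = v"
      using dinv_act(2)[OF adm_bij[OF g] comb_arcs_subset[OF v]] by simp
  qed
  then have "cellular (inv_into V (restrict (act g) V))"
    using cellular_cong adm_cellular[OF adm_dinv[OF g]] by metis
  ultimately show ?thesis using b by (simp add: Aut_pants_complex_def Bij_def)
qed

lemma cellular_comp:
  assumes "cellular f" "cellular g"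
  shows "cellular (g \<circ> f)"
  unfolding cellular_def
proof (intro conjI ballI)
  fix e assume "e \<in> pants_edges"
  then have "g ` f ` e \<in> pants_edges" using assms by (simp add: cellular_def)
  then show "(g \<circ> f) ` e \<in> pants_edges" by (simp only: image_comp)
next
  fix c assume "c \<in> two_cells"
  then have "(`) g ` (`) f ` c \<in> two_cells" using assms by (simp add: cellular_def)
  moreover have "(`) (g \<circ> f) = (`) g \<circ> (`) f" by (simp only: fun_eq_iff comp_apply image_comp simp_thms)
  ultimately show "(`) (g \<circ> f) ` c \<in> two_cells" by (simp only: image_comp)
qed

text \<open>The composite of \<open>f\<close> with the inverse of \<open>g\<close> fixes
  \<open>E\<close> and the flips of the three sides of one triangle, so rigidity applies.\<close>

lemma aut_eq_act:
  assumes "f \<in> carrier Aut_pants_complex" "adm g" "f E = act g E"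
    and "f (flip E arc0) = act g (flip E arc0)"
    and "f (flip E {to_circle 0, to_circle (1 / 4)}) = act g (flip E {to_circle 0, to_circle (1 / 4)})"
    and "f (flip E {to_circle (1 / 4), to_circle (1 / 2)}) = act g (flip E {to_circle (1 / 4), to_circle (1 / 2)})"
  shows "f = restrict (act g) V"
proof -
  have f: "f \<in> extensional V" "bij_betw f V V" "cellular f"
    using assms(1) by (auto simp: Aut_pants_complex_def Bij_def)
  define h where "h = act (dinv g) \<circ> f"
  note gi = adm_dinv[OF assms(2)]
  have "cellular h"
    unfolding h_def by (rule cellular_comp[OF f(3) adm_cellular[OF gi]])
  moreover have inj: "inj_on h (Collect comb)"
    using bij_betw_trans[OF f(2) adm_bij_V[OF gi]] unfolding h_def pants_vertices_eq bij_betw_def by blast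
  moreover have h: "h v = v" if "comb v" "f v = act g v" for v
    using dinv_act(1)[OF adm_bij[OF assms(2)] comb_arcs_subset[OF that(1)]] that(2) by (simp add: h_def)
  moreover have fl: "comb (flip E A)" if "A \<in> E" for A using flip_props(1)[OF comb_base that] .
  have arcs: "arc0 \<in> E" "{to_circle 0, to_circle (1 / 4)} \<in> E" "{to_circle (1 / 4), to_circle (1 / 2)} \<in> E"
    using quad_base by (simp_all add: quad_def)
  ultimately have "h (flip E A) = flip E A" if "A \<in> E" for A
    using cellular_rigid_base[of h A] that assms(3-6) comb_base fl by simp
  then have hid: "h v = v" if "comb v" for v
    using cellular_rigid[of h v] \<open>cellular h\<close> inj h[OF comb_base assms(3)] that by blast
  show ?thesis
  proof
    fix v
    show "f v = restrict (act g) V v"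
    proof (cases "comb v")
      case True
      have "comb (f v)" using f(2) True by (metis bij_betwE comb_V)
      then have "f v = act g (h v)"
        unfolding h_def using dinv_act(2)[OF adm_bij[OF assms(2)] comb_arcs_subset] by simp
      then show ?thesis using hid[OF True] True by (simp add: comb_V)
    next
      case False
      then show ?thesis using f(1) by (simp add: comb_V extensional_def)
    qed
  qed
qed

lemma base_triangle_adj:
  "adj E {to_circle 0, to_circle (1 / 4)} {to_circle (1 / 4), to_circle (1 / 2)}"
  "adj E {to_circle 0, to_circle (1 / 4)} arc0" "adj E {to_circle (1 / 4), to_circle (1 / 2)} arc0"
proof -
  have T: "{to_circle 0, to_circle (1 / 4), to_circle (1 / 2)} \<in> triangles E"
    using quad_triangles[OF quad_base] by blast
  then show "adj E {to_circle 0, to_circle (1 / 4)} {to_circle (1 / 4), to_circle (1 / 2)}"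
    "adj E {to_circle 0, to_circle (1 / 4)} arc0" "adj E {to_circle (1 / 4), to_circle (1 / 2)} arc0"
    unfolding adj_def by (intro bexI[OF _ T]; simp)+
qed

text \<open>The flips of the sides of the base triangle \<open>0, 1/4, 1/2\<close> go to flips of
  three pairwise adjacent arcs, which bound a triangle \<open>x, y, z\<close>. If it is positively
  oriented, a Thompson map matches it; otherwise one matches its mirror image.\<close>

lemma aut_surj:
  assumes "f \<in> carrier Aut_pants_complex"
  obtains t k where "thompson_map t" "k \<in> {0, 1}" "f = restrict (act (twist t k)) V"
proof -
  have f: "bij_betw f V V" "cellular f"
    using assms by (auto simp: Aut_pants_complex_def Bij_def)
  then have inj: "inj_on f (Collect comb)" by (simp add: bij_betw_def pants_vertices_eq)
  let ?A = "{to_circle 0, to_circle (1 / 4)}" and ?B = "{to_circle (1 / 4), to_circle (1 / 2)}"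
  have arcs: "arc0 \<in> E" "?A \<in> E" "?B \<in> E" using quad_base by (simp_all add: quad_def)
  have dist: "to_circle 0 \<noteq> to_circle (1 / 4)" "to_circle (1 / 4) \<noteq> to_circle (1 / 2)" "to_circle 0 \<noteq> to_circle (1 / 2)"
    using quad_distinct[OF quad_base] by auto
  then have ne: "?A \<noteq> ?B" "?A \<noteq> arc0" "?B \<noteq> arc0" by (auto simp: doubleton_eq_iff)
  define w where "w = f E"
  have w: "comb w" using f(1) comb_base bij_betwE unfolding w_def pants_vertices_eq by blast
  obtain A where A: "A \<in> w" "f (flip E ?A) = flip w A" using cellular_flip_image[OF f(2) comb_base arcs(2)] unfolding w_def .
  obtain B where B: "B \<in> w" "f (flip E ?B) = flip w B" using cellular_flip_image[OF f(2) comb_base arcs(3)] unfolding w_def .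
  obtain C where C: "C \<in> w" "f (flip E arc0) = flip w C" using cellular_flip_image[OF f(2) comb_base arcs(1)] unfolding w_def .
  have neq: "X' \<noteq> Y'" if h: "X \<in> E" "Y \<in> E" "X \<noteq> Y" "f (flip E X) = flip w X'" "f (flip E Y) = flip w Y'" for X Y X' Y'
  proof
    assume "X' = Y'"
    then have "f (flip E X) = f (flip E Y)" using h by simp
    then have "flip E X = flip E Y" using inj_onD[OF inj] flip_props(1)[OF comb_base] h(1,2) by blast
    then show False using flip_inj[OF comb_base] h(1-3) by blast
  qed
  have n': "A \<noteq> B" "B \<noteq> C" "A \<noteq> C"
    using neq[OF arcs(2,3) ne(1) A(2) B(2)] neq[OF arcs(3,1) ne(3) B(2) C(2)] neq[OF arcs(2,1) ne(2) A(2) C(2)] by blast+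
  have co: "corner E ?A ?B" "corner E ?A arc0" "corner E ?B arc0" "corner w A B" "corner w A C" "corner w B C"
    using arcs ne comb_base n' w A(1) B(1) C(1) by (simp_all add: corner_def)
  have adj: "adj w A B" "adj w A C" "adj w B C"
    using cellular_adj[OF f(2) inj co(1,4) w_def[symmetric] A(2) B(2) base_triangle_adj(1)]
      cellular_adj[OF f(2) inj co(2,5) w_def[symmetric] A(2) C(2) base_triangle_adj(2)]
      cellular_adj[OF f(2) inj co(3,6) w_def[symmetric] B(2) C(2) base_triangle_adj(3)] by blast+
  obtain x y z where xyz: "A = {x, y}" "B = {y, z}" "C = {x, z}" "distinct [x, y, z]"
    using clique_triangle[OF w A(1) B(1) C(1) n' adj] .
  have fin: "f = restrict (act g) V"
    if g: "adm g" "act g E = w" "g (to_circle 0) = x" "g (to_circle (1 / 4)) = y" "g (to_circle (1 / 2)) = z" for g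
  proof (rule aut_eq_act[OF assms g(1)])
    show "f E = act g E" using g(2) by (simp add: w_def)
    show "f (flip E arc0) = act g (flip E arc0)"
      unfolding adm_flip[OF g(1) comb_base arcs(1)] g(2) C(2) xyz(3) using g by simp
    show "f (flip E ?A) = act g (flip E ?A)"
      unfolding adm_flip[OF g(1) comb_base arcs(2)] g(2) A(2) xyz(1) using g by simp
    show "f (flip E ?B) = act g (flip E ?B)"
      unfolding adm_flip[OF g(1) comb_base arcs(3)] g(2) B(2) xyz(2) using g by simp
  qed
  have D: "x \<in> D" "y \<in> D" "z \<in> D" using comb_arcs[OF w] A(1) B(1) xyz(1,2) arc_iff by blast+
  have "cyc x y z \<or> cyc z y x" using cyc_linear xyz(4) by simp
  then show ?thesis
  proof
    assume c: "cyc x y z"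
    have "{x, y} \<in> w" "{y, z} \<in> w" "{z, x} \<in> w" using A(1) B(1) C(1) xyz by (auto simp: insert_commute)
    then obtain t where t: "thompson_map t" "act t E = w" "t (to_circle 0) = x" "t (to_circle (1 / 4)) = y" "t (to_circle (1 / 2)) = z"
      using thompson_transitive_triangles[OF w c] by blast
    have "f = restrict (act (twist t 0)) V" using fin[OF thompson_adm[OF t(1)] t(2-5)] by (simp add: twist_def)
    then show ?thesis using that[of t 0] t(1) by simp
  next
    assume c: "cyc z y x"
    let ?w = "act reflection w"
    have c': "cyc (reflection x) (reflection y) (reflection z)"
      using reflection_reversing c D by (simp add: reversing_def)
    have i: "{reflection p, reflection q} \<in> ?w" if "{p, q} \<in> w" for p q
      using imageI[OF that, of "(`) reflection"] by simp
    have "{reflection x, reflection y} \<in> ?w" "{reflection y, reflection z} \<in> ?w" "{reflection z, reflection x} \<in> ?w"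
      using A(1) B(1) C(1) i xyz by (auto simp: insert_commute)
    then obtain u where u: "thompson_map u" "act u E = ?w" "u (to_circle 0) = reflection x"
      "u (to_circle (1 / 4)) = reflection y" "u (to_circle (1 / 2)) = reflection z"
      using thompson_transitive_triangles[OF adm_comb[OF reflection_adm w] c'] by blast
    \<comment> \<open>With \<open>r\<close> the reflection, \<open>r u r\<close> composed with
      \<open>r\<close> is \<open>r u\<close>, since \<open>r\<close> is an involution.\<close>
    have e: "twist (gamma_R u) 1 = reflection \<circ> u" by (simp add: twist_def gamma_R_def fun_eq_iff)
    have "act (reflection \<circ> u) E = act (reflection \<circ> reflection) w" unfolding act_comp u(2) ..
    also have "reflection \<circ> reflection = id" by (simp add: fun_eq_iff)
    finally have "act (reflection \<circ> u) E = w" by simp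
    moreover have "adm (reflection \<circ> u)" using adm_comp reflection_adm thompson_adm[OF u(1)] by blast
    ultimately have "f = restrict (act (twist (gamma_R u) 1)) V"
      unfolding e using fin[of "reflection \<circ> u"] u(3-5) by simp
    then show ?thesis using that[of "gamma_R u" 1] thompson_gamma[OF u(1)] by simp
  qed
qed

text \<open>The explicit bijection runs from the semidirect product to the automorphism group,
  against the direction of the claim; multiplicativity passes to its inverse.\<close>

lemma is_iso_if_inverse_hom:
  assumes "bij_betw \<phi> (carrier H) (carrier G)"
    and "\<And>a b. a \<in> carrier H \<Longrightarrow> b \<in> carrier H \<Longrightarrow> a \<otimes>\<^bsub>H\<^esub> b \<in> carrier H \<and> \<phi> (a \<otimes>\<^bsub>H\<^esub> b) = \<phi> a \<otimes>\<^bsub>G\<^esub> \<phi> b"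
  shows "G \<cong> H"
proof (rule is_isoI)
  let ?\<theta> = "inv_into (carrier H) \<phi>"
  have b: "bij_betw ?\<theta> (carrier G) (carrier H)" using assms(1) by (rule bij_betw_inv_into)
  have "?\<theta> (x \<otimes>\<^bsub>G\<^esub> y) = ?\<theta> x \<otimes>\<^bsub>H\<^esub> ?\<theta> y" if xy: "x \<in> carrier G" "y \<in> carrier G" for x y
  proof -
    have m: "?\<theta> x \<in> carrier H" "?\<theta> y \<in> carrier H" using b xy bij_betwE by blast+
    have "\<phi> (?\<theta> x) = x" "\<phi> (?\<theta> y) = y" using assms(1) xy by (simp_all add: bij_betw_inv_into_right)
    then have "x \<otimes>\<^bsub>G\<^esub> y = \<phi> (?\<theta> x \<otimes>\<^bsub>H\<^esub> ?\<theta> y)" using assms(2)[OF m] by simp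
    moreover have "?\<theta> (\<phi> (?\<theta> x \<otimes>\<^bsub>H\<^esub> ?\<theta> y)) = ?\<theta> x \<otimes>\<^bsub>H\<^esub> ?\<theta> y"
      using assms(2)[OF m] by (intro bij_betw_inv_into_left[OF assms(1)]) blast
    ultimately show ?thesis by simp
  qed
  then show "?\<theta> \<in> iso G H" using b by (auto simp: iso_def hom_def dest: bij_betwE)
qed

theorem theorem1:
  shows "Aut_pants_complex \<cong>
         semidirect_product thompson_T (integer_mod_group 2) (\<lambda>k. gamma_R ^^ nat k)"
proof (rule is_iso_if_inverse_hom)
  let ?H = "semidirect_product thompson_T (integer_mod_group 2) (\<lambda>k. gamma_R ^^ nat k)"
  let ?\<phi> = "\<lambda>(t, k). restrict (act (twist t k)) V"
  have H: "carrier ?H = {t. thompson_map t} \<times> {0, 1}"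
    by (auto simp: semidirect_product_def thompson_T_def carrier_integer_mod_group)
  show "bij_betw ?\<phi> (carrier ?H) (carrier Aut_pants_complex)"
  proof (rule bij_betw_imageI)
    show "inj_on ?\<phi> (carrier ?H)"
    proof (rule inj_onI)
      fix a b assume ab: "a \<in> carrier ?H" "b \<in> carrier ?H" "?\<phi> a = ?\<phi> b"
      obtain t k t' k' where e: "a = (t, k)" "b = (t', k')" by (cases a, cases b)
      have "act (twist t k) v = act (twist t' k') v" if "comb v" for v
        using fun_cong[OF ab(3)[unfolded e prod.case], of v] that by (simp add: comb_V)
      then show "a = b" using twist_inj[of t t' k k'] ab(1,2) unfolding e H by blast
    qed
    show "?\<phi> ` carrier ?H = carrier Aut_pants_complex"
    proof (intro equalityI subsetI)
      fix f assume "f \<in> ?\<phi> ` carrier ?H"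
      then show "f \<in> carrier Aut_pants_complex" unfolding H using adm_aut adm_twist by auto
    next
      fix f assume f: "f \<in> carrier Aut_pants_complex"
      obtain t k where tk: "thompson_map t" "k \<in> {0, 1}" "f = restrict (act (twist t k)) V"
        by (rule aut_surj[OF f])
      show "f \<in> ?\<phi> ` carrier ?H"
        unfolding H by (rule image_eqI[of _ _ "(t, k)"]) (use tk in simp_all)
    qed
  qed
  fix a b assume ab: "a \<in> carrier ?H" "b \<in> carrier ?H"
  obtain t k t' k' where e: "a = (t, k)" "b = (t', k')" by (cases a, cases b)
  have tk: "thompson_map t" "thompson_map t'" "k \<in> {0, 1}" "k' \<in> {0, 1}" using ab unfolding e H by auto
  define s l where "s = t \<circ> (gamma_R ^^ nat k) t'" "l = (k + k') mod 2"
  have mult: "a \<otimes>\<^bsub>?H\<^esub> b = (s, l)"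
    by (simp add: e semidirect_product_def thompson_T_def s_l_def)
  have "thompson_map ((gamma_R ^^ nat k) t')" using tk(2,3) thompson_gamma[OF tk(2)] by auto
  then have s: "thompson_map s" unfolding s_l_def using thompson_comp tk(1) by blast
  have l: "l \<in> {0, 1}" using tk(3,4) by (auto simp: s_l_def)
  \<comment> \<open>With \<open>r\<close> the reflection,
    \<open>t r^k t' r^k' = t (r^k t' r^k) r^(k + k')\<close>; the bracket is the action of
    \<open>k\<close> on \<open>t'\<close>, and \<open>r\<close> being an involution reduces the
    exponent modulo 2.\<close>
  have tw: "twist s l = twist t k \<circ> twist t' k'"
    using tk(3,4) by (auto simp: s_l_def twist_def gamma_R_def fun_eq_iff)
  have Bij: "restrict (act g) V \<in> Bij V" if "adm g" for g
    using adm_aut[OF that] by (simp add: Aut_pants_complex_def)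
  have "?\<phi> a \<otimes>\<^bsub>Aut_pants_complex\<^esub> ?\<phi> b = compose V (?\<phi> a) (?\<phi> b)"
    using Bij[OF adm_twist[OF tk(1)]] Bij[OF adm_twist[OF tk(2)]]
    by (simp add: e Aut_pants_complex_def BijGroup_def)
  also have "\<dots> = ?\<phi> (s, l)"
  proof
    fix v
    show "compose V (?\<phi> a) (?\<phi> b) v = ?\<phi> (s, l) v"
    proof (cases "v \<in> V")
      case True
      then have "act (twist t' k') v \<in> V" using adm_comb adm_twist[OF tk(2)] by (simp add: comb_V)
      then have "compose V (?\<phi> a) (?\<phi> b) v = act (twist t k) (act (twist t' k') v)"
        using True by (simp add: e compose_eq)
      also have "\<dots> = act (twist s l) v" unfolding tw act_comp ..
      finally show ?thesis using True by simp
    qed (simp add: e compose_def)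
  qed
  finally show "a \<otimes>\<^bsub>?H\<^esub> b \<in> carrier ?H \<and> ?\<phi> (a \<otimes>\<^bsub>?H\<^esub> b) = ?\<phi> a \<otimes>\<^bsub>Aut_pants_complex\<^esub> ?\<phi> b"
    unfolding mult H using s l by auto
qed

end
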